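(* Consider Algorithm IPALM_KKT($\mathcal A$) (described in the context). Assume that there is $\gamma>0$ such that $L_s\le\gamma\beta_s^{-1}$ for all $s\geq 0$. Then, for $\epsilon>0$, to obtain a solution such that $$\mathbb E[\operatorname{dist}(0,\partial_xL(x^s,\lambda^{s+1}))]\le\epsilon,\qquad\mathbb E[\operatorname{dist}(0,\partial_\lambda L(x^s,\lambda^{s+1}))]\le\epsilon,$$ it suffices to run the algorithm for $$s\ge\frac{\ln(c_4/\epsilon)}{\ln(1/\rho)}$$ outer iterations, where $$c_4:=\max\left(\sqrt{16\gamma\epsilon_0/\beta_0+8c_0\beta_0^2},\ \beta_0\sqrt{c_0}\right),\qquad c_0:=2\left(\|(x^{-1},\lambda^0)-(x^\star,\lambda^\star)\|+\frac{2\sqrt{\epsilon_0/\beta_0}}{1-\sqrt{\eta/\rho}}\right)^2+2\|\lambda^\star\|^2+2\|x^\star\|^2 .$$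
   Context: Setting. Let $d=d_1+d_2$; for $\lambda\in\mathbb R^d$ write $\lambda=(\lambda_1;\lambda_2)$ with $\lambda_i\in\mathbb R^{d_i}$. $\|\cdot\|$ is the Euclidean norm. $g:\mathbb R^n\to\mathbb R\cup\{+\infty\}$ and $h_1:\mathbb R^{d_1}\to\mathbb R$ are proper, convex, closed; $h_2$ is the indicator function of a nonempty closed convex set $\mathcal K\subset\mathbb R^{d_2}$; $f:\mathbb R^n\to\mathbb R\cup\{+\infty\}$ is convex and differentiable on an open set containing $\operatorname{dom}(g)$; $p_1:\mathbb R^n\to\mathbb R^{d_1}$, $p_2:\mathbb R^n\to\mathbb R^{d_2}$ are differentiable. Put $p(x)=(p_1(x);p_2(x))$, $\nabla p(x)\in\mathbb R^{n\times d}$ the transposed Jacobian, $h(u)=h_1(u_1)+h_2(u_2)$, $h^*$ the Fenchel conjugate, $F(x)=f(x)+g(x)+h_1(p_1(x))$. The primal problem is $\min_x f(x)+g(x)+h(p(x))$; the Lagrangian is $L(x;\lambda)=L(x,\lambda)=f(x)+g(x)+\langle\lambda,p(x)\rangle-h^*(\lambda)$, with $\partial_xL(x,\lambda)=\nabla f(x)+\partial g(x)+\nabla p(x)\lambda$, $\partial_\lambda L(x,\lambda)=p(x)-\partial h^*(\lambda)$; the dual problem is $\max_\lambda D(\lambda)$, $D(\lambda)=\inf_xL(x;\lambda)$. Standing assumptions: (a) $h_1$ is $L_{h_1}$-Lipschitz. (b) For all $x,y\in\mathbb R^n$, $u_1,v_1\in\mathbb R^{d_1}$, $\alpha\in(0,1)$: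 $h_1(p_1(\alpha x+(1-\alpha)y)-\alpha u_1-(1-\alpha)v_1)\le\alpha h_1(p_1(x)-u_1)+(1-\alpha)h_1(p_1(y)-v_1)$. (c) For all $x,y\in\mathbb R^n$, $u_2,v_2\in\mathbb R^{d_2}$, $\alpha\in(0,1)$ with $p_2(x)-u_2\in\mathcal K$, $p_2(y)-v_2\in\mathcal K$: $p_2(\alpha x+(1-\alpha)y)-\alpha u_2-(1-\alpha)v_2\in\mathcal K$. (d) Primal and dual have optimal solutions and strong duality holds: there are $x^\star\in\operatorname{dom}(g)$, $\lambda^\star\in\operatorname{dom}(h^* )$ with $p_2(x^\star)\in\mathcal K$ and $F(x^\star)=L(x^\star;\lambda^\star)=D(\lambda^\star)$. Below $x^\star,\lambda^\star$ are arbitrary primal and dual optimal solutions. Smoothing. For $u,\lambda\in\mathbb R^d$, $\beta>0$: $h(u;\lambda,\beta)=\max_v\{\langle v,u\rangle-h^*(v)-\frac\beta2\|v-\lambda\|^2\}$, $\Lambda(u;\lambda,\beta)$ is its unique maximizer, and $L(x;y,\lambda,\beta)=f(x)+g(x)+h(p(x);\lambda,\beta)+\frac\beta2\|x-y\|^2$. Algorithm IPALM_KKT($\mathcal A$). Parameters $\beta_0>0$, $\rho\in(1/2,1)$, $\eta\in(0,\rho^3]$, positive integer $m_0$, and constants $L_s>0$; initial (deterministic) $x^{-1}\in\operatorname{dom}(g)$, $\lambda^0\in\operatorname{dom}(h^* )$. Write $\beta_s=\beta_0\rho^s$, $\epsilon_s=\epsilon_0\eta^s$, $H_s(x)=L(x;x^{s-1},\lambda^s,\beta_s)$,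 $H_s^\star=\min_xH_s(x)$, $\phi_s(x)=f(x)+h(p(x);\lambda^s,\beta_s)$. The $L_s$ satisfy $\phi_s(y)-\phi_s(x)-\langle\nabla\phi_s(x),y-x\rangle\le\frac{L_s}2\|x-y\|^2$ for all $x,y\in\operatorname{dom}(g)$. Set $\tilde x^0=\mathcal A(x^{-1},m_0,H_0)$ and let $\epsilon_0>0$ be a constant with $\epsilon_0\ge H_0(\tilde x^0)-H_0^\star$. For $s=0,1,2,\dots$: $x^s=\arg\min_y\{\langle\nabla\phi_s(\tilde x^s),y-\tilde x^s\rangle+\frac{L_s}2\|y-\tilde x^s\|^2+\frac{\beta_s}2\|y-x^{s-1}\|^2+g(y)\}$; $\lambda^{s+1}=\Lambda(p(x^s);\lambda^s,\beta_s)$; $m_{s+1}$ is the smallest positive integer such that $2\epsilon_s+M_s\le2^{\lfloor m_{s+1}/K_{s+1}\rfloor}\epsilon_{s+1}/2$; $\tilde x^{s+1}=\mathcal A(x^s,m_{s+1},H_{s+1})$. Here $$M_s=\beta_s\|\lambda^{s+1}-\lambda^s\|^2+\tfrac{\beta_s-\beta_{s+1}}2\|\Lambda(p(x^s);\lambda^{s+1},\beta_{s+1})-\lambda^{s+1}\|^2+\tfrac{\beta_s^2}{2\beta_{s+1}-\beta_s}\|x^{s-1}-x^s\|^2$$ $$\qquad+\|\lambda^{s+1}-\lambda^s\|\sqrt{\left((\beta_s+\beta_{s+1})L_{h_1}+\|\beta_s\lambda_1^s-\beta_{s+1}\lambda_1^{s+1}\|\right)^2+\|\beta_s\lambda_2^s-\beta_{s+1}\lambda_2^{s+1}\|^2}.$$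 Inner solver. $\mathcal A(x,k,H_s)$ denotes the (possibly random) output of $k$ iterations of algorithm $\mathcal A$ on $\min H_s$ started at $x$. With $\mathcal F_s$ the $\sigma$-algebra generated by $\{x^t,\lambda^t:t\le s\}$, it is assumed that for every $s\ge0$ there is $K_s\ge1$ such that for every $x\in\operatorname{dom}(g)$ and every $k$ (both possibly $\mathcal F_{s-1}$-measurable), $\mathbb E[H_s(\mathcal A(x,k,H_s))-H_s^\star\mid\mathcal F_{s-1}]\le2^{-\lfloor k/K_s\rfloor}(H_s(x)-H_s^\star)$. *)

theory Defs
  imports "HOL-Probability.Probability"
begin

section \<open>Extended-real-valued convex analysis\<close>

definition edom :: "('a \<Rightarrow> ereal) \<Rightarrow> 'a set" where
  "edom f = {x. f x < \<infinity>}"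

definition eproper :: "('a \<Rightarrow> ereal) \<Rightarrow> bool" where
  "eproper f \<longleftrightarrow> (\<forall>x. f x \<noteq> -\<infinity>) \<and> edom f \<noteq> {}"

definition econvex :: "('a::real_vector \<Rightarrow> ereal) \<Rightarrow> bool" where
  "econvex f \<longleftrightarrow> (\<forall>x y. \<forall>t\<in>{0<..<1}.
     f (t *\<^sub>R x + (1 - t) *\<^sub>R y) \<le> ereal t * f x + ereal (1 - t) * f y)"

definition eclosed :: "('a::topological_space \<Rightarrow> ereal) \<Rightarrow> bool" where
  "eclosed f \<longleftrightarrow> closed {(x, r::real). f x \<le> ereal r}"

definition fenchel_conj :: "('a::real_inner \<Rightarrow> ereal) \<Rightarrow> 'a \<Rightarrow> ereal" where
  "fenchel_conj h v = (SUP u. ereal (v \<bullet> u) - h u)"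

definition subdiff :: "('a::real_inner \<Rightarrow> ereal) \<Rightarrow> 'a \<Rightarrow> 'a set" where
  "subdiff f x = {v. \<bar>f x\<bar> \<noteq> \<infinity> \<and> (\<forall>y. f x + ereal (v \<bullet> (y - x)) \<le> f y)}"

text \<open>Only meaningful at points near which \<open>f\<close> is finite and where it is differentiable.\<close>

definition egrad :: "('a::real_inner \<Rightarrow> ereal) \<Rightarrow> 'a \<Rightarrow> 'a" where
  "egrad f x = (THE D. GDERIV (\<lambda>y. real_of_ereal (f y)) x :> D)"

text \<open>The distance to the empty set is \<open>\<infinity>\<close>, whereas \<^term>\<open>infdist x {} = 0\<close> in the library.\<close>

definition edist_set :: "'a::metric_space \<Rightarrow> 'a set \<Rightarrow> ennreal" where
  "edist_set x A = (INF a\<in>A. ennreal (dist x a))"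

definition indicator_fun :: "'a set \<Rightarrow> 'a \<Rightarrow> ereal" where
  "indicator_fun C u = (if u \<in> C then 0 else \<infinity>)"


section \<open>The composite problem, its Lagrangian and its smoothing\<close>

text \<open>A vector of \<open>\<real>\<^sup>d\<close>, \<open>d = d\<^sub>1 + d\<^sub>2\<close>, is a pair; the norm and the inner product on
  pairs are the Euclidean ones.\<close>

definition split_h :: "('b \<Rightarrow> real) \<Rightarrow> 'c set \<Rightarrow> 'b \<times> 'c \<Rightarrow> ereal" where
  "split_h h1 \<K> u = ereal (h1 (fst u)) + indicator_fun \<K> (snd u)"

definition lagrangian ::
  "('a \<Rightarrow> ereal) \<Rightarrow> ('a \<Rightarrow> ereal) \<Rightarrow> ('d::real_inner \<Rightarrow> ereal) \<Rightarrow> ('a \<Rightarrow> 'd) \<Rightarrow> 'a \<Rightarrow> 'd \<Rightarrow> ereal" where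
  "lagrangian f g h p x l = f x + g x + ereal (l \<bullet> p x) - fenchel_conj h l"

definition dual_fun ::
  "('a \<Rightarrow> ereal) \<Rightarrow> ('a \<Rightarrow> ereal) \<Rightarrow> ('d::real_inner \<Rightarrow> ereal) \<Rightarrow> ('a \<Rightarrow> 'd) \<Rightarrow> 'd \<Rightarrow> ereal" where
  "dual_fun f g h p l = (INF x. lagrangian f g h p x l)"

text \<open>The transposed Jacobian of \<open>p\<close> at \<open>x\<close> is the adjoint of the Frechet derivative.\<close>

definition subdiff_lagrangian_x ::
  "('a::euclidean_space \<Rightarrow> ereal) \<Rightarrow> ('a \<Rightarrow> ereal) \<Rightarrow> ('a \<Rightarrow> 'd::euclidean_space) \<Rightarrow> 'a \<Rightarrow> 'd \<Rightarrow> 'a set" where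
  "subdiff_lagrangian_x f g p x l =
     {egrad f x + v + adjoint (frechet_derivative p (at x)) l | v. v \<in> subdiff g x}"

definition subdiff_lagrangian_dual ::
  "('d::real_inner \<Rightarrow> ereal) \<Rightarrow> ('a \<Rightarrow> 'd) \<Rightarrow> 'a \<Rightarrow> 'd \<Rightarrow> 'd set" where
  "subdiff_lagrangian_dual h p x l = {p x - v | v. v \<in> subdiff (fenchel_conj h) l}"

definition smoothing_obj :: "('d::real_inner \<Rightarrow> ereal) \<Rightarrow> 'd \<Rightarrow> 'd \<Rightarrow> real \<Rightarrow> 'd \<Rightarrow> ereal" where
  "smoothing_obj h u l b v =
     ereal (v \<bullet> u) - fenchel_conj h v - ereal (b / 2 * (norm (v - l))\<^sup>2)"

definition smoothed :: "('d::real_inner \<Rightarrow> ereal) \<Rightarrow> 'd \<Rightarrow> 'd \<Rightarrow> real \<Rightarrow> ereal" where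
  "smoothed h u l b = (SUP v. smoothing_obj h u l b v)"

definition smooth_argmax :: "('d::real_inner \<Rightarrow> ereal) \<Rightarrow> 'd \<Rightarrow> 'd \<Rightarrow> real \<Rightarrow> 'd" where
  "smooth_argmax h u l b = arg_max (smoothing_obj h u l b) (\<lambda>_. True)"

definition smooth_part ::
  "('a \<Rightarrow> ereal) \<Rightarrow> ('d::real_inner \<Rightarrow> ereal) \<Rightarrow> ('a \<Rightarrow> 'd) \<Rightarrow> 'd \<Rightarrow> real \<Rightarrow> 'a \<Rightarrow> ereal" where
  "smooth_part f h p l b x = f x + smoothed h (p x) l b"

definition prox_aug_lagrangian ::
  "('a::real_normed_vector \<Rightarrow> ereal) \<Rightarrow> ('a \<Rightarrow> ereal) \<Rightarrow> ('d::real_inner \<Rightarrow> ereal) \<Rightarrow> ('a \<Rightarrow> 'd) \<Rightarrow>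
     'a \<Rightarrow> 'd \<Rightarrow> real \<Rightarrow> 'a \<Rightarrow> ereal" where
  "prox_aug_lagrangian f g h p y l b x =
     f x + g x + smoothed h (p x) l b + ereal (b / 2 * (norm (x - y))\<^sup>2)"


section \<open>Standing assumptions on the problem\<close>

locale composite_data =
  fixes f g :: "real^'n \<Rightarrow> ereal"
    and h1 :: "real^'d1 \<Rightarrow> real"
    and \<K> :: "(real^'d2) set"
    and p1 :: "real^'n \<Rightarrow> real^'d1"
    and p2 :: "real^'n \<Rightarrow> real^'d2"
    and Lh1 :: real
begin

abbreviation "h \<equiv> split_h h1 \<K>"
abbreviation "p \<equiv> (\<lambda>x. (p1 x, p2 x))"

end

locale composite_problem = composite_data +
  assumes g_proper: "eproper g" and g_convex: "econvex g" and g_closed: "eclosed g"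
    and h1_proper: "eproper (\<lambda>u. ereal (h1 u))"
    and h1_convex: "econvex (\<lambda>u. ereal (h1 u))"
    and h1_closed: "eclosed (\<lambda>u. ereal (h1 u))"
    and K_nonempty: "\<K> \<noteq> {}" and K_closed: "closed \<K>" and K_convex: "convex \<K>"
    and f_not_minf: "\<And>x. f x \<noteq> -\<infinity>" and f_convex: "econvex f"
    and f_differentiable: "\<exists>U. open U \<and> edom g \<subseteq> U \<and>
      (\<forall>x\<in>U. f x < \<infinity> \<and> (\<lambda>y. real_of_ereal (f y)) differentiable (at x))"
    and p1_differentiable: "p1 differentiable_on UNIV"
    and p2_differentiable: "p2 differentiable_on UNIV"
    and h1_lipschitz: "Lh1-lipschitz_on UNIV h1"
    and h1_p1_convex: "\<And>x y u v \<alpha>. 0 < \<alpha> \<Longrightarrow> \<alpha> < 1 \<Longrightarrow>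
      h1 (p1 (\<alpha> *\<^sub>R x + (1 - \<alpha>) *\<^sub>R y) - \<alpha> *\<^sub>R u - (1 - \<alpha>) *\<^sub>R v)
        \<le> \<alpha> * h1 (p1 x - u) + (1 - \<alpha>) * h1 (p1 y - v)"
    and K_p2_convex: "\<And>x y u v \<alpha>. 0 < \<alpha> \<Longrightarrow> \<alpha> < 1 \<Longrightarrow> p2 x - u \<in> \<K> \<Longrightarrow> p2 y - v \<in> \<K> \<Longrightarrow>
      p2 (\<alpha> *\<^sub>R x + (1 - \<alpha>) *\<^sub>R y) - \<alpha> *\<^sub>R u - (1 - \<alpha>) *\<^sub>R v \<in> \<K>"
    and strong_duality: "\<exists>x l. x \<in> edom g \<and> l \<in> edom (fenchel_conj h) \<and> p2 x \<in> \<K> \<and>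
      f x + g x + ereal (h1 (p1 x)) = lagrangian f g h p x l \<and>
      lagrangian f g h p x l = dual_fun f g h p l"


section \<open>The algorithm\<close>

text \<open>
  \<open>M\<close> is the underlying probability space, \<open>xinit\<close> is the iterate of index \<open>-1\<close>, and \<open>xt s\<close> is
  the output of the inner solver in outer iteration \<open>s\<close>.  The \<open>s\<close>-th call of the solver is
  \<open>\<A> s \<omega> y k H\<close>: the result of \<open>k\<close> iterations on \<open>H\<close> started at \<open>y\<close>; the arguments \<open>s\<close> and \<open>\<omega>\<close>
  carry the randomness of that call.  The optimality gap of an output is \<open>[0,\<infinity>]\<close>-valued, hence the
  use of \<^const>\<open>nn_cond_exp\<close>; that constant is \<open>0\<close> on non-measurable integrands, but the gap is
  measurable because the outputs are, \<open>f + g\<close> is Borel and the smoothing terms are continuous.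
\<close>

locale ipalm_data = composite_data f g h1 \<K> p1 p2 Lh1
  for f g :: "real^'n \<Rightarrow> ereal"
    and h1 :: "real^'d1 \<Rightarrow> real"
    and \<K> :: "(real^'d2) set"
    and p1 :: "real^'n \<Rightarrow> real^'d1"
    and p2 :: "real^'n \<Rightarrow> real^'d2"
    and Lh1 :: real +
  fixes M :: "'w measure"
    and \<A> :: "nat \<Rightarrow> 'w \<Rightarrow> real^'n \<Rightarrow> nat \<Rightarrow> (real^'n \<Rightarrow> ereal) \<Rightarrow> real^'n"
    and \<beta>0 \<rho> \<eta> \<epsilon>0 :: real
    and m0 :: nat
    and L K :: "nat \<Rightarrow> real"
    and xinit :: "real^'n"
    and l0 :: "(real^'d1) \<times> (real^'d2)"
    and xt x :: "nat \<Rightarrow> 'w \<Rightarrow> real^'n"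
    and l :: "nat \<Rightarrow> 'w \<Rightarrow> (real^'d1) \<times> (real^'d2)"
    and m :: "nat \<Rightarrow> 'w \<Rightarrow> nat"
begin

definition \<beta> :: "nat \<Rightarrow> real" where "\<beta> s = \<beta>0 * \<rho> ^ s"

definition eps :: "nat \<Rightarrow> real" where "eps s = \<epsilon>0 * \<eta> ^ s"

definition xprev :: "nat \<Rightarrow> 'w \<Rightarrow> real^'n" where
  "xprev s \<omega> = (case s of 0 \<Rightarrow> xinit | Suc t \<Rightarrow> x t \<omega>)"

definition \<phi> :: "nat \<Rightarrow> 'w \<Rightarrow> real^'n \<Rightarrow> ereal" where
  "\<phi> s \<omega> = smooth_part f h p (l s \<omega>) (\<beta> s)"

definition H :: "nat \<Rightarrow> 'w \<Rightarrow> real^'n \<Rightarrow> ereal" where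
  "H s \<omega> = prox_aug_lagrangian f g h p (xprev s \<omega>) (l s \<omega>) (\<beta> s)"

definition Hmin :: "nat \<Rightarrow> 'w \<Rightarrow> ereal" where
  "Hmin s \<omega> = (INF y. H s \<omega> y)"

definition Ms :: "nat \<Rightarrow> 'w \<Rightarrow> real" where
  "Ms s \<omega> =
     \<beta> s * (norm (l (Suc s) \<omega> - l s \<omega>))\<^sup>2
     + (\<beta> s - \<beta> (Suc s)) / 2 *
         (norm (smooth_argmax h (p (x s \<omega>)) (l (Suc s) \<omega>) (\<beta> (Suc s)) - l (Suc s) \<omega>))\<^sup>2
     + (\<beta> s)\<^sup>2 / (2 * \<beta> (Suc s) - \<beta> s) * (norm (xprev s \<omega> - x s \<omega>))\<^sup>2
     + norm (l (Suc s) \<omega> - l s \<omega>) *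
         sqrt (((\<beta> s + \<beta> (Suc s)) * Lh1
                 + norm (\<beta> s *\<^sub>R fst (l s \<omega>) - \<beta> (Suc s) *\<^sub>R fst (l (Suc s) \<omega>)))\<^sup>2
               + (norm (\<beta> s *\<^sub>R snd (l s \<omega>) - \<beta> (Suc s) *\<^sub>R snd (l (Suc s) \<omega>)))\<^sup>2)"

text \<open>The \<open>\<sigma>\<close>-algebra generated by the iterates of index \<open>t < s\<close>, i.e. \<open>\<F>\<^bsub>s-1\<^esub>\<close>; it is trivial for
  \<open>s = 0\<close>, the initial data being deterministic.\<close>

definition past :: "nat \<Rightarrow> 'w measure" where
  "past s = sigma (space M)
     (\<Union>t\<in>{..<s}. {x t -` B \<inter> space M | B. B \<in> sets borel} \<union>
                  {l t -` B \<inter> space M | B. B \<in> sets borel})"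

end

locale ipalm_kkt =
  ipalm_data f g h1 \<K> p1 p2 Lh1 M \<A> \<beta>0 \<rho> \<eta> \<epsilon>0 m0 L K xinit l0 xt x l m +
  composite_problem f g h1 \<K> p1 p2 Lh1 +
  prob_space M
  for f g :: "real^'n \<Rightarrow> ereal"
    and h1 :: "real^'d1 \<Rightarrow> real"
    and \<K> :: "(real^'d2) set"
    and p1 :: "real^'n \<Rightarrow> real^'d1"
    and p2 :: "real^'n \<Rightarrow> real^'d2"
    and Lh1 :: real
    and M :: "'w measure"
    and \<A> :: "nat \<Rightarrow> 'w \<Rightarrow> real^'n \<Rightarrow> nat \<Rightarrow> (real^'n \<Rightarrow> ereal) \<Rightarrow> real^'n"
    and \<beta>0 \<rho> \<eta> \<epsilon>0 :: real
    and m0 :: nat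
    and L K :: "nat \<Rightarrow> real"
    and xinit :: "real^'n"
    and l0 :: "(real^'d1) \<times> (real^'d2)"
    and xt x :: "nat \<Rightarrow> 'w \<Rightarrow> real^'n"
    and l :: "nat \<Rightarrow> 'w \<Rightarrow> (real^'d1) \<times> (real^'d2)"
    and m :: "nat \<Rightarrow> 'w \<Rightarrow> nat" +
  assumes beta0_pos: "0 < \<beta>0"
    and rho_bounds: "1/2 < \<rho>" "\<rho> < 1"
    and eta_bounds: "0 < \<eta>" "\<eta> \<le> \<rho> ^ 3"
    and m0_pos: "0 < m0"
    and L_pos: "\<And>s. 0 < L s"
    and xinit_dom: "xinit \<in> edom g"
    and l0_dom: "l0 \<in> edom (fenchel_conj h)"
    and L_descent: "\<And>s \<omega> y z. \<omega> \<in> space M \<Longrightarrow> y \<in> edom g \<Longrightarrow> z \<in> edom g \<Longrightarrow>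
      \<phi> s \<omega> z - \<phi> s \<omega> y - ereal (egrad (\<phi> s \<omega>) y \<bullet> (z - y)) \<le> ereal (L s / 2 * (norm (y - z))\<^sup>2)"
    and x_measurable: "\<And>s. x s \<in> borel_measurable M"
    and l_measurable: "\<And>s. l s \<in> borel_measurable M"
    \<comment> \<open>the recursion\<close>
    and l_init: "\<And>\<omega>. \<omega> \<in> space M \<Longrightarrow> l 0 \<omega> = l0"
    and m_init: "\<And>\<omega>. \<omega> \<in> space M \<Longrightarrow> m 0 \<omega> = m0"
    and eps0_pos: "0 < \<epsilon>0"
    and eps0_bound: "AE \<omega> in M. H 0 \<omega> (xt 0 \<omega>) - Hmin 0 \<omega> \<le> ereal \<epsilon>0"
    and xt_step: "\<And>s \<omega>. \<omega> \<in> space M \<Longrightarrow> xt s \<omega> = \<A> s \<omega> (xprev s \<omega>) (m s \<omega>) (H s \<omega>)"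
    and x_step: "\<And>s \<omega>. \<omega> \<in> space M \<Longrightarrow>
      is_arg_min
        (\<lambda>y. ereal (egrad (\<phi> s \<omega>) (xt s \<omega>) \<bullet> (y - xt s \<omega>)
                    + L s / 2 * (norm (y - xt s \<omega>))\<^sup>2
                    + \<beta> s / 2 * (norm (y - xprev s \<omega>))\<^sup>2) + g y)
        (\<lambda>_. True) (x s \<omega>)"
    and l_step: "\<And>s \<omega>. \<omega> \<in> space M \<Longrightarrow>
      l (Suc s) \<omega> = smooth_argmax h (p (x s \<omega>)) (l s \<omega>) (\<beta> s)"
    and m_step: "\<And>s \<omega>. \<omega> \<in> space M \<Longrightarrow>
      m (Suc s) \<omega> =
        (LEAST k. 0 < k \<and> 2 * eps s + Ms s \<omega> \<le> 2 powi \<lfloor>real k / K (Suc s)\<rfloor> * eps (Suc s) / 2)"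
    \<comment> \<open>the inner solver: its outputs are random variables and it contracts in conditional mean\<close>
    and K_ge_1: "\<And>s. 1 \<le> K s"
    and solver_measurable: "\<And>s X k. X \<in> borel_measurable (past s) \<Longrightarrow>
      (\<And>\<omega>. \<omega> \<in> space M \<Longrightarrow> X \<omega> \<in> edom g) \<Longrightarrow> k \<in> measurable (past s) (count_space UNIV) \<Longrightarrow>
      (\<lambda>\<omega>. \<A> s \<omega> (X \<omega>) (k \<omega>) (H s \<omega>)) \<in> borel_measurable M"
    and solver_rate: "\<And>s X k. X \<in> borel_measurable (past s) \<Longrightarrow>
      (\<And>\<omega>. \<omega> \<in> space M \<Longrightarrow> X \<omega> \<in> edom g) \<Longrightarrow> k \<in> measurable (past s) (count_space UNIV) \<Longrightarrow>
      AE \<omega> in M.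
        nn_cond_exp M (past s) (\<lambda>\<omega>. e2ennreal (H s \<omega> (\<A> s \<omega> (X \<omega>) (k \<omega>) (H s \<omega>)) - Hmin s \<omega>)) \<omega>
        \<le> ennreal (2 powi (- \<lfloor>real (k \<omega>) / K s\<rfloor>)) * e2ennreal (H s \<omega> (X \<omega>) - Hmin s \<omega>)"

end

theory Submission
  imports Defs
begin

text \<open>
  Consider an outer iteration with parameter \<open>b\<close> that starts at \<open>(y, l)\<close>. The objective \<open>H\<close> of the
  inner problem is the maximum over \<open>v\<close> of
  \<open>S(x, v) = L(x; v) + b/2 |x - y|^2 - b/2 |v - l|^2\<close>, which is \<open>b\<close>-strongly convex in \<open>x\<close> and
  \<open>b\<close>-strongly concave in \<open>v\<close>; the convexity of \<open>x \<mapsto> v \<bullet> p x\<close> for \<open>v\<close> in the domain of \<open>h*\<close> follows from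
  the two convexity conditions on \<open>h1\<close> and \<open>\<K>\<close> (\<open>p_coupling_convex\<close>). The exact iteration therefore
  sends \<open>(y, l)\<close> to the saddle point \<open>J(y, l)\<close> of \<open>S\<close>. This is a resolvent step for the monotone operator
  whose zeros are the optimal pairs, so it is firmly nonexpansive towards each of them
  (\<open>saddle_step_firm\<close>). Moreover the optimality gap of \<open>H\<close> at \<open>x\<close> dominates \<open>b/2\<close> times the squared
  distance from \<open>(x, \<Lambda>(p x))\<close> to \<open>J(y, l)\<close>, in both variables together (\<open>aug_val_gap_lower\<close>). So the
  outer loop is an inexact proximal point method whose errors are controlled by the gaps of the inner
  problems.
  
  The gap at \<open>xt\<close> in iteration \<open>s\<close> is at most \<open>eps s\<close> in mean (\<open>mean_gap\<close>). Passing from the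
  parameters of one inner problem to those of the next turns a gap \<open>\<Delta>\<close> into at most \<open>2 \<Delta> + M_s\<close>
  (\<open>shifted_gap\<close>), and the number of inner iterations is chosen so that \<open>2 eps s + M_s\<close> is reduced to
  half of \<open>eps (s+1)\<close>; the conditional contraction of the solver closes the induction.
  
  In mean square, the distance to an optimal pair hence grows by at most a multiple of
  \<open>sqrt (eps s / \<beta> s)\<close> per iteration. These increments form a geometric series of ratio
  \<open>sqrt (\<eta> / \<rho>)\<close>, which bounds the distances and, by firmness, also the lengths of the steps by one
  \<open>radius\<close> (\<open>mean_square_dist\<close>) whose square is at most half of the constant \<open>c0\<close> of the theorem.
  
  The dual residual is at most \<open>\<beta> s\<close> times the length of the step (\<open>dual_residual\<close>). The primal one
  is at most this plus \<open>2 L |x - xt|\<close> (\<open>primal_residual\<close>), and \<open>L/2 |x - xt|^2\<close> is at most the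
  gap at \<open>xt\<close>. With \<open>L s \<le> \<gamma> / \<beta> s\<close> and \<open>\<eta> \<le> \<rho>^3\<close> both are of order \<open>\<rho>^s\<close>.
\<close>

section \<open>Closed convex functions, subgradients and proximal points\<close>

text \<open>
  A proper closed convex function with values in \<open>(-\<infinity>, \<infinity>]\<close> is represented by its effective domain \<open>C\<close>
  and a real function on it. Closedness refers to the epigraph and not to \<open>C\<close>.
\<close>

definition closed_convex_on :: "'a::euclidean_space set \<Rightarrow> ('a \<Rightarrow> real) \<Rightarrow> bool" where
  "closed_convex_on C r \<longleftrightarrow> C \<noteq> {} \<and> convex_on C r \<and> closed {(x, t). x \<in> C \<and> r x \<le> t}"

lemma closed_convex_onD:
  assumes "closed_convex_on C r"
  shows "C \<noteq> {}" "convex_on C r" "convex C" "closed {(x, t). x \<in> C \<and> r x \<le> t}"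
  using assms by (auto simp: closed_convex_on_def convex_on_imp_convex)

lemma convex_epigraph_on:
  assumes "convex_on C r"
  shows "convex {(x, t). x \<in> C \<and> r x \<le> t}"
proof -
  have "r (u *\<^sub>R a + v *\<^sub>R b) \<le> u * s + v * t"
    if "a \<in> C" "b \<in> C" "r a \<le> s" "r b \<le> t" "0 \<le> u" "0 \<le> v" "u + v = 1" for a b s t u v
  proof -
    have "r (u *\<^sub>R a + v *\<^sub>R b) \<le> u * r a + v * r b"
      using assms that by (auto simp: convex_on_def)
    also have "\<dots> \<le> u * s + v * t"
      using that by (intro add_mono mult_left_mono) auto
    finally show ?thesis .
  qed
  moreover have "convex C" using assms by (rule convex_on_imp_convex)
  ultimately show ?thesis
    by (auto simp: convex_def)
qed

text \<open>
  A point below the graph is strictly separated from the epigraph. The hyperplane is not vertical, as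
  the point of the graph above it lies on the other side.
\<close>

lemma closed_convex_on_affine_minorant:
  assumes "closed_convex_on C r"
  obtains a c where "\<And>x. x \<in> C \<Longrightarrow> a \<bullet> x + c \<le> r x"
proof -
  let ?S = "{(x, t). x \<in> C \<and> r x \<le> t}"
  obtain x0 where x0: "x0 \<in> C" using closed_convex_onD(1)[OF assms] by blast
  have "(x0, r x0 - 1) \<notin> ?S" by simp
  from separating_hyperplane_closed_point
      [OF convex_epigraph_on[OF closed_convex_onD(2)[OF assms]] closed_convex_onD(4)[OF assms] this]
  obtain n b where n: "n \<bullet> (x0, r x0 - 1) < b" "\<And>z. z \<in> ?S \<Longrightarrow> b < n \<bullet> z" by blast
  obtain n1 \<alpha> where n1: "n = (n1, \<alpha>)" by (cases n)
  have "b < n \<bullet> (x0, r x0)" using x0 by (intro n(2)) auto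
  with n(1) have pos: "0 < \<alpha>" by (auto simp: n1 inner_Pair algebra_simps)
  have "(- (1 / \<alpha>) *\<^sub>R n1) \<bullet> x + b / \<alpha> \<le> r x" if "x \<in> C" for x
  proof -
    have "b < n \<bullet> (x, r x)" using that by (intro n(2)) auto
    then have "b < n1 \<bullet> x + \<alpha> * r x" by (simp add: n1 inner_Pair)
    then show ?thesis using pos by (simp add: field_simps)
  qed
  then show thesis by (rule that)
qed

text \<open>
  Compare \<open>m\<close> with \<open>m + t(y - m)\<close> and let \<open>t\<close> tend to \<open>0\<close>: the quadratic part of \<open>q\<close> is of order \<open>t^2\<close>.
\<close>

lemma convex_min_subgradient:
  fixes r q :: "'a::euclidean_space \<Rightarrow> real"
  assumes r: "convex_on C r" and m: "m \<in> C"
    and min: "\<And>y. y \<in> C \<Longrightarrow> r m + q m \<le> r y + q y"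
    and q: "\<And>d. q (m + d) = q m + e \<bullet> d + c * (norm d)\<^sup>2"
    and y: "y \<in> C"
  shows "r m - e \<bullet> (y - m) \<le> r y"
proof -
  have *: "r m - e \<bullet> (y - m) \<le> r y + t * (c * (norm (y - m))\<^sup>2)" if t: "0 < t" "t < 1" for t
  proof -
    let ?z = "m + t *\<^sub>R (y - m)"
    have z: "?z = (1 - t) *\<^sub>R m + t *\<^sub>R y" by (simp add: algebra_simps)
    have zC: "?z \<in> C" unfolding z using convex_on_imp_convex[OF r] m y t by (intro convexD) auto
    have "r ?z \<le> (1 - t) * r m + t * r y"
      unfolding z using r m y t by (auto simp: convex_on_def)
    moreover have "q ?z = q m + t * (e \<bullet> (y - m)) + c * (t\<^sup>2 * (norm (y - m))\<^sup>2)"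
      using q[of "t *\<^sub>R (y - m)"] by (simp add: power_mult_distrib)
    ultimately have "t * r m \<le> t * r y + t * (e \<bullet> (y - m)) + c * (t\<^sup>2 * (norm (y - m))\<^sup>2)"
      using min[OF zC] by (simp add: left_diff_distrib)
    also have "\<dots> = t * (r y + e \<bullet> (y - m) + t * (c * (norm (y - m))\<^sup>2))"
      by (simp add: power2_eq_square algebra_simps)
    finally show ?thesis using t by simp
  qed
  have "((\<lambda>t. r y + t * (c * (norm (y - m))\<^sup>2)) \<longlongrightarrow> r y + 0 * (c * (norm (y - m))\<^sup>2)) (at_right 0)"
    by (intro tendsto_intros)
  moreover have "\<forall>\<^sub>F t in at_right 0. r m - e \<bullet> (y - m) \<le> r y + t * (c * (norm (y - m))\<^sup>2)"
    using * by (auto simp: eventually_at_right[of 0 1] intro!: exI[of _ 1])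
  ultimately show ?thesis
    using tendsto_lowerbound[of _ _ "at_right (0::real)"] by fastforce
qed

text \<open>
  The point minimising \<open>r x + b/2 |x|^2 - z \<bullet> x\<close>, specified by its optimality condition. It is the
  usual proximal point of \<open>r/b\<close> at \<open>z/b\<close>; keeping a linear tilt \<open>z\<close> instead of a centre turns the smoothing
  of \<open>h\<close> at \<open>u\<close> with centre \<open>l\<close> into the single argument \<open>u + b l\<close>.
\<close>

definition prox_point :: "'a::euclidean_space set \<Rightarrow> ('a \<Rightarrow> real) \<Rightarrow> real \<Rightarrow> 'a \<Rightarrow> 'a" where
  "prox_point C r b z =
     (SOME x. x \<in> C \<and> (\<forall>y\<in>C. r x + (z - b *\<^sub>R x) \<bullet> (y - x) \<le> r y))"

text \<open>
  The value of the Fenchel conjugate of \<open>r + b/2 |\<cdot>|^2\<close> at \<open>z\<close>.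
\<close>

definition prox_env :: "'a::euclidean_space set \<Rightarrow> ('a \<Rightarrow> real) \<Rightarrow> real \<Rightarrow> 'a \<Rightarrow> real" where
  "prox_env C r b z =
     z \<bullet> prox_point C r b z - r (prox_point C r b z) - b / 2 * (norm (prox_point C r b z))\<^sup>2"

text \<open>
  An affine minorant of \<open>r\<close> makes the part of the epigraph on which the objective is not larger than at
  a given point compact. Minimising over this part, instead of over \<open>C\<close>, only involves a continuous
  objective.
\<close>

lemma prox_exists:
  assumes r: "closed_convex_on C r" and b: "0 < b"
  shows "\<exists>x. x \<in> C \<and> (\<forall>y\<in>C. r x + (z - b *\<^sub>R x) \<bullet> (y - x) \<le> r y)"
proof -
  obtain a c where ac: "\<And>x. x \<in> C \<Longrightarrow> a \<bullet> x + c \<le> r x"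
    using closed_convex_on_affine_minorant[OF r] by blast
  obtain x0 where x0: "x0 \<in> C" using closed_convex_onD(1)[OF r] by blast
  define q where "q = (\<lambda>x. b / 2 * (norm x)\<^sup>2 - z \<bullet> x)"
  define S where "S = {(x, t). x \<in> C \<and> r x \<le> t} \<inter> {w. snd w + q (fst w) \<le> r x0 + q x0}"
  have cont: "continuous_on A (\<lambda>w. snd w + q (fst w))" for A
    unfolding q_def by (intro continuous_intros)
  have "closed S"
    unfolding S_def using closed_convex_onD(4)[OF r] cont
    by (intro closed_Int closed_Collect_le continuous_on_const) auto
  define B where "B = r x0 + q x0 - c + (norm (z - a))\<^sup>2 / b"
  have bdx: "b / 4 * (norm x)\<^sup>2 \<le> B" and bdt: "a \<bullet> x + c \<le> t" "t \<le> r x0 + q x0 + z \<bullet> x"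
    if "(x, t) \<in> S" for x t
  proof -
    have 1: "a \<bullet> x + c \<le> t" "t + q x \<le> r x0 + q x0"
      using that ac[of x] by (auto simp: S_def)
    have "b * ((z - a) \<bullet> x) \<le> (b / 2 * norm x)\<^sup>2 + (norm (z - a))\<^sup>2"
    proof -
      have "0 \<le> (norm ((b / 2) *\<^sub>R x - (z - a)))\<^sup>2" by simp
      also have "\<dots> = (b / 2 * norm x)\<^sup>2 - b * ((z - a) \<bullet> x) + (norm (z - a))\<^sup>2"
        unfolding power_mult_distrib power2_norm_eq_inner
        by (simp add: inner_commute inner_diff inner_add algebra_simps power2_eq_square)
      finally show ?thesis by simp
    qed
    then have "(z - a) \<bullet> x \<le> b / 4 * (norm x)\<^sup>2 + (norm (z - a))\<^sup>2 / b"
      using b by (simp add: field_simps power2_eq_square)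
    then have "z \<bullet> x - a \<bullet> x \<le> b / 4 * (norm x)\<^sup>2 + (norm (z - a))\<^sup>2 / b"
      by (simp add: inner_diff_left)
    with 1(1) 1(2)[unfolded q_def] show "b / 4 * (norm x)\<^sup>2 \<le> B"
      unfolding B_def q_def by linarith
    show "a \<bullet> x + c \<le> t" by fact
    have "0 \<le> b / 2 * (norm x)\<^sup>2" using b by simp
    then show "t \<le> r x0 + q x0 + z \<bullet> x" using 1(2) by (simp add: q_def)
  qed
  have "bounded S"
  proof -
    define N where "N = sqrt (4 * B / b)"
    have nx: "norm x \<le> N" if "(x, t) \<in> S" for x t
      using bdx[OF that] b unfolding N_def by (intro real_le_rsqrt) (simp add: field_simps)
    have nt: "\<bar>t\<bar> \<le> norm a * N + \<bar>c\<bar> + \<bar>r x0 + q x0\<bar> + norm z * N" if "(x, t) \<in> S" for x t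
    proof -
      have "norm a * norm x \<le> norm a * N" "norm z * norm x \<le> norm z * N"
        using nx[OF that] by (auto intro: mult_left_mono)
      then have "\<bar>a \<bullet> x\<bar> \<le> norm a * N" "\<bar>z \<bullet> x\<bar> \<le> norm z * N"
        using Cauchy_Schwarz_ineq2[of a x] Cauchy_Schwarz_ineq2[of z x] by linarith+
      with bdt[OF that] show ?thesis by linarith
    qed
    have "S \<subseteq> cball 0 N \<times> {- (norm a * N + \<bar>c\<bar> + \<bar>r x0 + q x0\<bar> + norm z * N) ..
        norm a * N + \<bar>c\<bar> + \<bar>r x0 + q x0\<bar> + norm z * N}"
    proof
      fix w assume w: "w \<in> S"
      then have "(fst w, snd w) \<in> S" by simp
      from nx[OF this] nt[OF this] show "w \<in> cball 0 N \<times> {- (norm a * N + \<bar>c\<bar> + \<bar>r x0 + q x0\<bar> + norm z * N) ..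
          norm a * N + \<bar>c\<bar> + \<bar>r x0 + q x0\<bar> + norm z * N}"
        by (cases w) auto
    qed
    then show ?thesis
      by (rule bounded_subset[rotated]) (intro bounded_Times bounded_cball bounded_closed_interval)
  qed
  with \<open>closed S\<close> have "compact S" by (simp add: compact_eq_bounded_closed)
  moreover have "(x0, r x0) \<in> S" using x0 by (simp add: S_def)
  ultimately obtain w where w: "w \<in> S" "\<And>v. v \<in> S \<Longrightarrow> snd w + q (fst w) \<le> snd v + q (fst v)"
    using continuous_attains_inf[OF _ _ cont, of S] by blast
  define x where "x = fst w"
  have xC: "x \<in> C" and xw: "r x \<le> snd w" using w(1) by (auto simp: S_def x_def split: prod.splits)
  have min: "r x + q x \<le> r y + q y" if y: "y \<in> C" for y
  proof (cases "(y, r y) \<in> S")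
    case True
    with w(2)[OF True] xw show ?thesis by (simp add: x_def)
  next
    case False
    then have "r x0 + q x0 < r y + q y" using y by (auto simp: S_def)
    moreover have "snd w + q x \<le> r x0 + q x0" using w(1) by (simp add: S_def x_def)
    ultimately show ?thesis using xw by linarith
  qed
  have q: "q (x + d) = q x + (b *\<^sub>R x - z) \<bullet> d + b / 2 * (norm d)\<^sup>2" for d
    unfolding q_def power2_norm_eq_inner
    by (simp add: inner_add inner_diff inner_commute algebra_simps)
  have "r x + (z - b *\<^sub>R x) \<bullet> (y - x) \<le> r y" if "y \<in> C" for y
    using convex_min_subgradient[OF closed_convex_onD(2)[OF r] xC min q that]
    by (simp add: inner_diff algebra_simps)
  with xC show ?thesis by blast
qed

lemma
  assumes r: "closed_convex_on C r" and b: "0 < b"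
  shows prox_point_in: "prox_point C r b z \<in> C"
    and prox_point_subgradient: "\<And>y. y \<in> C \<Longrightarrow>
      r (prox_point C r b z) + (z - b *\<^sub>R prox_point C r b z) \<bullet> (y - prox_point C r b z) \<le> r y"
  using someI_ex[OF prox_exists[OF r b, of z]] unfolding prox_point_def by auto

lemma subgradient_monotone:
  fixes r :: "'a::real_inner \<Rightarrow> real"
  assumes "r x + a \<bullet> (y - x) \<le> r y" "r y + c \<bullet> (x - y) \<le> r x"
  shows "0 \<le> (c - a) \<bullet> (y - x)"
  using assms by (simp add: algebra_simps inner_diff)

lemma prox_point_cocoercive:
  assumes r: "closed_convex_on C r" and b: "0 < b"
  shows "b * (norm (prox_point C r b w - prox_point C r b z))\<^sup>2
    \<le> (w - z) \<bullet> (prox_point C r b w - prox_point C r b z)"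
proof -
  let ?P = "prox_point C r b z" and ?Q = "prox_point C r b w"
  have "0 \<le> (w - b *\<^sub>R ?Q - (z - b *\<^sub>R ?P)) \<bullet> (?Q - ?P)"
    by (intro subgradient_monotone[of r ?P _ ?Q] prox_point_subgradient[OF r b] prox_point_in[OF r b])
  also have "\<dots> = (w - z) \<bullet> (?Q - ?P) - b * (norm (?Q - ?P))\<^sup>2"
    unfolding power2_norm_eq_inner by (simp add: algebra_simps)
  finally show ?thesis by simp
qed

lemma prox_point_lipschitz:
  assumes r: "closed_convex_on C r" and b: "0 < b"
  shows "norm (prox_point C r b w - prox_point C r b z) \<le> norm (w - z) / b"
proof -
  let ?d = "prox_point C r b w - prox_point C r b z"
  have "(b * norm ?d) * norm ?d \<le> norm (w - z) * norm ?d"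
    using prox_point_cocoercive[OF r b, of w z] norm_cauchy_schwarz[of "w - z" ?d]
    by (simp add: power2_eq_square)
  then have "b * norm ?d \<le> norm (w - z)"
    by (cases "norm ?d = 0") (auto simp: mult_le_cancel_right)
  then show ?thesis using b by (simp add: field_simps)
qed

lemma continuous_on_prox_point:
  assumes r: "closed_convex_on C r" and b: "0 < b"
  shows "continuous_on UNIV (prox_point C r b)"
proof -
  have "(1 / b)-lipschitz_on UNIV (prox_point C r b)"
    using prox_point_lipschitz[OF r b] b by (intro lipschitz_onI) (auto simp: dist_norm)
  then show ?thesis by (rule lipschitz_on_continuous_on)
qed

text \<open>
  This is the subgradient inequality at the proximal point: the objective defining the envelope is
  strongly concave, so its maximum exceeds every value by a multiple of the squared distance to the
  maximiser.
\<close>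

lemma prox_env_growth:
  assumes r: "closed_convex_on C r" and b: "0 < b" and v: "v \<in> C"
  shows "z \<bullet> v - r v - b / 2 * (norm v)\<^sup>2 + b / 2 * (norm (prox_point C r b z - v))\<^sup>2 \<le> prox_env C r b z"
  using prox_point_subgradient[OF r b v, of z]
  unfolding prox_env_def power2_norm_eq_inner
  by (simp add: algebra_simps inner_diff inner_commute)

lemma prox_env_ge:
  assumes r: "closed_convex_on C r" and b: "0 < b" and v: "v \<in> C"
  shows "z \<bullet> v - r v - b / 2 * (norm v)\<^sup>2 \<le> prox_env C r b z"
proof -
  have "0 \<le> b / 2 * (norm (prox_point C r b z - v))\<^sup>2" using b by simp
  with prox_env_growth[OF r b v, of z] show ?thesis by linarith
qed

lemma prox_env_subgradient:
  assumes r: "closed_convex_on C r" and b: "0 < b"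
  shows "prox_env C r b z + prox_point C r b z \<bullet> (w - z) \<le> prox_env C r b w"
  using prox_env_ge[OF r b prox_point_in[OF r b, of z], of w]
  by (simp add: prox_env_def inner_diff inner_commute)

text \<open>
  The maximisers at \<open>z\<close> and at \<open>w\<close> give a lower and an upper linear bound for the increment of the
  envelope. They differ by \<open>(w - z) \<bullet> (P w - P z)\<close>, which is of second order because \<open>P\<close> is Lipschitz.
\<close>

lemma prox_env_gderiv:
  assumes r: "closed_convex_on C r" and b: "0 < b"
  shows "GDERIV (prox_env C r b) z :> prox_point C r b z"
  unfolding gderiv_def has_derivative_at2
proof (intro conjI)
  let ?P = "prox_point C r b" and ?e = "prox_env C r b"
  show "bounded_linear (\<lambda>h. h \<bullet> ?P z)" by (rule bounded_linear_inner_left)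
  have bd: "norm ((1 / norm (y - z)) *\<^sub>R (?e y - (?e z + (y - z) \<bullet> ?P z))) \<le> norm (y - z) / b" for y
  proof -
    have 1: "?e z + ?P z \<bullet> (y - z) \<le> ?e y" "?e y + ?P y \<bullet> (z - y) \<le> ?e z"
      by (intro prox_env_subgradient[OF r b])+
    then have "\<bar>?e y - (?e z + (y - z) \<bullet> ?P z)\<bar> \<le> (y - z) \<bullet> (?P y - ?P z)"
      by (simp add: inner_diff inner_commute algebra_simps)
    also have "\<dots> \<le> norm (y - z) * norm (?P y - ?P z)" by (rule norm_cauchy_schwarz)
    also have "\<dots> \<le> norm (y - z) * (norm (y - z) / b)"
      by (intro mult_left_mono prox_point_lipschitz[OF r b]) auto
    finally show ?thesis
      using b by (cases "y = z") (auto simp: field_simps)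
  qed
  show "((\<lambda>y. (1 / norm (y - z)) *\<^sub>R (?e y - (?e z + (y - z) \<bullet> ?P z))) \<longlongrightarrow> 0) (at z)"
  proof (rule Lim_null_comparison)
    show "\<forall>\<^sub>F y in at z. norm ((1 / norm (y - z)) *\<^sub>R (?e y - (?e z + (y - z) \<bullet> ?P z))) \<le> norm (y - z) / b"
      using bd by simp
    have "((\<lambda>y. norm (y - z) / b) \<longlongrightarrow> norm (z - z) / b) (at z)" using b by (intro tendsto_intros) auto
    then show "((\<lambda>y. norm (y - z) / b) \<longlongrightarrow> 0) (at z)" by simp
  qed
qed

lemma continuous_on_prox_env:
  assumes r: "closed_convex_on C r" and b: "0 < b"
  shows "continuous_on A (prox_env C r b)"
proof -
  have "continuous (at z) (prox_env C r b)" for z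
    using prox_env_gderiv[OF r b, of z] unfolding gderiv_def by (rule has_derivative_continuous)
  then show ?thesis by (simp add: continuous_at_imp_continuous_on)
qed

lemma closed_convex_on_add_continuous:
  assumes r: "closed_convex_on C r" and q: "convex_on C q" and cont: "continuous_on UNIV q"
  shows "closed_convex_on C (\<lambda>x. r x + q x)"
proof -
  have cf: "continuous_on UNIV (\<lambda>w::'a \<times> real. (fst w, snd w - q (fst w)))"
    by (intro continuous_intros continuous_on_compose2[OF cont]) auto
  have "closed ((\<lambda>w. (fst w, snd w - q (fst w))) -` {(x, t). x \<in> C \<and> r x \<le> t})"
    by (rule closed_vimage[OF closed_convex_onD(4)[OF r] cf])
  moreover have "(\<lambda>w. (fst w, snd w - q (fst w))) -` {(x, t). x \<in> C \<and> r x \<le> t}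
    = {(x, t). x \<in> C \<and> r x + q x \<le> t}" by auto
  ultimately show ?thesis
    using closed_convex_onD[OF r] q by (auto simp: closed_convex_on_def)
qed

text \<open>
  The point \<open>x\<close> minimises \<open>g + a \<bullet> (\<cdot> - x) + c |\<cdot> - x|\<close>, so the claim is the sum rule for this minimum, the
  subdifferential of the norm at \<open>0\<close> being the unit ball. It is obtained by separating the epigraph of
  the first two terms from the region strictly below \<open>- c |\<cdot> - x|\<close>; the hyperplane is not vertical since
  that region projects onto the whole space.
\<close>

lemma exists_subgradient_near:
  fixes g :: "'a::euclidean_space \<Rightarrow> real"
  assumes g: "convex_on C g" and x: "x \<in> C" and c: "0 \<le> c"
    and min: "\<And>y. y \<in> C \<Longrightarrow> g x \<le> g y + a \<bullet> (y - x) + c * norm (y - x)"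
  obtains v where "\<And>y. y \<in> C \<Longrightarrow> g x + v \<bullet> (y - x) \<le> g y" "norm (v + a) \<le> c"
proof -
  define G where "G y = g y - g x + a \<bullet> (y - x)" for y
  define S where "S = {(y, t). y \<in> C \<and> G y \<le> t}"
  define T where "T = {(y::'a, t::real). t < - c * norm (y - x)}"
  have Cc: "convex C" using g by (rule convex_on_imp_convex)
  have "convex_on C (\<lambda>y. a \<bullet> y + (- g x - a \<bullet> x))"
    using Cc unfolding convex_on_def
    by (auto simp: inner_add_right algebra_simps) (simp flip: distrib_right distrib_left add: algebra_simps)
  from convex_on_add[OF g this] have "convex_on C G"
    unfolding G_def by (simp add: inner_diff algebra_simps)
  then have "convex S" unfolding S_def by (rule convex_epigraph_on)
  moreover have "convex T"
  proof (rule convexI)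
    fix w1 w2 :: "'a \<times> real" and u v :: real
    assume w: "w1 \<in> T" "w2 \<in> T" and uv: "0 \<le> u" "0 \<le> v" "u + v = 1"
    let ?y = "u *\<^sub>R fst w1 + v *\<^sub>R fst w2"
    have "?y - x = u *\<^sub>R (fst w1 - x) + v *\<^sub>R (fst w2 - x)"
      using uv(3) by (simp add: algebra_simps flip: scaleR_add_left)
    then have n: "norm (?y - x) \<le> u * norm (fst w1 - x) + v * norm (fst w2 - x)"
      using norm_triangle_ineq[of "u *\<^sub>R (fst w1 - x)" "v *\<^sub>R (fst w2 - x)"] uv by simp
    have "u * snd w1 + v * snd w2 < u * (- c * norm (fst w1 - x)) + v * (- c * norm (fst w2 - x))"
    proof (cases "u = 0")
      case True then show ?thesis using w uv by (auto simp: T_def split: prod.splits)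
    next
      case False
      then show ?thesis using w uv
        by (intro add_less_le_mono mult_strict_left_mono mult_left_mono) (auto simp: T_def split: prod.splits)
    qed
    also have "\<dots> = - c * (u * norm (fst w1 - x) + v * norm (fst w2 - x))" by (simp add: algebra_simps)
    also have "\<dots> \<le> - c * norm (?y - x)" using n c by (simp add: mult_left_mono)
    finally show "u *\<^sub>R w1 + v *\<^sub>R w2 \<in> T" by (cases w1; cases w2) (simp add: T_def)
  qed
  moreover have "(x, 0) \<in> S" using x by (simp add: S_def G_def)
  moreover have "(x, -1) \<in> T" by (simp add: T_def)
  moreover have "S \<inter> T = {}"
  proof -
    have "- c * norm (y - x) \<le> t" if "y \<in> C" "G y \<le> t" for y t
      using min[OF that(1)] that(2) by (simp add: G_def)
    then show ?thesis by (fastforce simp: S_def T_def)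
  qed
  ultimately obtain n b where n: "n \<noteq> 0" "\<And>w. w \<in> T \<Longrightarrow> n \<bullet> w \<le> b" "\<And>w. w \<in> S \<Longrightarrow> b \<le> n \<bullet> w"
    using separating_hyperplane_sets[of T S] by blast
  obtain n1 \<alpha> where n1: "n = (n1, \<alpha>)" by (cases n)
  \<comment> \<open>Points at distance \<open>d\<close> below the boundary of the region belong to \<open>T\<close>; let \<open>d\<close> tend to \<open>0\<close>.\<close>
  have T: "n1 \<bullet> y - \<alpha> * (c * norm (y - x)) \<le> b" for y
  proof -
    have "((\<lambda>d. n1 \<bullet> y + \<alpha> * (- c * norm (y - x) - d)) \<longlongrightarrow> n1 \<bullet> y + \<alpha> * (- c * norm (y - x) - 0)) (at_right 0)"
      by (intro tendsto_intros)
    moreover have "\<forall>\<^sub>F d in at_right 0. n1 \<bullet> y + \<alpha> * (- c * norm (y - x) - d) \<le> b"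
    proof (rule eventually_mono[OF eventually_at_right_less])
      fix d :: real assume "0 < d"
      then have "(y, - c * norm (y - x) - d) \<in> T" by (simp add: T_def)
      from n(2)[OF this] show "n1 \<bullet> y + \<alpha> * (- c * norm (y - x) - d) \<le> b" by (simp add: n1 inner_Pair)
    qed
    ultimately show ?thesis
      using tendsto_upperbound[of _ _ "at_right (0::real)" b] by fastforce
  qed
  have bx: "n1 \<bullet> x = b"
    using T[of x] n(3)[OF \<open>(x, 0) \<in> S\<close>] by (simp add: n1 inner_Pair)
  have "n \<bullet> (x, -1) \<le> b" by (rule n(2)[OF \<open>(x, -1) \<in> T\<close>])
  then have "0 \<le> \<alpha>" using bx by (simp add: n1 inner_Pair)
  have T': "n1 \<bullet> d \<le> \<alpha> * (c * norm d)" for d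
    using T[of "x + d"] bx by (simp add: inner_add_right)
  have pos: "0 < \<alpha>"
  proof (rule ccontr)
    assume "\<not> 0 < \<alpha>"
    with \<open>0 \<le> \<alpha>\<close> have "\<alpha> = 0" by simp
    with T'[of n1] inner_gt_zero_iff[of n1] have "n1 = 0" by fastforce
    with \<open>\<alpha> = 0\<close> n(1) n1 show False by (simp add: zero_prod_def)
  qed
  define v where "v = - (1 / \<alpha>) *\<^sub>R n1 - a"
  show thesis
  proof (rule that[of v])
    fix y assume "y \<in> C"
    then have "(y, G y) \<in> S" by (simp add: S_def)
    from n(3)[OF this] have "0 \<le> n1 \<bullet> (y - x) + \<alpha> * G y"
      by (simp add: n1 inner_Pair inner_diff_right bx)
    then have "0 \<le> (1 / \<alpha>) * (n1 \<bullet> (y - x)) + G y"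
      using pos by (simp add: field_simps)
    then show "g x + v \<bullet> (y - x) \<le> g y"
      unfolding v_def G_def by (simp add: inner_diff_left algebra_simps)
  next
    have "norm n1 * norm n1 \<le> (\<alpha> * c) * norm n1"
      using T'[of n1] by (simp add: power2_norm_eq_inner power2_eq_square algebra_simps flip: power2_norm_eq_inner)
    then have "norm n1 \<le> \<alpha> * c"
      using pos c by (cases "norm n1 = 0") (auto simp: mult_le_cancel_right)
    moreover have "v + a = - (1 / \<alpha>) *\<^sub>R n1" by (simp add: v_def)
    ultimately show "norm (v + a) \<le> c" using pos by (simp add: field_simps)
  qed
qed

section \<open>The smoothing and its dependence on the parameters\<close>

text \<open>
  With \<open>k = h*\<close> on its domain \<open>E\<close> these are \<open>\<Lambda>(u; l, b)\<close> and \<open>h(u; l, b)\<close>: completing the square in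
  \<open>v \<bullet> u - b/2 |v - l|^2\<close> moves the centre \<open>l\<close> into the linear term.
\<close>

definition smooth_arg :: "'d::euclidean_space set \<Rightarrow> ('d \<Rightarrow> real) \<Rightarrow> real \<Rightarrow> 'd \<Rightarrow> 'd \<Rightarrow> 'd" where
  "smooth_arg E k b l u = prox_point E k b (u + b *\<^sub>R l)"

definition smooth_val :: "'d::euclidean_space set \<Rightarrow> ('d \<Rightarrow> real) \<Rightarrow> real \<Rightarrow> 'd \<Rightarrow> 'd \<Rightarrow> real" where
  "smooth_val E k b l u = prox_env E k b (u + b *\<^sub>R l) - b / 2 * (norm l)\<^sup>2"

context
  fixes E :: "'d::euclidean_space set" and k :: "'d \<Rightarrow> real" and b :: real
  assumes k: "closed_convex_on E k" and b: "0 < b"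
begin

lemma smooth_arg_in: "smooth_arg E k b l u \<in> E"
  unfolding smooth_arg_def by (rule prox_point_in[OF k b])

lemma smooth_val_eq:
  "smooth_val E k b l u =
     smooth_arg E k b l u \<bullet> u - k (smooth_arg E k b l u) - b / 2 * (norm (smooth_arg E k b l u - l))\<^sup>2"
  unfolding smooth_val_def smooth_arg_def prox_env_def power2_norm_eq_inner
  by (simp add: inner_add inner_diff inner_commute algebra_simps)

lemma smooth_arg_subgradient:
  assumes "w \<in> E"
  shows "k (smooth_arg E k b l u) + (u - b *\<^sub>R (smooth_arg E k b l u - l)) \<bullet> (w - smooth_arg E k b l u) \<le> k w"
  using prox_point_subgradient[OF k b assms, of "u + b *\<^sub>R l"]
  unfolding smooth_arg_def by (simp add: algebra_simps)

lemma smooth_val_growth: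
  assumes "w \<in> E"
  shows "w \<bullet> u - k w - b / 2 * (norm (w - l))\<^sup>2 + b / 2 * (norm (smooth_arg E k b l u - w))\<^sup>2
    \<le> smooth_val E k b l u"
  using prox_env_growth[OF k b assms, of "u + b *\<^sub>R l"]
  unfolding smooth_val_def smooth_arg_def power2_norm_eq_inner
  by (simp add: inner_add inner_diff inner_commute algebra_simps)

lemma smooth_val_ge:
  assumes "w \<in> E"
  shows "w \<bullet> u - k w - b / 2 * (norm (w - l))\<^sup>2 \<le> smooth_val E k b l u"
proof -
  have "0 \<le> b / 2 * (norm (smooth_arg E k b l u - w))\<^sup>2" using b by simp
  with smooth_val_growth[OF assms, of u l] show ?thesis by linarith
qed

lemma smooth_arg_unique:
  assumes v: "v \<in> E" and max: "\<And>w. w \<in> E \<Longrightarrow>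
      w \<bullet> u - k w - b / 2 * (norm (w - l))\<^sup>2 \<le> v \<bullet> u - k v - b / 2 * (norm (v - l))\<^sup>2"
  shows "v = smooth_arg E k b l u"
proof -
  have "b / 2 * (norm (smooth_arg E k b l u - v))\<^sup>2 \<le> 0"
    using smooth_val_growth[OF v, of u l] max[OF smooth_arg_in, of l u] smooth_val_eq[of l u] by linarith
  then show ?thesis using b by (simp add: mult_le_0_iff)
qed

lemma smooth_val_subgradient:
  "smooth_val E k b l u + smooth_arg E k b l u \<bullet> (w - u) \<le> smooth_val E k b l w"
  using prox_env_subgradient[OF k b, of "u + b *\<^sub>R l" "w + b *\<^sub>R l"]
  by (simp add: smooth_val_def smooth_arg_def)

lemma smooth_val_gderiv: "GDERIV (smooth_val E k b l) u :> smooth_arg E k b l u"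
proof -
  have "((\<lambda>u. prox_env E k b (u + b *\<^sub>R l)) has_derivative (\<lambda>h. h \<bullet> smooth_arg E k b l u)) (at u)"
    unfolding smooth_arg_def
    by (rule has_derivative_compose[where g = "prox_env E k b" and f = "\<lambda>u. u + b *\<^sub>R l" and f' = "\<lambda>h. h"])
       (auto intro!: derivative_eq_intros simp: prox_env_gderiv[OF k b, unfolded gderiv_def])
  then have "((\<lambda>u. prox_env E k b (u + b *\<^sub>R l) - b / 2 * (norm l)\<^sup>2) has_derivative (\<lambda>h. h \<bullet> smooth_arg E k b l u - 0)) (at u)"
    by (intro has_derivative_diff has_derivative_const)
  then show ?thesis unfolding gderiv_def smooth_val_def by simp
qed

lemma continuous_on_smooth_arg: "continuous_on A (\<lambda>(l, u). smooth_arg E k b l u)"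
  unfolding smooth_arg_def case_prod_beta
  by (intro continuous_on_compose2[OF continuous_on_prox_point[OF k b]] continuous_intros) auto

lemma continuous_on_smooth_val: "continuous_on A (\<lambda>(l, u). smooth_val E k b l u)"
  unfolding smooth_val_def case_prod_beta
  by (intro continuous_on_compose2[OF continuous_on_prox_env[OF k b, of UNIV]] continuous_intros) auto

end

text \<open>
  As a function of its centre the smoothing is concave with gradient \<open>b (\<Lambda> - l)\<close>, and it is decreasing
  in \<open>b\<close>. So the affine upper bound at \<open>(b', l')\<close> holds at \<open>l\<close> with the larger parameter \<open>b\<close>.
\<close>

lemma smooth_val_shift_ge:
  assumes k: "closed_convex_on E k" and b: "0 < b'" "b' \<le> b"
  shows "smooth_val E k b l u + (l' - l) \<bullet> (b' *\<^sub>R (smooth_arg E k b' l' u - l')) \<le> smooth_val E k b' l' u"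
proof -
  have b0: "0 < b" using b by simp
  define v v' d e where "v = smooth_arg E k b l u" and "v' = smooth_arg E k b' l' u"
    and "d = v' - l'" and "e = v - l"
  have sub: "k v' + (u - b' *\<^sub>R (v' - l')) \<bullet> (v - v') \<le> k v"
    unfolding v'_def by (intro smooth_arg_subgradient[OF k b(1)]) (simp add: v_def smooth_arg_in[OF k b0])
  have "0 \<le> b' / 2 * (norm (d - e))\<^sup>2" using b by simp
  then have 1: "b' * (d \<bullet> e) \<le> b' / 2 * (norm d)\<^sup>2 + b' / 2 * (norm e)\<^sup>2"
    unfolding power2_norm_eq_inner by (simp add: inner_diff inner_commute algebra_simps)
  have 2: "b' / 2 * (norm e)\<^sup>2 \<le> b / 2 * (norm e)\<^sup>2" using b by (intro mult_right_mono) auto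
  have "v - v' = e - d + (l - l')" by (simp add: d_def e_def)
  then have "b' * (d \<bullet> (v - v')) = b' * (d \<bullet> (e - d + (l - l')))" by simp
  also have "\<dots> = b' * (d \<bullet> e) - b' * (norm d)\<^sup>2 + b' * (d \<bullet> (l - l'))"
    unfolding power2_norm_eq_inner by (simp add: inner_add inner_diff algebra_simps)
  finally have "b' * (d \<bullet> (v - v')) = b' * (d \<bullet> e) - b' * (norm d)\<^sup>2 + b' * (d \<bullet> (l - l'))" .
  moreover have "smooth_val E k b l u = v \<bullet> u - k v - b / 2 * (norm e)\<^sup>2"
    unfolding v_def e_def by (rule smooth_val_eq[OF k b0])
  moreover have "smooth_val E k b' l' u = v' \<bullet> u - k v' - b' / 2 * (norm d)\<^sup>2"
    unfolding v'_def d_def by (rule smooth_val_eq[OF k b(1)])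
  moreover have "k v' + u \<bullet> v - u \<bullet> v' - b' * (d \<bullet> (v - v')) \<le> k v"
    using sub unfolding d_def[symmetric] by (simp add: inner_diff_left inner_diff_right right_diff_distrib)
  ultimately have "smooth_val E k b l u + b' * (d \<bullet> (l' - l)) \<le> smooth_val E k b' l' u"
    using 1 2 by (simp add: inner_commute inner_diff algebra_simps)
  then show ?thesis by (simp add: d_def v'_def inner_commute)
qed

text \<open>
  At the particular new centre \<open>l' = \<Lambda>(u; l, b)\<close> there is a matching upper bound: the first increment
  comes from moving the centre with \<open>b\<close> fixed, the second one from then replacing \<open>b\<close> by \<open>b'\<close>.
\<close>

lemma smooth_val_update_le:
  assumes k: "closed_convex_on E k" and b: "0 < b" "0 < b'"
    and l': "l' = smooth_arg E k b l u"
  shows "smooth_val E k b' l' u \<le> smooth_val E k b l u + b * (norm (l' - l))\<^sup>2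
      + (b - b') / 2 * (norm (smooth_arg E k b' l' u - l'))\<^sup>2"
proof -
  define v d e where "v = smooth_arg E k b' l' u" and "d = v - l'" and "e = l' - l"
  have sub: "k l' + (u - b *\<^sub>R e) \<bullet> d \<le> k v"
    unfolding e_def d_def l'
    by (intro smooth_arg_subgradient[OF k b(1)]) (simp add: v_def smooth_arg_in[OF k b(2)])
  have "0 \<le> b / 2 * (norm (e - d))\<^sup>2" using b by simp
  then have 1: "b * (e \<bullet> d) \<le> b / 2 * (norm e)\<^sup>2 + b / 2 * (norm d)\<^sup>2"
    unfolding power2_norm_eq_inner by (simp add: inner_diff inner_commute algebra_simps)
  have 2: "smooth_val E k b l u = l' \<bullet> u - k l' - b / 2 * (norm e)\<^sup>2"
    unfolding l' e_def by (rule smooth_val_eq[OF k b(1)])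
  have 3: "smooth_val E k b' l' u = v \<bullet> u - k v - b' / 2 * (norm d)\<^sup>2"
    unfolding v_def d_def by (rule smooth_val_eq[OF k b(2)])
  have 4: "v \<bullet> u = l' \<bullet> u + d \<bullet> u" by (simp add: d_def inner_diff_left)
  have 5: "k l' + d \<bullet> u - b * (e \<bullet> d) \<le> k v" using sub by (simp add: inner_diff_left inner_commute[of d u])
  have 6: "(b - b') / 2 * (norm d)\<^sup>2 = b / 2 * (norm d)\<^sup>2 - b' / 2 * (norm d)\<^sup>2" by (simp add: field_simps)
  have "smooth_val E k b' l' u \<le> smooth_val E k b l u + b * (norm e)\<^sup>2 + (b - b') / 2 * (norm d)\<^sup>2"
    using 1 2 3 4 5 6 by linarith
  then show ?thesis by (simp add: d_def v_def e_def)
qed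

section \<open>Inexact proximal steps for a convex-concave saddle function\<close>

text \<open>
  The saddle function is \<open>r x + v \<bullet> p x - k v\<close> on \<open>C \<times> E\<close>, with a coupling that is linear in \<open>v\<close> and
  convex in \<open>x\<close>.
\<close>

locale convex_coupling =
  fixes C :: "'a::euclidean_space set" and r :: "'a \<Rightarrow> real"
    and E :: "'d::euclidean_space set" and k :: "'d \<Rightarrow> real"
    and p :: "'a \<Rightarrow> 'd"
  assumes r: "closed_convex_on C r" and k: "closed_convex_on E k"
    and p_cont: "continuous_on UNIV p"
    and p_convex: "\<And>v. v \<in> E \<Longrightarrow> convex_on UNIV (\<lambda>x. v \<bullet> p x)"
begin

abbreviation "\<Lambda> b l u \<equiv> smooth_arg E k b l u"
abbreviation "sm b l u \<equiv> smooth_val E k b l u"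

text \<open>
  At a convex combination the maximum is attained at some \<open>v\<close>; this \<open>v\<close> is admissible at both end
  points, and \<open>v \<bullet> p\<close> is convex.
\<close>

lemma smooth_val_convex:
  assumes b: "0 < b"
  shows "convex_on UNIV (\<lambda>x. sm b l (p x))"
proof (rule convex_onI)
  fix t :: real and x y :: 'a assume t: "0 < t" "t < 1"
  let ?z = "(1 - t) *\<^sub>R x + t *\<^sub>R y"
  define v where "v = \<Lambda> b l (p ?z)"
  have v: "v \<in> E" unfolding v_def by (rule smooth_arg_in[OF k b])
  define A where "A = - k v - b / 2 * (norm (v - l))\<^sup>2"
  have 1: "v \<bullet> p ?z \<le> (1 - t) * (v \<bullet> p x) + t * (v \<bullet> p y)"
    using p_convex[OF v] t by (intro convex_onD) auto
  have "v \<bullet> p x + A \<le> sm b l (p x)" "v \<bullet> p y + A \<le> sm b l (p y)"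
    using smooth_val_ge[OF k b v] by (auto simp: A_def algebra_simps)
  then have "(1 - t) * (v \<bullet> p x + A) + t * (v \<bullet> p y + A) \<le> (1 - t) * sm b l (p x) + t * sm b l (p y)"
    using t by (intro add_mono mult_left_mono) auto
  moreover have "sm b l (p ?z) = v \<bullet> p ?z + A"
    unfolding A_def v_def using smooth_val_eq[OF k b] by simp
  ultimately show "sm b l (p ?z) \<le> (1 - t) * sm b l (p x) + t * sm b l (p y)"
    using 1 by (simp add: algebra_simps)
qed simp

lemma smooth_val_comp_cont:
  assumes b: "0 < b"
  shows "continuous_on UNIV (\<lambda>x. sm b l (p x))"
proof -
  have "continuous_on UNIV (\<lambda>x. (l, p x))" by (intro continuous_on_Pair continuous_on_const p_cont)
  from continuous_on_compose2[OF continuous_on_smooth_val[OF k b, of UNIV] this] show ?thesis by simp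
qed

text \<open>
  \<open>exact_x\<close> and \<open>exact_v\<close> form the saddle point of
  \<open>r x + v \<bullet> p x - k v + b/2 |x - y|^2 - b/2 |v - l|^2\<close>, the exact proximal step from \<open>(y, l)\<close>.
\<close>

definition exact_x :: "real \<Rightarrow> 'a \<Rightarrow> 'd \<Rightarrow> 'a" where
  "exact_x b y l = prox_point C (\<lambda>x. r x + sm b l (p x)) b (b *\<^sub>R y)"

definition exact_v :: "real \<Rightarrow> 'a \<Rightarrow> 'd \<Rightarrow> 'd" where
  "exact_v b y l = \<Lambda> b l (p (exact_x b y l))"

definition aug_val :: "real \<Rightarrow> 'a \<Rightarrow> 'd \<Rightarrow> 'a \<Rightarrow> real" where
  "aug_val b y l x = r x + sm b l (p x) + b / 2 * (norm (x - y))\<^sup>2"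

lemma aug_closed_convex:
  assumes b: "0 < b" shows "closed_convex_on C (\<lambda>x. r x + sm b l (p x))"
proof (rule closed_convex_on_add_continuous[OF r _ smooth_val_comp_cont[OF b]])
  show "convex_on C (\<lambda>x. sm b l (p x))"
    by (rule convex_on_subset[OF smooth_val_convex[OF b] subset_UNIV closed_convex_onD(3)[OF r]])
qed

lemma exact_x_in: "0 < b \<Longrightarrow> exact_x b y l \<in> C"
  unfolding exact_x_def by (rule prox_point_in[OF aug_closed_convex])

lemma exact_v_in: "0 < b \<Longrightarrow> exact_v b y l \<in> E"
  unfolding exact_v_def by (rule smooth_arg_in[OF k])

text \<open>
  Minimality of \<open>x'\<close> concerns a function in which the multiplier follows \<open>x\<close>; here it is frozen at \<open>v'\<close>.
  At \<open>x_t = (1 - t) x' + t x\<close>, whose multiplier is \<open>v_t\<close>, the increment of the smoothing is at most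
  \<open>v_t \<bullet> (p x_t - p x')\<close>, hence at most \<open>t\<close> times \<open>v_t \<bullet> (p x - p x')\<close> by convexity. Divide by \<open>t\<close> and
  use that \<open>v_t\<close> tends to \<open>v'\<close>.
\<close>

lemma exact_x_saddle:
  assumes b: "0 < b" and x: "x \<in> C"
  shows "r (exact_x b y l) + exact_v b y l \<bullet> p (exact_x b y l) + b * ((y - exact_x b y l) \<bullet> (x - exact_x b y l))
    \<le> r x + exact_v b y l \<bullet> p x"
proof -
  define x' where "x' = exact_x b y l"
  have x': "x' \<in> C" unfolding x'_def by (rule exact_x_in[OF b])
  define z where "z t = (1 - t) *\<^sub>R x' + t *\<^sub>R x" for t
  define v where "v t = \<Lambda> b l (p (z t))" for t
  have v_in: "v t \<in> E" for t unfolding v_def by (rule smooth_arg_in[OF k b])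
  have *: "b * ((y - x') \<bullet> (x - x')) \<le> r x - r x' + v t \<bullet> (p x - p x')" if t: "0 < t" "t < 1" for t
  proof -
    have zC: "z t \<in> C"
      unfolding z_def using closed_convex_onD(3)[OF r] x x' t by (intro convexD) auto
    have zx: "z t - x' = t *\<^sub>R (x - x')" by (simp add: z_def algebra_simps)
    have "r x' + sm b l (p x') + (b *\<^sub>R y - b *\<^sub>R x') \<bullet> (z t - x') \<le> r (z t) + sm b l (p (z t))"
      unfolding x'_def exact_x_def
      by (rule prox_point_subgradient[OF aug_closed_convex[OF b] b zC])
    then have "r x' + sm b l (p x') + t * (b * ((y - x') \<bullet> (x - x'))) \<le> r (z t) + sm b l (p (z t))"
      by (simp add: zx algebra_simps flip: scaleR_diff_right)
    moreover have "sm b l (p (z t)) + v t \<bullet> (p x' - p (z t)) \<le> sm b l (p x')"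
      unfolding v_def by (rule smooth_val_subgradient[OF k b])
    moreover have "v t \<bullet> p (z t) \<le> (1 - t) * (v t \<bullet> p x') + t * (v t \<bullet> p x)"
      unfolding z_def using p_convex[OF v_in] t by (intro convex_onD) auto
    moreover have "r (z t) \<le> (1 - t) * r x' + t * r x"
      unfolding z_def using closed_convex_onD(2)[OF r] t x x' by (intro convex_onD) auto
    ultimately have "t * (b * ((y - x') \<bullet> (x - x'))) \<le> t * (r x - r x' + v t \<bullet> (p x - p x'))"
      by (simp add: algebra_simps inner_diff_right)
    then show ?thesis using t by simp
  qed
  have "continuous_on UNIV z" unfolding z_def by (intro continuous_intros)
  from continuous_on_compose2[OF p_cont this]
  have contp: "continuous_on UNIV (\<lambda>t. (l, p (z t)))" by (intro continuous_on_Pair continuous_on_const) auto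
  have cv: "continuous_on UNIV v"
    unfolding v_def
    using continuous_on_compose2[OF continuous_on_smooth_arg[OF k b, of UNIV] contp] by simp
  then have "(v \<longlongrightarrow> v 0) (at 0)" by (simp add: continuous_on_def)
  then have "(v \<longlongrightarrow> v 0) (at_right 0)" by (rule tendsto_within_subset) simp
  then have "((\<lambda>t. r x - r x' + v t \<bullet> (p x - p x')) \<longlongrightarrow> r x - r x' + v 0 \<bullet> (p x - p x')) (at_right 0)"
    by (intro tendsto_intros)
  moreover have "\<forall>\<^sub>F t in at_right 0. b * ((y - x') \<bullet> (x - x')) \<le> r x - r x' + v t \<bullet> (p x - p x')"
    using * by (auto simp: eventually_at_right[of 0 1] intro!: exI[of _ 1])
  ultimately have "b * ((y - x') \<bullet> (x - x')) \<le> r x - r x' + v 0 \<bullet> (p x - p x')"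
    using tendsto_lowerbound[of _ _ "at_right (0::real)"] by fastforce
  moreover have "v 0 = exact_v b y l" by (simp add: v_def z_def exact_v_def x'_def)
  ultimately show ?thesis by (simp add: x'_def inner_diff_right)
qed

text \<open>
  Strong concavity gives \<open>H x \<ge> S(x, v') + b/2 |\<Lambda>(p x) - v'|^2\<close> and strong convexity gives
  \<open>S(x, v') \<ge> S(x', v') + b/2 |x - x'|^2\<close>, where \<open>S(x', v') = H x'\<close>; so the two distances add up.
\<close>

lemma aug_val_gap_lower:
  assumes b: "0 < b" and x: "x \<in> C"
  shows "b / 2 * (norm (x - exact_x b y l))\<^sup>2 + b / 2 * (norm (\<Lambda> b l (p x) - exact_v b y l))\<^sup>2
    \<le> aug_val b y l x - aug_val b y l (exact_x b y l)"
proof -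
  define x' v' where "x' = exact_x b y l" and "v' = exact_v b y l"
  have "v' \<bullet> p x - k v' - b / 2 * (norm (v' - l))\<^sup>2 + b / 2 * (norm (\<Lambda> b l (p x) - v'))\<^sup>2 \<le> sm b l (p x)"
    unfolding v'_def by (rule smooth_val_growth[OF k b exact_v_in[OF b]])
  moreover have "sm b l (p x') = v' \<bullet> p x' - k v' - b / 2 * (norm (v' - l))\<^sup>2"
    unfolding v'_def exact_v_def x'_def by (rule smooth_val_eq[OF k b])
  moreover have "r x' + v' \<bullet> p x' + b * ((y - x') \<bullet> (x - x')) \<le> r x + v' \<bullet> p x"
    unfolding x'_def v'_def by (rule exact_x_saddle[OF b x])
  moreover have "b / 2 * (norm (x - y))\<^sup>2 - b / 2 * (norm (x' - y))\<^sup>2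
      = b / 2 * (norm (x - x'))\<^sup>2 - b * ((y - x') \<bullet> (x - x'))"
    unfolding power2_norm_eq_inner by (simp add: inner_diff inner_commute field_simps)
  ultimately show ?thesis
    unfolding aug_val_def x'_def[symmetric] v'_def[symmetric] by linarith
qed

lemma aug_val_exact_x_le:
  assumes b: "0 < b" and x: "x \<in> C"
  shows "aug_val b y l (exact_x b y l) \<le> aug_val b y l x"
proof -
  have "0 \<le> b / 2 * (norm (x - exact_x b y l))\<^sup>2 + b / 2 * (norm (\<Lambda> b l (p x) - exact_v b y l))\<^sup>2"
    using b by simp
  with aug_val_gap_lower[OF assms, of y l] show ?thesis by linarith
qed

lemma inexact_step_error:
  assumes b: "0 < b" and x: "x \<in> C"
  shows "norm ((x, \<Lambda> b l (p x)) - (exact_x b y l, exact_v b y l))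
    \<le> sqrt (2 * (aug_val b y l x - aug_val b y l (exact_x b y l)) / b)"
proof (rule real_le_rsqrt)
  show "(norm ((x, \<Lambda> b l (p x)) - (exact_x b y l, exact_v b y l)))\<^sup>2
      \<le> 2 * (aug_val b y l x - aug_val b y l (exact_x b y l)) / b"
    using aug_val_gap_lower[OF assms, of y l] b by (simp add: norm_Pair field_simps)
qed

text \<open>
  Testing the optimality conditions of \<open>J(y, l) = (x', v')\<close> at the saddle point \<open>(xs, ls)\<close>, and conversely,
  shows \<open>((y, l) - J(y, l)) \<bullet> ((xs, ls) - J(y, l)) \<le> 0\<close>.
\<close>

lemma saddle_step_firm:
  assumes b: "0 < b" and xs: "xs \<in> C" and ls: "ls \<in> E"
    and saddle_x: "\<And>x. x \<in> C \<Longrightarrow> r xs + ls \<bullet> p xs \<le> r x + ls \<bullet> p x"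
    and saddle_l: "\<And>v. v \<in> E \<Longrightarrow> v \<bullet> p xs - k v \<le> ls \<bullet> p xs - k ls"
  shows "(norm ((exact_x b y l, exact_v b y l) - (xs, ls)))\<^sup>2 + (norm ((exact_x b y l, exact_v b y l) - (y, l)))\<^sup>2
    \<le> (norm ((y, l) - (xs, ls)))\<^sup>2"
proof -
  define x' v' where "x' = exact_x b y l" and "v' = exact_v b y l"
  have "r x' + v' \<bullet> p x' + b * ((y - x') \<bullet> (xs - x')) \<le> r xs + v' \<bullet> p xs"
    unfolding x'_def v'_def by (rule exact_x_saddle[OF b xs])
  moreover have "k v' + (p x' - b *\<^sub>R (v' - l)) \<bullet> (ls - v') \<le> k ls"
    unfolding v'_def exact_v_def x'_def by (rule smooth_arg_subgradient[OF k b ls])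
  moreover have "r xs + ls \<bullet> p xs \<le> r x' + ls \<bullet> p x'"
    by (rule saddle_x) (simp add: x'_def exact_x_in[OF b])
  moreover have "v' \<bullet> p xs - k v' \<le> ls \<bullet> p xs - k ls"
    by (rule saddle_l) (simp add: v'_def exact_v_in[OF b])
  ultimately have "b * ((y - x') \<bullet> (xs - x') + (l - v') \<bullet> (ls - v')) \<le> 0"
    by (simp add: inner_diff inner_commute algebra_simps)
  then have "(y - x') \<bullet> (xs - x') + (l - v') \<bullet> (ls - v') \<le> 0" using b by (simp add: mult_le_0_iff)
  then show ?thesis
    unfolding x'_def[symmetric] v'_def[symmetric] power2_norm_eq_inner
    by (simp add: inner_Pair inner_diff inner_commute algebra_simps)
qed

text \<open>
  The new pair is within \<open>e\<close> of \<open>J(y, l)\<close>, and by firmness neither the distance from \<open>J(y, l)\<close> to the saddle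
  point nor that to \<open>(y, l)\<close> exceeds the initial distance. The second bound thus loses no factor \<open>2\<close>.
\<close>

lemma inexact_step:
  fixes y :: 'a and l :: 'd
  assumes b: "0 < b" and x: "x \<in> C" and xs: "xs \<in> C" and ls: "ls \<in> E"
    and saddle_x: "\<And>x. x \<in> C \<Longrightarrow> r xs + ls \<bullet> p xs \<le> r x + ls \<bullet> p x"
    and saddle_l: "\<And>v. v \<in> E \<Longrightarrow> v \<bullet> p xs - k v \<le> ls \<bullet> p xs - k ls"
  defines "e \<equiv> sqrt (2 * (aug_val b y l x - aug_val b y l (exact_x b y l)) / b)"
  shows "norm ((x, \<Lambda> b l (p x)) - (xs, ls)) \<le> norm ((y, l) - (xs, ls)) + e"
    and "norm ((x, \<Lambda> b l (p x)) - (y, l)) \<le> norm ((y, l) - (xs, ls)) + e"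
proof -
  let ?z = "(x, \<Lambda> b l (p x))" and ?J = "(exact_x b y l, exact_v b y l)"
  have e: "norm (?z - ?J) \<le> e" unfolding e_def by (rule inexact_step_error[OF b x])
  have f: "(norm (?J - (xs, ls)))\<^sup>2 + (norm (?J - (y, l)))\<^sup>2 \<le> (norm ((y, l) - (xs, ls)))\<^sup>2"
    using b xs ls saddle_x saddle_l by (rule saddle_step_firm)
  have "(norm (?J - (xs, ls)))\<^sup>2 \<le> (norm ((y, l) - (xs, ls)))\<^sup>2"
    using f zero_le_power2[of "norm (?J - (y, l))"] by linarith
  moreover have "(norm (?J - (y, l)))\<^sup>2 \<le> (norm ((y, l) - (xs, ls)))\<^sup>2"
    using f zero_le_power2[of "norm (?J - (xs, ls))"] by linarith
  ultimately have "norm (?J - (xs, ls)) \<le> norm ((y, l) - (xs, ls))" "norm (?J - (y, l)) \<le> norm ((y, l) - (xs, ls))"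
    by (blast intro: power2_le_imp_le norm_ge_zero)+
  moreover have "?z - (xs, ls) = (?z - ?J) + (?J - (xs, ls))" "?z - (y, l) = (?z - ?J) + (?J - (y, l))"
    by simp_all
  then have "norm (?z - (xs, ls)) \<le> norm (?z - ?J) + norm (?J - (xs, ls))"
    "norm (?z - (y, l)) \<le> norm (?z - ?J) + norm (?J - (y, l))"
    by (metis norm_triangle_ineq)+
  ultimately show "norm (?z - (xs, ls)) \<le> norm ((y, l) - (xs, ls)) + e" "norm (?z - (y, l)) \<le> norm ((y, l) - (xs, ls)) + e"
    using e by linarith+
qed

text \<open>
  How a gap at \<open>x\<close> changes when the centre \<open>(y, l)\<close> is moved to \<open>(x, l')\<close> and \<open>b\<close> is lowered to \<open>b'\<close>. The
  change of the smoothing is bounded from above at \<open>x\<close> and from below at the competitor \<open>w\<close>. The lower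
  bound contains terms in \<open>w\<close> that are not bounded; they are absorbed by the strong convexity of the old
  problem, and only the difference of the two proximal points of \<open>h\<close> at \<open>p w\<close> remains.
\<close>

lemma shifted_gap:
  assumes b': "b < 2 * b'" "b' \<le> b" and x: "x \<in> C" and w: "w \<in> C"
    and l': "l' = \<Lambda> b l (p x)"
    and R: "norm ((p w - b *\<^sub>R (\<Lambda> b l (p w) - l)) - (p w - b' *\<^sub>R (\<Lambda> b' l' (p w) - l'))) \<le> R"
  shows "aug_val b' x l' x - aug_val b' x l' w \<le> 2 * (aug_val b y l x - aug_val b y l (exact_x b y l))
    + b * (norm (l' - l))\<^sup>2 + (b - b') / 2 * (norm (\<Lambda> b' l' (p x) - l'))\<^sup>2
    + b\<^sup>2 / (2 * b' - b) * (norm (y - x))\<^sup>2 + norm (l' - l) * R"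
proof -
  have b: "0 < b" "0 < b'" using b' by linarith+
  define x' v' where "x' = exact_x b y l" and "v' = exact_v b y l"
  define v where "v = \<Lambda> b l (p w)"
  define \<Delta> where "\<Delta> = aug_val b y l x - aug_val b y l x'"
  define W where "W = (p w - b *\<^sub>R (v - l)) - (p w - b' *\<^sub>R (\<Lambda> b' l' (p w) - l'))"
  have par: "(norm (a - c))\<^sup>2 \<le> 2 * (norm (a - d))\<^sup>2 + 2 * (norm (c - d))\<^sup>2" for a c d :: "'z::real_inner"
  proof -
    have "0 \<le> (norm ((a - d) + (c - d)))\<^sup>2" by simp
    then show ?thesis
      unfolding power2_norm_eq_inner by (simp add: inner_add inner_diff inner_commute algebra_simps)
  qed
  \<comment> \<open>The surplus of strong convexity at \<open>w\<close> is measured from the exact pair; measuring it from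
      \<open>(x, l')\<close> instead costs a second copy of the gap at \<open>x\<close> and a factor \<open>1/2\<close>.\<close>
  have gx: "b / 2 * (norm (x - x'))\<^sup>2 + b / 2 * (norm (l' - v'))\<^sup>2 \<le> \<Delta>"
    unfolding \<Delta>_def x'_def v'_def l' by (rule aug_val_gap_lower[OF b(1) x])
  have gw: "b / 2 * (norm (w - x'))\<^sup>2 + b / 2 * (norm (v - v'))\<^sup>2 \<le> aug_val b y l w - aug_val b y l x'"
    unfolding x'_def v'_def v_def by (rule aug_val_gap_lower[OF b(1) w])
  have "b / 4 * (norm (w - x))\<^sup>2 \<le> b / 4 * (2 * (norm (w - x'))\<^sup>2 + 2 * (norm (x - x'))\<^sup>2)"
    using b by (intro mult_left_mono par) auto
  moreover have "b / 4 * (norm (v - l'))\<^sup>2 \<le> b / 4 * (2 * (norm (v - v'))\<^sup>2 + 2 * (norm (l' - v'))\<^sup>2)"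
    using b by (intro mult_left_mono par) auto
  moreover have dist_r: "b / 4 * (2 * s + 2 * t) = b / 2 * s + b / 2 * t" for s t :: real
    by (simp add: field_simps)
  ultimately have g: "aug_val b y l x - aug_val b y l w \<le> 2 * \<Delta> - b / 4 * (norm (w - x))\<^sup>2 - b / 4 * (norm (v - l'))\<^sup>2"
    using gx gw \<Delta>_def unfolding dist_r by linarith
  \<comment> \<open>Young's inequality with weight \<open>2 b' - b\<close> leaves exactly the multiple \<open>b/4\<close> of \<open>|w - x|^2\<close>
      that the surplus provides.\<close>
  have prox: "- b / 2 * (norm (x - y))\<^sup>2 + b / 2 * (norm (w - y))\<^sup>2 - b' / 2 * (norm (w - x))\<^sup>2
      \<le> b / 4 * (norm (w - x))\<^sup>2 + b\<^sup>2 / (2 * b' - b) * (norm (y - x))\<^sup>2"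
  proof -
    define a c where "a = w - x" and "c = x - y"
    define \<theta> where "\<theta> = 2 * b' - b"
    have \<theta>: "0 < \<theta>" using b' by (simp add: \<theta>_def)
    have "0 \<le> (norm ((\<theta> / 2) *\<^sub>R a - b *\<^sub>R c))\<^sup>2 / \<theta>" using \<theta> by simp
    also have "(norm ((\<theta> / 2) *\<^sub>R a - b *\<^sub>R c))\<^sup>2 = \<theta>\<^sup>2 / 4 * (norm a)\<^sup>2 - \<theta> * (b * (a \<bullet> c)) + b\<^sup>2 * (norm c)\<^sup>2"
      unfolding power2_norm_eq_inner
      by (simp add: inner_diff inner_commute algebra_simps power2_eq_square)
    also have "\<dots> / \<theta> = \<theta> / 4 * (norm a)\<^sup>2 - b * (a \<bullet> c) + b\<^sup>2 / \<theta> * (norm c)\<^sup>2"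
      using \<theta> by (simp add: field_simps power2_eq_square)
    finally have 1: "b * (a \<bullet> c) \<le> \<theta> / 4 * (norm a)\<^sup>2 + b\<^sup>2 / \<theta> * (norm c)\<^sup>2" by simp
    have "w - y = a + c" by (simp add: a_def c_def)
    then have 2: "b / 2 * (norm (w - y))\<^sup>2 = b / 2 * (norm a)\<^sup>2 + b * (a \<bullet> c) + b / 2 * (norm c)\<^sup>2"
      unfolding power2_norm_eq_inner by (simp add: inner_add inner_commute field_simps)
    have 3: "b / 2 * (norm a)\<^sup>2 - b' / 2 * (norm a)\<^sup>2 + \<theta> / 4 * (norm a)\<^sup>2 = b / 4 * (norm a)\<^sup>2"
      by (simp add: \<theta>_def field_simps)
    have "- b / 2 * (norm c)\<^sup>2 + b / 2 * (norm (w - y))\<^sup>2 - b' / 2 * (norm a)\<^sup>2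
        \<le> b / 4 * (norm a)\<^sup>2 + b\<^sup>2 / \<theta> * (norm c)\<^sup>2"
      using 1 2 3 by linarith
    then show ?thesis by (simp add: a_def c_def \<theta>_def norm_minus_commute)
  qed
  \<comment> \<open>The lower bound at \<open>w\<close> is split by means of the difference \<open>W\<close> of the proximal points; the part
      linear in \<open>v - l'\<close> is absorbed by the surplus \<open>b/4 |v - l'|^2\<close>.\<close>
  have up: "sm b' l' (p x) \<le> sm b l (p x) + b * (norm (l' - l))\<^sup>2
      + (b - b') / 2 * (norm (\<Lambda> b' l' (p x) - l'))\<^sup>2"
    by (rule smooth_val_update_le[OF k b l'])
  have low: "sm b l (p w) + (l' - l) \<bullet> (b' *\<^sub>R (\<Lambda> b' l' (p w) - l')) \<le> sm b' l' (p w)"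
    by (rule smooth_val_shift_ge[OF k b(2) b'(2)])
  have "b' *\<^sub>R (\<Lambda> b' l' (p w) - l') = W + b *\<^sub>R (v - l') + b *\<^sub>R (l' - l)"
    by (simp add: W_def algebra_simps)
  then have inn: "(l' - l) \<bullet> (b' *\<^sub>R (\<Lambda> b' l' (p w) - l'))
      = (l' - l) \<bullet> W + b * ((l' - l) \<bullet> (v - l')) + b * (norm (l' - l))\<^sup>2"
    unfolding power2_norm_eq_inner by (simp add: inner_add_right)
  have "- ((l' - l) \<bullet> W) \<le> norm (l' - l) * norm W"
    using Cauchy_Schwarz_ineq2[of "l' - l" W] by linarith
  also have "\<dots> \<le> norm (l' - l) * R" using R by (intro mult_left_mono) (auto simp: W_def v_def)
  finally have W: "- ((l' - l) \<bullet> W) \<le> norm (l' - l) * R" .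
  have cross: "- (b * (a \<bullet> c)) \<le> b * (norm a)\<^sup>2 + b / 4 * (norm c)\<^sup>2" for a c :: 'd
  proof -
    have "0 \<le> b * (norm (a + (1 / 2) *\<^sub>R c))\<^sup>2" using b by simp
    then show ?thesis
      unfolding power2_norm_eq_inner by (simp add: inner_add inner_commute field_simps)
  qed
  have "aug_val b' x l' x = r x + sm b' l' (p x)" by (simp add: aug_val_def)
  moreover have "aug_val b' x l' w = r w + sm b' l' (p w) + b' / 2 * (norm (w - x))\<^sup>2" by (simp add: aug_val_def)
  moreover have "aug_val b y l x = r x + sm b l (p x) + b / 2 * (norm (x - y))\<^sup>2" by (simp add: aug_val_def)
  moreover have "aug_val b y l w = r w + sm b l (p w) + b / 2 * (norm (w - y))\<^sup>2" by (simp add: aug_val_def)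
  ultimately show ?thesis
    using g prox up low inn W cross[of "l' - l" "v - l'"] unfolding \<Delta>_def x'_def by linarith
qed

end

section \<open>Gradients under a one-sided quadratic bound\<close>

lemma GDERIV_unique:
  assumes "GDERIV f x :> D" "GDERIV f x :> D'"
  shows "D = D'"
proof -
  have "(\<lambda>h. h \<bullet> D) = (\<lambda>h. h \<bullet> D')"
    using assms unfolding gderiv_def by (rule has_derivative_unique)
  then have "(D - D') \<bullet> D = (D - D') \<bullet> D'" by metis
  then have "(D - D') \<bullet> (D - D') = 0" by (simp only: inner_diff_right diff_self)
  then show ?thesis by simp
qed

lemma differentiable_imp_GDERIV:
  fixes f :: "'a::euclidean_space \<Rightarrow> real"
  assumes "f differentiable (at x)"
  obtains D where "GDERIV f x :> D"
proof -
  obtain f' where f': "(f has_derivative f') (at x)" using assms by (auto simp: differentiable_def)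
  have "h \<bullet> adjoint f' 1 = f' h" for h
    using adjoint_works[OF has_derivative_linear[OF f'], of h 1] by simp
  then have "GDERIV f x :> adjoint f' 1" using f' by (simp add: gderiv_def)
  then show thesis by (rule that)
qed

lemma GDERIV_along_line:
  fixes f :: "'a::euclidean_space \<Rightarrow> real"
  assumes "GDERIV f a :> D"
  shows "((\<lambda>s. (f (a + s *\<^sub>R t) - f a) / s) \<longlongrightarrow> t \<bullet> D) (at_right 0)"
proof -
  have "(f has_derivative (\<lambda>h. h \<bullet> D)) (at (a + 0 *\<^sub>R t))" using assms by (simp add: gderiv_def)
  moreover have "((\<lambda>s. a + s *\<^sub>R t) has_derivative (\<lambda>s. s *\<^sub>R t)) (at 0)"
    by (auto intro!: derivative_eq_intros)
  ultimately have "((\<lambda>s. f (a + s *\<^sub>R t)) has_derivative (\<lambda>s. (s *\<^sub>R t) \<bullet> D)) (at 0)"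
    by (rule has_derivative_compose[rotated])
  then have "DERIV (\<lambda>s. f (a + s *\<^sub>R t)) 0 :> t \<bullet> D"
    by (simp add: has_field_derivative_def mult.commute[of _ "t \<bullet> D"])
  then have "((\<lambda>s. (f (a + s *\<^sub>R t) - f a) / s) \<longlongrightarrow> t \<bullet> D) (at 0)"
    by (simp add: DERIV_def)
  then show ?thesis by (rule tendsto_within_subset) simp
qed

lemma convex_on_gradient_ineq:
  fixes f :: "'a::euclidean_space \<Rightarrow> real"
  assumes f: "convex_on S f" and a: "a \<in> S" and z: "z \<in> S" and D: "GDERIV f a :> D"
  shows "f a + D \<bullet> (z - a) \<le> f z"
proof -
  have "(f (a + s *\<^sub>R (z - a)) - f a) / s \<le> f z - f a" if s: "0 < s" "s < 1" for s
  proof -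
    have "a + s *\<^sub>R (z - a) = (1 - s) *\<^sub>R a + s *\<^sub>R z" by (simp add: algebra_simps)
    then have "f (a + s *\<^sub>R (z - a)) \<le> (1 - s) * f a + s * f z"
      using f a z s by (simp add: convex_onD)
    then show ?thesis using s by (simp add: field_simps)
  qed
  then have "\<forall>\<^sub>F s in at_right 0. (f (a + s *\<^sub>R (z - a)) - f a) / s \<le> f z - f a"
    by (auto simp: eventually_at_right[of 0 1] intro!: exI[of _ 1])
  from tendsto_upperbound[OF GDERIV_along_line[OF D] this] show ?thesis
    by (simp add: inner_commute)
qed

text \<open>
  Telescope over a subdivision of \<open>[0, T]\<close> of mesh at most \<open>\<delta>\<close>.
\<close>

lemma local_growth_imp_growth:
  fixes q :: "real \<Rightarrow> real"
  assumes loc: "\<And>a b. 0 \<le> a \<Longrightarrow> a \<le> b \<Longrightarrow> b \<le> T \<Longrightarrow> b - a \<le> \<delta> \<Longrightarrow> q b - q a \<le> c * (b - a)"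
    and \<delta>: "0 < \<delta>" and T: "0 \<le> T"
  shows "q T - q 0 \<le> c * T"
proof -
  obtain N :: nat where N: "T / \<delta> < real N" using reals_Archimedean2 by blast
  have N0: "0 < real N" using N T \<delta> by (smt (verit) divide_nonneg_pos)
  have step: "T / N \<le> \<delta>" using N N0 \<delta> by (simp add: field_simps)
  have "i \<le> N \<Longrightarrow> q (i * (T / N)) - q 0 \<le> c * (i * (T / N))" for i
  proof (induction i)
    case (Suc i)
    have 1: "real (Suc i) * (T / N) - real i * (T / N) = T / N" by (simp add: algebra_simps add_divide_distrib)
    have "real (Suc i) * (T / N) \<le> real N * (T / N)"
      using Suc.prems T by (intro mult_right_mono) auto
    then have "real (Suc i) * (T / N) \<le> T" using N0 by simp
    moreover have "real i * (T / N) \<le> real (Suc i) * (T / N)"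
      using T by (intro mult_right_mono) auto
    ultimately have "q (real (Suc i) * (T / N)) - q (real i * (T / N))
        \<le> c * (real (Suc i) * (T / N) - real i * (T / N))"
      using T step by (intro loc) (auto simp only: 1 intro!: mult_nonneg_nonneg divide_nonneg_nonneg)
    with Suc show ?case by (simp add: algebra_simps)
  qed simp
  from this[of N] N0 show ?thesis by simp
qed

text \<open>
  As the quadratic upper bound is available on \<open>C\<close> only, and \<open>C\<close> may have empty interior, the gradient
  itself need not be Lipschitz; its components along \<open>C\<close> are. For two points \<open>a\<close>, \<open>b\<close> of the segment from
  \<open>x\<close> to \<open>w\<close>, move from \<open>a\<close> in the direction \<open>y - x\<close> by the distance from \<open>a\<close> to \<open>b\<close>: the upper bounds
  at \<open>a\<close> and \<open>b\<close> and the gradient inequality at \<open>b\<close> give the estimate for this pair. The move must stay in the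
  triangle \<open>x, w, y\<close>, so only close pairs are allowed and the segment is subdivided. At \<open>w\<close> the triangle
  leaves no room; there the estimate follows by a limit that uses the derivative of \<open>\<phi>\<close> at \<open>w\<close>, along
  points of the open set \<open>U\<close>.
\<close>

lemma gradient_increment_le:
  fixes \<phi> :: "'a::euclidean_space \<Rightarrow> real"
  assumes C: "convex C" and U: "open U" "C \<subseteq> U"
    and grad: "\<And>a. a \<in> C \<Longrightarrow> GDERIV \<phi> a :> G a"
    and sub: "\<And>a z. a \<in> C \<Longrightarrow> z \<in> U \<Longrightarrow> \<phi> a + G a \<bullet> (z - a) \<le> \<phi> z"
    and cont: "continuous_on U \<phi>"
    and desc: "\<And>a z. a \<in> C \<Longrightarrow> z \<in> C \<Longrightarrow> \<phi> z \<le> \<phi> a + G a \<bullet> (z - a) + L / 2 * (norm (z - a))\<^sup>2"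
    and L: "0 \<le> L" and xyw: "x \<in> C" "y \<in> C" "w \<in> C"
  shows "(G w - G x) \<bullet> (y - x) \<le> L * norm (w - x) * norm (y - x)"
proof (cases "y = x \<or> w = x")
  case False
  then have nz: "y \<noteq> x" "w \<noteq> x" by auto
  define t d where "t = y - x" and "d = w - x"
  have nt: "0 < norm t" "0 < norm d" using nz by (auto simp: t_def d_def)
  define X where "X \<theta> = x + \<theta> *\<^sub>R d" for \<theta>
  define q where "q \<theta> = G (X \<theta>) \<bullet> t" for \<theta>
  define B where "B = L * norm d * norm t"
  have B0: "0 \<le> B" using L by (simp add: B_def)
  have tri: "X \<theta> + \<kappa> *\<^sub>R t \<in> C" if "0 \<le> \<theta>" "0 \<le> \<kappa>" "\<theta> + \<kappa> \<le> 1" for \<theta> \<kappa>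
  proof -
    have "X \<theta> + \<kappa> *\<^sub>R t = (1 - \<theta> - \<kappa>) *\<^sub>R x + \<theta> *\<^sub>R w + \<kappa> *\<^sub>R y"
      by (simp add: X_def d_def t_def algebra_simps)
    then have "X \<theta> + \<kappa> *\<^sub>R t \<in> convex hull {x, w, y}"
      using that unfolding convex_hull_3 by (intro CollectI exI[of _ "1 - \<theta> - \<kappa>"] exI[of _ \<theta>] exI[of _ \<kappa>]) auto
    also have "\<dots> \<subseteq> C" using xyw C by (intro hull_minimal) auto
    finally show ?thesis .
  qed
  have XC: "X \<theta> \<in> C" if "0 \<le> \<theta>" "\<theta> \<le> 1" for \<theta> using tri[of \<theta> 0] that by simp
  have one: "q b - q a \<le> B * (b - a)"
    if ab: "0 \<le> a" "a \<le> b" and small: "b - a \<le> (1 - b) * (norm t / norm d)" for a b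
  proof (cases "a = b")
    case False
    define \<kappa> where "\<kappa> = (b - a) * norm d / norm t"
    have \<kappa>: "0 < \<kappa>" using False ab nt by (simp add: \<kappa>_def)
    have \<kappa>1: "\<kappa> \<le> 1 - b" using small nt by (simp add: \<kappa>_def field_simps)
    then have b1: "b \<le> 1" using \<kappa> by linarith
    have C1: "X a \<in> C" "X b \<in> C" using ab b1 by (auto intro: XC)
    have C2: "X a + \<kappa> *\<^sub>R t \<in> C" using ab \<kappa> \<kappa>1 by (intro tri) auto
    have "X b - X a = (b - a) *\<^sub>R d" by (simp add: X_def algebra_simps)
    then have nba: "(norm (X b - X a))\<^sup>2 = \<kappa>\<^sup>2 * (norm t)\<^sup>2"
      using nt by (simp add: \<kappa>_def power_mult_distrib power_divide)
    have C2': "X b + \<kappa> *\<^sub>R t \<in> C" using ab \<kappa> \<kappa>1 by (intro tri) auto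
    have "\<phi> (X b) + G (X b) \<bullet> (X a + \<kappa> *\<^sub>R t - X b) \<le> \<phi> (X a + \<kappa> *\<^sub>R t)"
      using C1 C2 U by (intro sub) auto
    moreover have "\<phi> (X a + \<kappa> *\<^sub>R t) \<le> \<phi> (X a) + G (X a) \<bullet> (\<kappa> *\<^sub>R t) + L / 2 * (norm (\<kappa> *\<^sub>R t))\<^sup>2"
      using desc[OF C1(1) C2] by simp
    moreover have "\<phi> (X a) \<le> \<phi> (X b) + G (X b) \<bullet> (X a - X b) + L / 2 * (\<kappa>\<^sup>2 * (norm t)\<^sup>2)"
      using desc[OF C1(2) C1(1)] nba by (simp add: norm_minus_commute)
    moreover have "(norm (\<kappa> *\<^sub>R t))\<^sup>2 = \<kappa>\<^sup>2 * (norm t)\<^sup>2" by (simp add: power_mult_distrib)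
    ultimately have "\<kappa> * (q b - q a) \<le> L * (\<kappa>\<^sup>2 * (norm t)\<^sup>2)"
      by (simp add: q_def inner_diff_right inner_add_right algebra_simps)
    also have "\<dots> = \<kappa> * (L * \<kappa> * (norm t)\<^sup>2)" by (simp add: power2_eq_square)
    finally have "q b - q a \<le> L * \<kappa> * (norm t)\<^sup>2" using \<kappa> by simp
    also have "\<dots> = B * (b - a)" using nt by (simp add: \<kappa>_def B_def power2_eq_square)
    finally show ?thesis .
  qed simp
  have qT: "q T \<le> q 0 + B" if T: "0 \<le> T" "T < 1" for T
  proof -
    have "q T - q 0 \<le> B * T"
    proof (rule local_growth_imp_growth[where \<delta> = "(1 - T) * (norm t / norm d)"])
      fix a b assume ab: "0 \<le> a" "a \<le> b" "b \<le> T" "b - a \<le> (1 - T) * (norm t / norm d)"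
      have "(1 - T) * (norm t / norm d) \<le> (1 - b) * (norm t / norm d)"
        using ab by (intro mult_right_mono) auto
      with ab show "q b - q a \<le> B * (b - a)" by (intro one) auto
    qed (use T nt in auto)
    also have "B * T \<le> B" using B0 T by (simp add: mult_left_le)
    finally show ?thesis by simp
  qed
  \<comment> \<open>Difference quotients of \<open>\<phi>\<close> at \<open>w\<close> in the direction \<open>- t\<close> are limits of those at \<open>X \<theta>\<close>,
      which the gradients at \<open>X \<theta>\<close> bound.\<close>
  have X1: "X 1 = w" by (simp add: X_def d_def)
  have "\<forall>\<^sub>F s in at_right 0. - (q 0 + B) \<le> (\<phi> (w + s *\<^sub>R (- t)) - \<phi> w) / s"
  proof -
    have "((\<lambda>s. w + s *\<^sub>R (- t)) \<longlongrightarrow> w + 0 *\<^sub>R (- t)) (at_right 0)" by (intro tendsto_intros)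
    then have "\<forall>\<^sub>F s in at_right 0. w + s *\<^sub>R (- t) \<in> U"
      using U xyw by (intro topological_tendstoD) auto
    with eventually_at_right_less[of 0] show ?thesis
    proof eventually_elim
      fix s :: real assume s: "0 < s" and sU: "w + s *\<^sub>R (- t) \<in> U"
      have isC: "isCont \<phi> u" if "u \<in> U" for u
        using cont U(1) that by (simp add: continuous_on_eq_continuous_at)
      have XT: "(X \<longlongrightarrow> w) (at_left 1)"
      proof -
        have "(X \<longlongrightarrow> x + 1 *\<^sub>R d) (at_left 1)" unfolding X_def by (intro tendsto_intros)
        then show ?thesis by (simp add: d_def)
      qed
      have XsT: "((\<lambda>\<theta>. X \<theta> + s *\<^sub>R (- t)) \<longlongrightarrow> w + s *\<^sub>R (- t)) (at_left 1)"
        by (intro tendsto_intros XT)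
      have lim: "((\<lambda>\<theta>. \<phi> (X \<theta>) - \<phi> (X \<theta> + s *\<^sub>R (- t))) \<longlongrightarrow> \<phi> w - \<phi> (w + s *\<^sub>R (- t))) (at_left 1)"
        using U xyw sU by (intro tendsto_diff isCont_tendsto_compose[OF isC XT] isCont_tendsto_compose[OF isC XsT]) auto
      have evU: "\<forall>\<^sub>F \<theta> in at_left 1. X \<theta> + s *\<^sub>R (- t) \<in> U"
        using XsT U(1) sU by (rule topological_tendstoD)
      have ev0: "\<forall>\<^sub>F \<theta> in at_left (1::real). 0 < \<theta> \<and> \<theta> < 1"
        by (auto simp: eventually_at_left[of 0 1] intro!: exI[of _ 0])
      have "\<forall>\<^sub>F \<theta> in at_left 1. \<phi> (X \<theta>) - \<phi> (X \<theta> + s *\<^sub>R (- t)) \<le> s * (q 0 + B)"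
        using evU ev0
      proof eventually_elim
        fix \<theta> assume \<theta>: "X \<theta> + s *\<^sub>R (- t) \<in> U" "0 < \<theta> \<and> \<theta> < 1"
        have "\<phi> (X \<theta>) + G (X \<theta>) \<bullet> (X \<theta> + s *\<^sub>R (- t) - X \<theta>) \<le> \<phi> (X \<theta> + s *\<^sub>R (- t))"
          using \<theta> by (intro sub XC) auto
        then have "\<phi> (X \<theta>) - \<phi> (X \<theta> + s *\<^sub>R (- t)) \<le> s * q \<theta>" by (simp add: q_def)
        also have "\<dots> \<le> s * (q 0 + B)" using s \<theta> by (intro mult_left_mono qT) auto
        finally show "\<phi> (X \<theta>) - \<phi> (X \<theta> + s *\<^sub>R (- t)) \<le> s * (q 0 + B)" .
      qed
      from tendsto_upperbound[OF lim this] have "\<phi> w - \<phi> (w + s *\<^sub>R (- t)) \<le> s * (q 0 + B)" by simp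
      then show "- (q 0 + B) \<le> (\<phi> (w + s *\<^sub>R (- t)) - \<phi> w) / s"
        using s by (simp add: field_simps)
    qed
  qed
  from tendsto_lowerbound[OF GDERIV_along_line[OF grad[OF xyw(3)], of "- t"] this]
  have "- (q 0 + B) \<le> - (t \<bullet> G w)" by simp
  then show ?thesis
    by (simp add: q_def X_def B_def t_def d_def inner_commute inner_diff)
qed auto

section \<open>Mean-square estimates\<close>

text \<open>
  Integrate \<open>f \<le> f^2 / (2 C) + C / 2\<close>.
\<close>

lemma (in prob_space) nn_integral_le_sqrt:
  fixes f :: "'a \<Rightarrow> real"
  assumes [measurable]: "f \<in> borel_measurable M" and C: "0 < C"
    and f: "(\<integral>\<^sup>+ \<omega>. ennreal ((f \<omega>)\<^sup>2) \<partial>M) \<le> ennreal (C\<^sup>2)"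
  shows "(\<integral>\<^sup>+ \<omega>. ennreal (f \<omega>) \<partial>M) \<le> ennreal C"
proof -
  have "f \<omega> \<le> 1 / (2 * C) * (f \<omega>)\<^sup>2 + C / 2" for \<omega>
    using C zero_le_power2[of "f \<omega> - C"] by (simp add: field_simps power2_eq_square)
  then have "(\<integral>\<^sup>+ \<omega>. ennreal (f \<omega>) \<partial>M)
      \<le> (\<integral>\<^sup>+ \<omega>. ennreal (1 / (2 * C)) * ennreal ((f \<omega>)\<^sup>2) + ennreal (C / 2) \<partial>M)"
    using C by (intro nn_integral_mono) (simp flip: ennreal_mult' ennreal_plus add: ennreal_leI)
  also have "\<dots> = ennreal (1 / (2 * C)) * (\<integral>\<^sup>+ \<omega>. ennreal ((f \<omega>)\<^sup>2) \<partial>M) + ennreal (C / 2)"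
    by (simp add: nn_integral_add nn_integral_cmult emeasure_space_1)
  also have "\<dots> \<le> ennreal (1 / (2 * C)) * ennreal (C\<^sup>2) + ennreal (C / 2)"
    by (intro add_mono mult_left_mono f) auto
  also have "\<dots> = ennreal C"
    using C by (simp flip: ennreal_mult' ennreal_plus add: power2_eq_square)
  finally show ?thesis .
qed

text \<open>
  Minkowski's inequality for square integrals, from \<open>(f + g)^2 \<le> (1 + B/A) f^2 + (1 + A/B) g^2\<close>.
\<close>

lemma nn_integral_square_add_le:
  fixes f g :: "'a \<Rightarrow> real"
  assumes [measurable]: "f \<in> borel_measurable M" "g \<in> borel_measurable M"
    and AB: "0 \<le> A" "0 \<le> B"
    and f: "(\<integral>\<^sup>+ \<omega>. ennreal ((f \<omega>)\<^sup>2) \<partial>M) \<le> ennreal (A\<^sup>2)"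
    and g: "(\<integral>\<^sup>+ \<omega>. ennreal ((g \<omega>)\<^sup>2) \<partial>M) \<le> ennreal (B\<^sup>2)"
  shows "(\<integral>\<^sup>+ \<omega>. ennreal ((f \<omega> + g \<omega>)\<^sup>2) \<partial>M) \<le> ennreal ((A + B)\<^sup>2)"
proof -
  consider "A = 0" | "B = 0" | "0 < A" "0 < B" using AB by linarith
  then show ?thesis
  proof cases
    case 1
    then have "AE \<omega> in M. f \<omega> = 0" using f by (simp add: nn_integral_0_iff_AE)
    then have "(\<integral>\<^sup>+ \<omega>. ennreal ((f \<omega> + g \<omega>)\<^sup>2) \<partial>M) = (\<integral>\<^sup>+ \<omega>. ennreal ((g \<omega>)\<^sup>2) \<partial>M)"
      by (intro nn_integral_cong_AE) auto
    with g 1 show ?thesis by simp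
  next
    case 2
    then have "AE \<omega> in M. g \<omega> = 0" using g by (simp add: nn_integral_0_iff_AE)
    then have "(\<integral>\<^sup>+ \<omega>. ennreal ((f \<omega> + g \<omega>)\<^sup>2) \<partial>M) = (\<integral>\<^sup>+ \<omega>. ennreal ((f \<omega>)\<^sup>2) \<partial>M)"
      by (intro nn_integral_cong_AE) auto
    with f 2 show ?thesis by simp
  next
    case 3
    have "(f \<omega> + g \<omega>)\<^sup>2 \<le> (1 + B / A) * (f \<omega>)\<^sup>2 + (1 + A / B) * (g \<omega>)\<^sup>2" for \<omega>
    proof -
      have "0 \<le> (B * f \<omega> - A * g \<omega>)\<^sup>2 / (A * B)" using 3 by simp
      also have "\<dots> = B / A * (f \<omega>)\<^sup>2 + A / B * (g \<omega>)\<^sup>2 - 2 * f \<omega> * g \<omega>"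
        using 3 by (simp add: field_simps power2_eq_square)
      finally show ?thesis by (simp add: power2_sum algebra_simps)
    qed
    then have "(\<integral>\<^sup>+ \<omega>. ennreal ((f \<omega> + g \<omega>)\<^sup>2) \<partial>M)
      \<le> (\<integral>\<^sup>+ \<omega>. ennreal (1 + B / A) * ennreal ((f \<omega>)\<^sup>2) + ennreal (1 + A / B) * ennreal ((g \<omega>)\<^sup>2) \<partial>M)"
      using 3 by (intro nn_integral_mono) (simp flip: ennreal_mult' ennreal_plus add: ennreal_leI)
    also have "\<dots> = ennreal (1 + B / A) * (\<integral>\<^sup>+ \<omega>. ennreal ((f \<omega>)\<^sup>2) \<partial>M)
        + ennreal (1 + A / B) * (\<integral>\<^sup>+ \<omega>. ennreal ((g \<omega>)\<^sup>2) \<partial>M)"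
      by (simp add: nn_integral_add nn_integral_cmult)
    also have "\<dots> \<le> ennreal (1 + B / A) * ennreal (A\<^sup>2) + ennreal (1 + A / B) * ennreal (B\<^sup>2)"
      by (intro add_mono mult_left_mono f g) auto
    also have "\<dots> = ennreal ((1 + B / A) * A\<^sup>2 + (1 + A / B) * B\<^sup>2)"
      using 3 by (simp flip: ennreal_mult' ennreal_plus)
    also have "(1 + B / A) * A\<^sup>2 + (1 + A / B) * B\<^sup>2 = (A + B)\<^sup>2"
      using 3 by (simp add: field_simps power2_eq_square)
    finally show ?thesis .
  qed
qed

section \<open>Extended-real-valued functions and their finite parts\<close>

lemma econvex_imp_convex_on:
  assumes F: "econvex F" and nm: "\<And>x. F x \<noteq> -\<infinity>"
  shows "convex_on (edom F) (\<lambda>x. real_of_ereal (F x))"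
proof -
  have key: "t *\<^sub>R x + (1 - t) *\<^sub>R y \<in> edom F \<and> real_of_ereal (F (t *\<^sub>R x + (1 - t) *\<^sub>R y))
      \<le> t * real_of_ereal (F x) + (1 - t) * real_of_ereal (F y)"
    if xy: "x \<in> edom F" "y \<in> edom F" and t: "0 < t" "t < 1" for x y t
  proof -
    obtain a b where ab: "F x = ereal a" "F y = ereal b"
      using xy nm[of x] nm[of y] by (cases "F x"; cases "F y") (auto simp: edom_def)
    have "F (t *\<^sub>R x + (1 - t) *\<^sub>R y) \<le> ereal t * F x + ereal (1 - t) * F y"
      using F t by (auto simp: econvex_def)
    then have "F (t *\<^sub>R x + (1 - t) *\<^sub>R y) \<le> ereal (t * a + (1 - t) * b)" by (simp add: ab)
    then show ?thesis
      using nm[of "t *\<^sub>R x + (1 - t) *\<^sub>R y"]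
      by (cases "F (t *\<^sub>R x + (1 - t) *\<^sub>R y)") (auto simp: edom_def ab)
  qed
  show ?thesis
  proof (rule convex_onI)
    show "real_of_ereal (F ((1 - t) *\<^sub>R x + t *\<^sub>R y)) \<le> (1 - t) * real_of_ereal (F x) + t * real_of_ereal (F y)"
      if "0 < t" "t < 1" "x \<in> edom F" "y \<in> edom F" for t x y
      using key[of x y "1 - t"] that by simp
    show "convex (edom F)"
    proof (rule convexI)
      fix x y and u v :: real
      assume *: "x \<in> edom F" "y \<in> edom F" "0 \<le> u" "0 \<le> v" "u + v = 1"
      then have v: "v = 1 - u" by simp
      consider "u = 0" | "u = 1" | "0 < u" "u < 1" using * by linarith
      then show "u *\<^sub>R x + v *\<^sub>R y \<in> edom F"
        by cases (use * key[of x y u] in \<open>auto simp: v\<close>)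
    qed
  qed
qed

lemma edom_ereal_real:
  assumes "x \<in> edom F" "F x \<noteq> -\<infinity>"
  shows "F x = ereal (real_of_ereal (F x))"
  using assms by (cases "F x") (auto simp: edom_def)

lemma in_subdiffI:
  assumes nm: "\<And>y. F y \<noteq> -\<infinity>" and x: "x \<in> edom F"
    and le: "\<And>y. y \<in> edom F \<Longrightarrow> real_of_ereal (F x) + v \<bullet> (y - x) \<le> real_of_ereal (F y)"
  shows "v \<in> subdiff F x"
proof -
  have Fx: "F x = ereal (real_of_ereal (F x))" by (rule edom_ereal_real[OF x nm])
  have "F x + ereal (v \<bullet> (y - x)) \<le> F y" for y
  proof (cases "y \<in> edom F")
    case True
    show ?thesis
      by (subst Fx, subst edom_ereal_real[OF True nm]) (simp add: le[OF True])
  qed (simp add: edom_def)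
  moreover have "\<bar>F x\<bar> \<noteq> \<infinity>" by (subst Fx) simp
  ultimately show ?thesis by (simp add: subdiff_def)
qed

lemma edist_set_zero_le:
  assumes "v \<in> A"
  shows "edist_set 0 A \<le> ennreal (norm v)"
  unfolding edist_set_def using assms by (intro INF_lower2[of v]) (auto simp: dist_norm)

lemma egrad_eq:
  assumes "GDERIV (\<lambda>y. real_of_ereal (F y)) x :> D"
  shows "egrad F x = D"
  unfolding egrad_def using assms by (blast intro: GDERIV_unique)

section \<open>The composite problem as a convex coupling\<close>

context composite_problem
begin

text \<open>
  The closed convex functions in question: \<open>f + g\<close>, represented by \<open>r\<close> on \<open>C\<close>, and \<open>h*\<close>, represented by \<open>k\<close>
  on \<open>E\<close>.
\<close>

definition C :: "(real^'a) set" where "C = edom g"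
definition r :: "real^'a \<Rightarrow> real" where "r x = real_of_ereal (f x) + real_of_ereal (g x)"
definition E :: "((real^'b) \<times> (real^'c)) set" where "E = edom (fenchel_conj h)"
definition k :: "(real^'b) \<times> (real^'c) \<Rightarrow> real" where "k v = real_of_ereal (fenchel_conj h v)"

lemma g_not_minf: "g x \<noteq> -\<infinity>"
  using g_proper by (simp add: eproper_def)

lemma conj_not_minf: "fenchel_conj h v \<noteq> -\<infinity>"
proof -
  obtain z where z: "z \<in> \<K>" using K_nonempty by blast
  have "ereal (v \<bullet> (0, z)) - h (0, z) \<le> fenchel_conj h v"
    unfolding fenchel_conj_def by (rule SUP_upper) simp
  then show ?thesis using z by (auto simp: split_h_def indicator_fun_def)
qed

lemma conj_eq: "v \<in> E \<Longrightarrow> fenchel_conj h v = ereal (k v)"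
  unfolding E_def k_def using edom_ereal_real[of v "fenchel_conj h"] conj_not_minf[of v] by simp

lemma conj_eq_inf: "v \<notin> E \<Longrightarrow> fenchel_conj h v = \<infinity>"
  by (simp add: E_def edom_def)

lemma conj_le_iff:
  "v \<in> E \<and> k v \<le> t \<longleftrightarrow> (\<forall>u. snd u \<in> \<K> \<longrightarrow> v \<bullet> u - h1 (fst u) \<le> t)"
proof -
  have "v \<in> E \<and> k v \<le> t \<longleftrightarrow> fenchel_conj h v \<le> ereal t"
    by (cases "v \<in> E") (auto simp: conj_eq conj_eq_inf)
  also have "\<dots> \<longleftrightarrow> (\<forall>u. ereal (v \<bullet> u) - h u \<le> ereal t)"
    by (simp add: fenchel_conj_def SUP_le_iff)
  also have "\<dots> \<longleftrightarrow> (\<forall>u. snd u \<in> \<K> \<longrightarrow> v \<bullet> u - h1 (fst u) \<le> t)"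
    by (intro all_cong1) (auto simp: split_h_def indicator_fun_def)
  finally show ?thesis .
qed

lemma conj_ge: "v \<in> E \<Longrightarrow> snd u \<in> \<K> \<Longrightarrow> v \<bullet> u - h1 (fst u) \<le> k v"
  using conj_le_iff[of v "k v"] by blast

lemma conj_leI:
  assumes "\<And>u. snd u \<in> \<K> \<Longrightarrow> v \<bullet> u - h1 (fst u) \<le> t"
  shows "v \<in> E" "k v \<le> t"
  using conj_le_iff[of v t] assms by auto

lemma conj_closed_convex: "closed_convex_on E k"
proof -
  have comb: "u *\<^sub>R v + u' *\<^sub>R v' \<in> E \<and> k (u *\<^sub>R v + u' *\<^sub>R v') \<le> u * k v + u' * k v'"
    if "v \<in> E" "v' \<in> E" "0 \<le> u" "0 \<le> u'" "u + u' = 1" for v v' u u'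
    unfolding conj_le_iff
  proof (intro allI impI)
    fix w :: "(real^'b) \<times> (real^'c)" assume w: "snd w \<in> \<K>"
    have "u * (v \<bullet> w - h1 (fst w)) + u' * (v' \<bullet> w - h1 (fst w)) \<le> u * k v + u' * k v'"
      using that w by (intro add_mono mult_left_mono conj_ge) auto
    moreover have "u * (v \<bullet> w - h1 (fst w)) + u' * (v' \<bullet> w - h1 (fst w))
        = (u *\<^sub>R v + u' *\<^sub>R v') \<bullet> w - (u + u') * h1 (fst w)"
      by (simp add: inner_add_left algebra_simps)
    ultimately show "(u *\<^sub>R v + u' *\<^sub>R v') \<bullet> w - h1 (fst w) \<le> u * k v + u' * k v'"
      using that by simp
  qed
  then have "convex_on E k" by (auto simp: convex_on_def convex_def)
  moreover have "{(v, t). v \<in> E \<and> k v \<le> t}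
      = (\<Inter>u\<in>{u. snd u \<in> \<K>}. {w. fst w \<bullet> u - h1 (fst u) \<le> snd w})"
    by (auto simp: conj_le_iff)
  moreover have "closed (\<Inter>u\<in>{u. snd u \<in> \<K>}. {w :: ((real^'b) \<times> (real^'c)) \<times> real. fst w \<bullet> u - h1 (fst u) \<le> snd w})"
    by (intro closed_INT ballI closed_Collect_le continuous_intros)
  moreover have "E \<noteq> {}" using strong_duality by (auto simp: E_def)
  ultimately show ?thesis by (simp add: closed_convex_on_def)
qed

text \<open>
  Let \<open>d\<close> be the value of \<open>p\<close> at a convex combination minus the combination of the values. The
  hypotheses, used with \<open>u = p x - w\<close> and \<open>v = p y - w\<close>, say that \<open>h1 (w + d1) \<le> h1 w\<close> and that \<open>\<K>\<close> is
  invariant under adding \<open>d2\<close>. Iterating, \<open>h\<close> is bounded above along the ray in direction \<open>d\<close>, so finiteness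
  of \<open>h* v\<close> forces \<open>v \<bullet> d \<le> 0\<close>.
\<close>

lemma p_coupling_convex:
  assumes v: "v \<in> E"
  shows "convex_on UNIV (\<lambda>x. v \<bullet> p x)"
proof (rule convex_onI)
  fix t :: real and x y :: "real^'a" assume t: "0 < t" "t < 1"
  define z where "z = (1 - t) *\<^sub>R x + t *\<^sub>R y"
  define d where "d = p z - ((1 - t) *\<^sub>R p x + t *\<^sub>R p y)"
  have h1d: "h1 (w + fst d) \<le> h1 w" for w
  proof -
    have "h1 (p1 z - (1 - t) *\<^sub>R (p1 x - w) - (1 - (1 - t)) *\<^sub>R (p1 y - w))
        \<le> (1 - t) * h1 (p1 x - (p1 x - w)) + (1 - (1 - t)) * h1 (p1 y - (p1 y - w))"
      using h1_p1_convex[where \<alpha> = "1 - t" and x = x and y = y and u = "p1 x - w" and v = "p1 y - w"] t by (simp add: z_def)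
    moreover have "p1 z - (1 - t) *\<^sub>R (p1 x - w) - (1 - (1 - t)) *\<^sub>R (p1 y - w) = w + fst d"
      by (simp add: d_def algebra_simps)
    ultimately show ?thesis by (simp add: algebra_simps)
  qed
  have Kd: "w + snd d \<in> \<K>" if "w \<in> \<K>" for w
  proof -
    have "p2 z - (1 - t) *\<^sub>R (p2 x - w) - (1 - (1 - t)) *\<^sub>R (p2 y - w) \<in> \<K>"
      using K_p2_convex[where \<alpha> = "1 - t" and x = x and y = y and u = "p2 x - w" and v = "p2 y - w"] t that by (simp add: z_def)
    moreover have "p2 z - (1 - t) *\<^sub>R (p2 x - w) - (1 - (1 - t)) *\<^sub>R (p2 y - w) = w + snd d"
      by (simp add: d_def algebra_simps)
    ultimately show ?thesis by simp
  qed
  obtain z0 where z0: "z0 \<in> \<K>" using K_nonempty by blast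
  have it: "h1 (real n *\<^sub>R fst d) \<le> h1 0 \<and> z0 + real n *\<^sub>R snd d \<in> \<K>" for n
  proof (induction n)
    case (Suc n)
    have "h1 (real n *\<^sub>R fst d + fst d) \<le> h1 (real n *\<^sub>R fst d)" by (rule h1d)
    moreover have "z0 + real n *\<^sub>R snd d + snd d \<in> \<K>" using Suc by (intro Kd) auto
    ultimately show ?case using Suc by (simp add: algebra_simps)
  qed (simp add: z0)
  have "real n * (v \<bullet> d) \<le> k v + h1 0 - v \<bullet> (0, z0)" for n
  proof -
    have "v \<bullet> (real n *\<^sub>R fst d, z0 + real n *\<^sub>R snd d) - h1 (real n *\<^sub>R fst d) \<le> k v"
      using conj_ge[OF v, of "(real n *\<^sub>R fst d, z0 + real n *\<^sub>R snd d)"] it[of n] by simp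
    moreover have "(real n *\<^sub>R fst d, z0 + real n *\<^sub>R snd d) = (0, z0) + real n *\<^sub>R d"
      by (simp add: prod_eq_iff)
    ultimately show ?thesis using it[of n] by (simp add: inner_add_right del: add_Pair)
  qed
  then have "v \<bullet> d \<le> 0"
    using reals_Archimedean3[of "v \<bullet> d"] by (meson not_le)
  then show "v \<bullet> p ((1 - t) *\<^sub>R x + t *\<^sub>R y) \<le> (1 - t) * (v \<bullet> p x) + t * (v \<bullet> p y)"
    unfolding z_def[symmetric] by (simp add: d_def inner_diff_right inner_add_right del: add_Pair scaleR_Pair diff_Pair)
qed simp

lemma p_differentiable: "p differentiable (at x)"
  using p1_differentiable p2_differentiable
  by (auto simp: differentiable_on_def intro: differentiable_Pair)

lemma p_continuous: "continuous_on UNIV p"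
  using p_differentiable by (auto simp: continuous_on_eq_continuous_at intro: differentiable_imp_continuous_within)

section \<open>The smooth part f\<close>

lemma f_domain:
  obtains U where "open U" "C \<subseteq> U" "U \<subseteq> edom f"
    "\<And>x. x \<in> U \<Longrightarrow> GDERIV (\<lambda>y. real_of_ereal (f y)) x :> egrad f x"
    "continuous_on U (\<lambda>y. real_of_ereal (f y))"
proof -
  obtain U where U: "open U" "C \<subseteq> U"
    "\<And>x. x \<in> U \<Longrightarrow> f x < \<infinity> \<and> (\<lambda>y. real_of_ereal (f y)) differentiable (at x)"
    using f_differentiable unfolding C_def by blast
  have "GDERIV (\<lambda>y. real_of_ereal (f y)) x :> egrad f x" if "x \<in> U" for x
    using U(3)[OF that] differentiable_imp_GDERIV egrad_eq by metis
  moreover have "continuous_on U (\<lambda>y. real_of_ereal (f y))"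
    by (intro continuous_at_imp_continuous_on ballI differentiable_imp_continuous_within)
       (use U(3) in blast)
  ultimately show thesis using U by (intro that[of U]) (auto simp: edom_def)
qed

lemma f_convex_on: "convex_on (edom f) (\<lambda>x. real_of_ereal (f x))"
  by (rule econvex_imp_convex_on[OF f_convex f_not_minf])

lemma g_convex_on: "convex_on C (\<lambda>x. real_of_ereal (g x))"
  unfolding C_def by (rule econvex_imp_convex_on[OF g_convex g_not_minf])

lemma C_sub_f: "C \<subseteq> edom f" by (rule f_domain) blast

lemma g_eq: "x \<in> C \<Longrightarrow> g x = ereal (real_of_ereal (g x))"
  unfolding C_def using edom_ereal_real[of x g] g_not_minf[of x] by simp

lemma f_eq: "x \<in> C \<Longrightarrow> f x = ereal (real_of_ereal (f x))"
  using C_sub_f by (intro edom_ereal_real f_not_minf) auto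

lemma fg_eq: "x \<in> C \<Longrightarrow> f x + g x = ereal (r x)"
  using f_eq[of x] g_eq[of x] unfolding r_def by (metis plus_ereal.simps(1))

lemma fg_eq_inf: "x \<notin> C \<Longrightarrow> f x + g x = \<infinity>"
  using f_not_minf[of x] by (simp add: C_def edom_def)

text \<open>
  Near \<open>C\<close> the function \<open>f\<close> is continuous, but it is not assumed to be closed. That limits of points of the
  epigraph stay in the domain of \<open>g\<close> is due to an affine minorant of \<open>f\<close>, a tangent at a point of \<open>C\<close>.
\<close>

lemma r_closed_convex: "closed_convex_on C r"
proof -
  obtain U where U: "open U" "C \<subseteq> U" "U \<subseteq> edom f"
    "\<And>x. x \<in> U \<Longrightarrow> GDERIV (\<lambda>y. real_of_ereal (f y)) x :> egrad f x"
    "continuous_on U (\<lambda>y. real_of_ereal (f y))" by (rule f_domain) (rule that)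
  let ?f = "\<lambda>x. real_of_ereal (f x)" and ?g = "\<lambda>x. real_of_ereal (g x)"
  have C0: "C \<noteq> {}" using g_proper by (simp add: eproper_def C_def)
  then obtain x0 where x0: "x0 \<in> C" by blast
  have Cc: "convex C" using g_convex_on by (rule convex_on_imp_convex)
  have "convex_on C ?f" by (rule convex_on_subset[OF f_convex_on C_sub_f Cc])
  then have "convex_on C r" unfolding r_def using g_convex_on by (rule convex_on_add)
  moreover have "closed {(x, t). x \<in> C \<and> r x \<le> t}"
    unfolding closed_sequential_limits
  proof (intro allI impI, elim conjE)
    fix X :: "nat \<Rightarrow> (real^'a) \<times> real" and w
    assume X: "\<forall>n. X n \<in> {(x, t). x \<in> C \<and> r x \<le> t}" and lim: "X \<longlonglongrightarrow> w"
    define y t where "y n = fst (X n)" and "t n = snd (X n)" for n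
    have y: "y n \<in> C" "r (y n) \<le> t n" for n
      using X[rule_format, of n] by (cases "X n"; simp add: y_def t_def)+
    have yl: "y \<longlonglongrightarrow> fst w" and tl: "t \<longlonglongrightarrow> snd w"
      unfolding y_def t_def using lim by (auto intro: tendsto_fst tendsto_snd)
    have epi: "closed {(x, s::real). g x \<le> ereal s}" using g_closed by (simp add: eclosed_def)
    have lift: "g (fst w) \<le> ereal s" if le: "\<And>n. ?g (y n) \<le> s' n" and sl: "s' \<longlonglongrightarrow> s" for s' s
    proof -
      have conv: "(\<lambda>n. (y n, s' n)) \<longlonglongrightarrow> (fst w, s)" by (intro tendsto_Pair yl sl)
      have "(y n, s' n) \<in> {(x, s). g x \<le> ereal s}" for n
        using le[of n] g_eq[OF y(1)[of n]] by (metis (mono_tags, lifting) case_prodI ereal_less_eq(3) mem_Collect_eq)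
      then have "(fst w, s) \<in> {(x, s). g x \<le> ereal s}"
        by (intro closed_sequentially[OF epi _ conv])
      then show ?thesis by simp
    qed
    \<comment> \<open>the affine minorant keeps f from escaping to minus infinity\<close>
    have "g (fst w) \<le> ereal (snd w - (?f x0 + egrad f x0 \<bullet> (fst w - x0)))"
    proof (rule lift)
      show "?g (y n) \<le> t n - (?f x0 + egrad f x0 \<bullet> (y n - x0))" for n
        using convex_on_gradient_ineq[OF f_convex_on subsetD[OF C_sub_f x0] subsetD[OF C_sub_f y(1)[of n]]
          U(4)[OF subsetD[OF U(2) x0]]] y(2)[of n]
        by (simp add: r_def)
      show "(\<lambda>n. t n - (?f x0 + egrad f x0 \<bullet> (y n - x0))) \<longlonglongrightarrow> snd w - (?f x0 + egrad f x0 \<bullet> (fst w - x0))"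
        by (intro tendsto_intros yl tl)
    qed
    then have wC: "fst w \<in> C" unfolding C_def edom_def by (auto simp: less_ereal.simps le_less_trans)
    have "isCont ?f (fst w)" using U(1,2,5) wC by (auto simp: continuous_on_eq_continuous_at)
    then have "(\<lambda>n. ?f (y n)) \<longlonglongrightarrow> ?f (fst w)" using yl by (rule isCont_tendsto_compose)
    then have "(\<lambda>n. t n - ?f (y n)) \<longlonglongrightarrow> snd w - ?f (fst w)" using tl by (intro tendsto_diff)
    moreover have "?g (y n) \<le> t n - ?f (y n)" for n using y(2)[of n] by (simp add: r_def)
    ultimately have "g (fst w) \<le> ereal (snd w - ?f (fst w))" by (intro lift)
    then have "?g (fst w) \<le> snd w - ?f (fst w)" using g_eq[OF wC] by (metis ereal_less_eq(3))
    then show "w \<in> {(x, t). x \<in> C \<and> r x \<le> t}" using wC by (auto simp: r_def split: prod.splits)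
  qed
  ultimately show ?thesis using C0 by (simp add: closed_convex_on_def)
qed

sublocale convex_coupling C r E k p
  by unfold_locales (fact r_closed_convex conj_closed_convex p_continuous p_coupling_convex)+

section \<open>Identification of the smoothed objects\<close>

lemma smoothing_obj_eq:
  "v \<in> E \<Longrightarrow> smoothing_obj h u l b v = ereal (v \<bullet> u - k v - b / 2 * (norm (v - l))\<^sup>2)"
  "v \<notin> E \<Longrightarrow> smoothing_obj h u l b v = - \<infinity>"
  by (simp_all add: smoothing_obj_def conj_eq conj_eq_inf)

lemma smoothing_obj_max:
  assumes b: "0 < b"
  shows "smoothing_obj h u l b v \<le> smoothing_obj h u l b (\<Lambda> b l u)"
  using smooth_val_ge[OF k b, of v u l] smooth_val_eq[OF k b, of l u] smooth_arg_in[OF k b, of l u]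
  by (cases "v \<in> E") (simp_all add: smoothing_obj_eq)

lemma smoothed_eq:
  assumes b: "0 < b"
  shows "smoothed h u l b = ereal (sm b l u)"
proof -
  have "smoothed h u l b = smoothing_obj h u l b (\<Lambda> b l u)"
    unfolding smoothed_def
    by (intro antisym SUP_least SUP_upper smoothing_obj_max[OF b]) simp
  then show ?thesis
    using smooth_val_eq[OF k b, of l u] smooth_arg_in[OF k b, of l u] by (simp add: smoothing_obj_eq)
qed

lemma smooth_argmax_eq:
  assumes b: "0 < b"
  shows "smooth_argmax h u l b = \<Lambda> b l u"
proof -
  let ?o = "smoothing_obj h u l b"
  define v where "v = smooth_argmax h u l b"
  have "is_arg_max ?o (\<lambda>_. True) (\<Lambda> b l u)"
    unfolding is_arg_max_def using smoothing_obj_max[OF b] by (auto simp: not_less)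
  then have "is_arg_max ?o (\<lambda>_. True) v"
    unfolding v_def smooth_argmax_def arg_max_def by (rule someI)
  then have max: "?o w \<le> ?o v" for w unfolding is_arg_max_def by (metis not_le)
  have vE: "v \<in> E"
    using max[of "\<Lambda> b l u"] smooth_arg_in[OF k b, of l u] by (cases "v \<in> E") (auto simp: smoothing_obj_eq)
  have "v = \<Lambda> b l u"
  proof (rule smooth_arg_unique[OF k b vE])
    fix w assume "w \<in> E"
    with max[of w] vE show "w \<bullet> u - k w - b / 2 * (norm (w - l))\<^sup>2 \<le> v \<bullet> u - k v - b / 2 * (norm (v - l))\<^sup>2"
      by (simp add: smoothing_obj_eq)
  qed
  then show ?thesis by (simp add: v_def)
qed

lemma prox_aug_lagrangian_eq:
  assumes b: "0 < b"
  shows "x \<in> C \<Longrightarrow> prox_aug_lagrangian f g h p y l b x = ereal (aug_val b y l x)"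
    "x \<notin> C \<Longrightarrow> prox_aug_lagrangian f g h p y l b x = \<infinity>"
  by (simp_all add: prox_aug_lagrangian_def smoothed_eq[OF b] fg_eq fg_eq_inf aug_val_def)

lemma prox_aug_lagrangian_INF:
  assumes b: "0 < b"
  shows "(INF x. prox_aug_lagrangian f g h p y l b x) = ereal (aug_val b y l (exact_x b y l))"
proof (rule antisym)
  show "(INF x. prox_aug_lagrangian f g h p y l b x) \<le> ereal (aug_val b y l (exact_x b y l))"
    by (rule INF_lower2[of "exact_x b y l"]) (simp_all add: prox_aug_lagrangian_eq[OF b] exact_x_in[OF b])
  show "ereal (aug_val b y l (exact_x b y l)) \<le> (INF x. prox_aug_lagrangian f g h p y l b x)"
  proof (rule INF_greatest)
    fix x show "ereal (aug_val b y l (exact_x b y l)) \<le> prox_aug_lagrangian f g h p y l b x"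
      using aug_val_exact_x_le[OF b, of x y l] by (cases "x \<in> C") (simp_all add: prox_aug_lagrangian_eq[OF b])
  qed
qed

text \<open>
  The gradient of the smooth part of the inner objective, by the chain rule and because \<open>\<Lambda>\<close> is the
  gradient of the smoothing.
\<close>

definition smooth_grad :: "real \<Rightarrow> (real^'b) \<times> (real^'c) \<Rightarrow> real^'a \<Rightarrow> real^'a" where
  "smooth_grad b l x = egrad f x + adjoint (frechet_derivative p (at x)) (\<Lambda> b l (p x))"

lemma smooth_part_gderiv:
  assumes b: "0 < b" and x: "x \<in> C"
  shows "GDERIV (\<lambda>y. real_of_ereal (f y) + sm b l (p y)) x :> smooth_grad b l x"
    and "egrad (smooth_part f h p l b) x = smooth_grad b l x"
proof -
  obtain U where U: "open U" "C \<subseteq> U" "U \<subseteq> edom f"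
    "\<And>x. x \<in> U \<Longrightarrow> GDERIV (\<lambda>y. real_of_ereal (f y)) x :> egrad f x" by (rule f_domain) (rule that)
  let ?D = "frechet_derivative p (at x)"
  have D: "(p has_derivative ?D) (at x)"
    using p_differentiable by (simp add: frechet_derivative_works)
  have "((\<lambda>y. sm b l (p y)) has_derivative (\<lambda>d. ?D d \<bullet> \<Lambda> b l (p x))) (at x)"
    by (rule has_derivative_compose[OF D]) (rule smooth_val_gderiv[OF k b, unfolded gderiv_def])
  moreover have "?D d \<bullet> \<Lambda> b l (p x) = d \<bullet> adjoint ?D (\<Lambda> b l (p x))" for d
    by (rule adjoint_works[OF has_derivative_linear[OF D], symmetric])
  ultimately have "GDERIV (\<lambda>y. sm b l (p y)) x :> adjoint ?D (\<Lambda> b l (p x))"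
    by (simp add: gderiv_def)
  moreover have "GDERIV (\<lambda>y. real_of_ereal (f y)) x :> egrad f x" using U x by auto
  ultimately show G: "GDERIV (\<lambda>y. real_of_ereal (f y) + sm b l (p y)) x :> smooth_grad b l x"
    unfolding smooth_grad_def by (intro GDERIV_add)
  have "((\<lambda>y. real_of_ereal (smooth_part f h p l b y)) has_derivative (\<lambda>d. d \<bullet> smooth_grad b l x)) (at x)"
  proof (rule has_derivative_transform_within_open[OF G[unfolded gderiv_def] U(1)])
    show "x \<in> U" using U x by auto
    fix y assume "y \<in> U"
    then have "f y = ereal (real_of_ereal (f y))" using U(3) by (intro edom_ereal_real f_not_minf) auto
    then show "real_of_ereal (f y) + sm b l (p y) = real_of_ereal (smooth_part f h p l b y)"
      unfolding smooth_part_def smoothed_eq[OF b] by (metis plus_ereal.simps(1) real_of_ereal.simps(1))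
  qed
  then show "egrad (smooth_part f h p l b) x = smooth_grad b l x"
    by (intro egrad_eq) (simp add: gderiv_def)
qed

lemma smooth_part_eq:
  assumes "0 < b" "x \<in> C"
  shows "smooth_part f h p l b x = ereal (real_of_ereal (f x) + sm b l (p x))"
  unfolding smooth_part_def smoothed_eq[OF assms(1)] by (subst f_eq[OF assms(2)]) simp

lemma smooth_part_convex:
  assumes b: "0 < b"
  shows "convex_on (edom f) (\<lambda>x. real_of_ereal (f x) + sm b l (p x))"
  by (intro convex_on_add f_convex_on convex_on_subset[OF smooth_val_convex[OF b]])
     (auto intro: convex_on_imp_convex[OF f_convex_on])

section \<open>Optimal pairs are saddle points\<close>

lemma lagrangian_eq:
  "x \<in> C \<Longrightarrow> v \<in> E \<Longrightarrow> lagrangian f g h p x v = ereal (r x + v \<bullet> p x - k v)"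
  "x \<in> C \<Longrightarrow> v \<notin> E \<Longrightarrow> lagrangian f g h p x v = - \<infinity>"
  by (simp_all add: lagrangian_def fg_eq conj_eq conj_eq_inf)

text \<open>
  Strong duality is postulated for one pair; it makes the primal and dual optimal values equal, so for
  every optimal pair all members of \<open>D(ls) \<le> L(xs; ls) \<le> F(xs)\<close> coincide.
\<close>

lemma optimal_saddle:
  assumes xs: "is_arg_min (\<lambda>y. f y + g y + h (p y)) (\<lambda>_. True) xs"
    and ls: "is_arg_max (dual_fun f g h p) (\<lambda>_. True) ls"
  shows "xs \<in> C" "ls \<in> E"
    and "\<And>x. x \<in> C \<Longrightarrow> r xs + ls \<bullet> p xs \<le> r x + ls \<bullet> p x"
    and "\<And>v. v \<in> E \<Longrightarrow> v \<bullet> p xs - k v \<le> ls \<bullet> p xs - k ls"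
proof -
  obtain x0 v0 where x0: "x0 \<in> C" "v0 \<in> E" "p2 x0 \<in> \<K>"
    and sd: "f x0 + g x0 + ereal (h1 (p1 x0)) = lagrangian f g h p x0 v0"
    "lagrangian f g h p x0 v0 = dual_fun f g h p v0"
    using strong_duality unfolding C_def E_def by blast
  define c where "c = r x0 + h1 (p1 x0)"
  have c: "dual_fun f g h p v0 = ereal c"
    using sd fg_eq[OF x0(1)] by (simp add: c_def)
  have "f xs + g xs + h (p xs) \<le> f x0 + g x0 + h (p x0)"
    using xs by (auto simp: is_arg_min_def not_less)
  also have "\<dots> = ereal c"
    using x0 by (simp add: fg_eq c_def split_h_def indicator_fun_def)
  finally have P: "f xs + g xs + h (p xs) \<le> ereal c" .
  have hnm: "h u \<noteq> - \<infinity>" for u by (simp add: split_h_def indicator_fun_def)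
  show xC: "xs \<in> C"
    using P hnm[of "p xs"] by (cases "xs \<in> C") (auto simp: fg_eq_inf)
  have xK: "p2 xs \<in> \<K>"
    using P by (cases "p2 xs \<in> \<K>") (auto simp: fg_eq[OF xC] split_h_def indicator_fun_def)
  have Pc: "r xs + h1 (p1 xs) \<le> c"
    using P by (simp add: fg_eq[OF xC] split_h_def indicator_fun_def xK)
  have "\<not> dual_fun f g h p ls < dual_fun f g h p v0"
    using ls unfolding is_arg_max_def by blast
  then have D: "ereal c \<le> dual_fun f g h p ls" by (simp add: c not_less)
  have D': "ereal c \<le> lagrangian f g h p x ls" for x
    using D unfolding dual_fun_def by (rule order_trans) (rule INF_lower, simp)
  show lE: "ls \<in> E"
    using D'[of x0] lagrangian_eq(2)[OF x0(1), of ls] by (cases "ls \<in> E") auto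
  have Dx: "c \<le> r x + ls \<bullet> p x - k ls" if "x \<in> C" for x
    using D'[of x] lagrangian_eq(1)[OF that lE] by simp
  have fen: "v \<bullet> p xs - k v \<le> h1 (p1 xs)" if "v \<in> E" for v
    using conj_ge[OF that, of "p xs"] xK by simp
  show "r xs + ls \<bullet> p xs \<le> r x + ls \<bullet> p x" if "x \<in> C" for x
    using Dx[OF that] Pc fen[OF lE] by linarith
  show "v \<bullet> p xs - k v \<le> ls \<bullet> p xs - k ls" if "v \<in> E" for v
    using fen[OF that] Dx[OF xC] Pc by linarith
qed

section \<open>The proximal point of h\<close>

text \<open>
  Test the conjugate with large multiples of the first component of \<open>v\<close>: \<open>h1\<close> grows with slope at most
  \<open>Lh1\<close>.
\<close>

lemma conj_dom_bound:
  assumes v: "v \<in> E"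
  shows "norm (fst v) \<le> Lh1"
proof (cases "fst v = 0")
  case True
  then show ?thesis using lipschitz_on_nonneg[OF h1_lipschitz] by simp
next
  case False
  obtain z0 where z0: "z0 \<in> \<K>" using K_nonempty by blast
  let ?n = "norm (fst v)"
  have "real n * (?n\<^sup>2 - Lh1 * ?n) \<le> k v + h1 0 - snd v \<bullet> z0" for n
  proof -
    have "v \<bullet> (real n *\<^sub>R fst v, z0) - h1 (real n *\<^sub>R fst v) \<le> k v"
      using conj_ge[OF v, of "(real n *\<^sub>R fst v, z0)"] z0 by simp
    moreover have "h1 (real n *\<^sub>R fst v) - h1 0 \<le> Lh1 * (real n * ?n)"
      using lipschitz_onD[OF h1_lipschitz, of "real n *\<^sub>R fst v" 0] by (simp add: dist_norm)
    moreover have "v \<bullet> (real n *\<^sub>R fst v, z0) = real n * ?n\<^sup>2 + snd v \<bullet> z0"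
      by (cases v) (simp add: power2_norm_eq_inner)
    ultimately show ?thesis by (simp add: algebra_simps)
  qed
  then have "?n\<^sup>2 - Lh1 * ?n \<le> 0"
    using reals_Archimedean3[of "?n\<^sup>2 - Lh1 * ?n"] by (meson not_le)
  then have "?n * ?n \<le> Lh1 * ?n" by (simp add: power2_eq_square)
  then show ?thesis using False by (simp add: mult_le_cancel_right)
qed

text \<open>
  By Moreau's decomposition \<open>u - b (\<Lambda> - l)\<close> is the proximal point of \<open>b h\<close> at \<open>u + b l\<close>, and the second
  summand of \<open>h\<close> is an indicator. Without biconjugation: \<open>v2 = (z - \<pi>) / b\<close> is normal to \<open>\<K>\<close> at the
  projection \<open>\<pi>\<close> of \<open>z\<close>, so \<open>\<pi>\<close> is a subgradient of the support function at \<open>v2\<close>; comparing with the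
  subgradient inequality at \<open>\<Lambda>\<close>, where only the second component is changed, gives \<open>v2 = snd \<Lambda>\<close> by
  monotonicity.
\<close>

lemma snd_prox_eq_projection:
  assumes b: "0 < b"
  shows "snd (u - b *\<^sub>R (\<Lambda> b l u - l)) = closest_point \<K> (snd u + b *\<^sub>R snd l)"
proof -
  define v where "v = \<Lambda> b l u"
  define w where "w = u - b *\<^sub>R (v - l)"
  define z where "z = snd u + b *\<^sub>R snd l"
  define \<pi> where "\<pi> = closest_point \<K> z"
  define v2 where "v2 = (1 / b) *\<^sub>R (z - \<pi>)"
  have vE: "v \<in> E" unfolding v_def by (rule smooth_arg_in[OF k b])
  have pK: "\<pi> \<in> \<K>" unfolding \<pi>_def by (rule closest_point_in_set[OF K_closed K_nonempty])
  have nrm: "v2 \<bullet> y \<le> v2 \<bullet> \<pi>" if "y \<in> \<K>" for y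
  proof -
    have "(z - \<pi>) \<bullet> (y - \<pi>) \<le> 0"
      unfolding \<pi>_def by (rule closest_point_dot[OF K_convex K_closed that])
    then have "(z - \<pi>) \<bullet> y \<le> (z - \<pi>) \<bullet> \<pi>" by (simp add: inner_diff_right)
    then show ?thesis unfolding v2_def using b by (simp add: divide_right_mono)
  qed
  have "(fst v, v2) \<bullet> u' - h1 (fst u') \<le> k v + (v2 - snd v) \<bullet> \<pi>" if u': "snd u' \<in> \<K>" for u'
  proof -
    have "v \<bullet> (fst u', \<pi>) - h1 (fst u') \<le> k v" using conj_ge[OF vE, of "(fst u', \<pi>)"] pK by simp
    moreover have "v \<bullet> (fst u', \<pi>) = fst v \<bullet> fst u' + snd v \<bullet> \<pi>" by (cases v) simp
    moreover have "(fst v, v2) \<bullet> u' = fst v \<bullet> fst u' + v2 \<bullet> snd u'" by (cases u') simp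
    ultimately show ?thesis using nrm[OF u'] by (simp add: inner_diff_left)
  qed
  from conj_leI[OF this] have test: "(fst v, v2) \<in> E" "k (fst v, v2) \<le> k v + (v2 - snd v) \<bullet> \<pi>"
    by auto
  have "k v + w \<bullet> ((fst v, v2) - v) \<le> k (fst v, v2)"
    unfolding w_def v_def by (rule smooth_arg_subgradient[OF k b]) (use test v_def in simp)
  moreover have "w \<bullet> ((fst v, v2) - v) = snd w \<bullet> (v2 - snd v)" by (cases v; cases w) simp
  ultimately have "(snd w - \<pi>) \<bullet> (v2 - snd v) \<le> 0"
    using test(2) by (simp add: inner_diff_left inner_diff_right inner_commute)
  moreover have wv: "snd w - \<pi> = b *\<^sub>R (v2 - snd v)"
    using b by (simp add: w_def v2_def z_def algebra_simps)
  ultimately have "b * (norm (v2 - snd v))\<^sup>2 \<le> 0" by (simp add: power2_norm_eq_inner)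
  then have "v2 = snd v" using b by (simp add: mult_le_0_iff)
  with wv show ?thesis by (simp add: w_def v_def \<pi>_def z_def)
qed

text \<open>
  In the first component the multipliers are bounded by \<open>Lh1\<close>; in the second one the proximal points
  are projections onto \<open>\<K>\<close>, which are nonexpansive.
\<close>

lemma prox_shift_bound:
  assumes b: "0 < b" "0 < b'"
  shows "norm ((u - b *\<^sub>R (\<Lambda> b l u - l)) - (u - b' *\<^sub>R (\<Lambda> b' l' u - l')))
    \<le> sqrt (((b + b') * Lh1 + norm (b *\<^sub>R fst l - b' *\<^sub>R fst l'))\<^sup>2 + (norm (b *\<^sub>R snd l - b' *\<^sub>R snd l'))\<^sup>2)"
proof -
  define v v' where "v = \<Lambda> b l u" and "v' = \<Lambda> b' l' u"
  define d where "d = (u - b *\<^sub>R (v - l)) - (u - b' *\<^sub>R (v' - l'))"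
  have vE: "v \<in> E" "v' \<in> E" unfolding v_def v'_def by (intro smooth_arg_in[OF k] b)+
  have "fst d = (b *\<^sub>R fst l - b' *\<^sub>R fst l') - (b *\<^sub>R fst v - b' *\<^sub>R fst v')"
    by (simp add: d_def algebra_simps)
  then have "norm (fst d) \<le> norm (b *\<^sub>R fst l - b' *\<^sub>R fst l') + norm (b *\<^sub>R fst v - b' *\<^sub>R fst v')"
    by (simp only: norm_triangle_ineq4)
  moreover have "norm (b *\<^sub>R fst v - b' *\<^sub>R fst v') \<le> b * norm (fst v) + b' * norm (fst v')"
    using norm_triangle_ineq4[of "b *\<^sub>R fst v" "b' *\<^sub>R fst v'"] b by simp
  moreover have "b * norm (fst v) \<le> b * Lh1" "b' * norm (fst v') \<le> b' * Lh1"
    using vE b by (auto intro!: mult_left_mono conj_dom_bound)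
  ultimately have 1: "norm (fst d) \<le> (b + b') * Lh1 + norm (b *\<^sub>R fst l - b' *\<^sub>R fst l')"
    by (simp add: distrib_right)
  have "snd d = closest_point \<K> (snd u + b *\<^sub>R snd l) - closest_point \<K> (snd u + b' *\<^sub>R snd l')"
    unfolding d_def v_def v'_def
    by (simp only: snd_diff[of "u - b *\<^sub>R (\<Lambda> b l u - l)"] snd_prox_eq_projection[OF b(1)] snd_prox_eq_projection[OF b(2)])
  then have 2: "norm (snd d) \<le> norm (b *\<^sub>R snd l - b' *\<^sub>R snd l')"
    using closest_point_lipschitz[OF K_convex K_closed K_nonempty, of "snd u + b *\<^sub>R snd l" "snd u + b' *\<^sub>R snd l'"]
    by (simp add: dist_norm)
  have "norm d = sqrt ((norm (fst d))\<^sup>2 + (norm (snd d))\<^sup>2)" by (simp add: norm_prod_def)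
  also have "\<dots> \<le> sqrt (((b + b') * Lh1 + norm (b *\<^sub>R fst l - b' *\<^sub>R fst l'))\<^sup>2 + (norm (b *\<^sub>R snd l - b' *\<^sub>R snd l'))\<^sup>2)"
    by (intro real_sqrt_le_mono add_mono power_mono 1 2) auto
  finally show ?thesis by (simp add: d_def v_def v'_def)
qed

section \<open>Residuals of the optimality conditions\<close>

lemma dual_residual:
  assumes b: "0 < b"
  shows "edist_set 0 (subdiff_lagrangian_dual h p x (\<Lambda> b l (p x))) \<le> ennreal (b * norm (\<Lambda> b l (p x) - l))"
proof -
  let ?v = "\<Lambda> b l (p x)"
  have "p x - b *\<^sub>R (?v - l) \<in> subdiff (fenchel_conj h) ?v"
  proof (rule in_subdiffI[OF conj_not_minf])
    show "?v \<in> edom (fenchel_conj h)" using smooth_arg_in[OF k b] by (simp add: E_def)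
    show "real_of_ereal (fenchel_conj h ?v) + (p x - b *\<^sub>R (?v - l)) \<bullet> (y - ?v) \<le> real_of_ereal (fenchel_conj h y)"
      if "y \<in> edom (fenchel_conj h)" for y
      using smooth_arg_subgradient[OF k b, of y l "p x"] that by (simp add: E_def k_def)
  qed
  then have "p x - (p x - b *\<^sub>R (?v - l)) \<in> subdiff_lagrangian_dual h p x ?v"
    unfolding subdiff_lagrangian_dual_def by blast
  then have "b *\<^sub>R (?v - l) \<in> subdiff_lagrangian_dual h p x ?v" by simp
  from edist_set_zero_le[OF this] show ?thesis using b by simp
qed

context
  fixes b L :: real and l :: "(real^'b) \<times> (real^'c)" and y0 xt x :: "real^'a"
  assumes b: "0 < b" and L: "0 \<le> L" and xt: "xt \<in> C" and x: "x \<in> C"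
    and desc: "\<And>y z. y \<in> C \<Longrightarrow> z \<in> C \<Longrightarrow>
      real_of_ereal (f z) + sm b l (p z) \<le> real_of_ereal (f y) + sm b l (p y)
        + smooth_grad b l y \<bullet> (z - y) + L / 2 * (norm (z - y))\<^sup>2"
    and step: "\<And>y. y \<in> C \<Longrightarrow>
      real_of_ereal (g x) + (smooth_grad b l xt \<bullet> (x - xt) + L / 2 * (norm (x - xt))\<^sup>2 + b / 2 * (norm (x - y0))\<^sup>2)
      \<le> real_of_ereal (g y) + (smooth_grad b l xt \<bullet> (y - xt) + L / 2 * (norm (y - xt))\<^sup>2 + b / 2 * (norm (y - y0))\<^sup>2)"
begin

text \<open>
  The optimality condition of the proximal gradient step from \<open>xt\<close> to \<open>x\<close>.
\<close>

lemma prox_gradient_subgradient: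
  assumes "y \<in> C"
  shows "real_of_ereal (g x) - (smooth_grad b l xt + L *\<^sub>R (x - xt) + b *\<^sub>R (x - y0)) \<bullet> (y - x) \<le> real_of_ereal (g y)"
proof (rule convex_min_subgradient[OF g_convex_on x step _ assms])
  fix d
  show "smooth_grad b l xt \<bullet> (x + d - xt) + L / 2 * (norm (x + d - xt))\<^sup>2 + b / 2 * (norm (x + d - y0))\<^sup>2
    = smooth_grad b l xt \<bullet> (x - xt) + L / 2 * (norm (x - xt))\<^sup>2 + b / 2 * (norm (x - y0))\<^sup>2
      + (smooth_grad b l xt + L *\<^sub>R (x - xt) + b *\<^sub>R (x - y0)) \<bullet> d + (L + b) / 2 * (norm d)\<^sup>2"
    unfolding power2_norm_eq_inner
    by (simp add: inner_add inner_diff inner_commute field_simps)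
qed

lemma prox_gradient_decrease:
  "aug_val b y0 l x + L / 2 * (norm (x - xt))\<^sup>2 \<le> aug_val b y0 l xt"
proof -
  let ?G = "smooth_grad b l xt"
  have "real_of_ereal (g x) + ?G \<bullet> (x - xt) + L * (norm (x - xt))\<^sup>2 + b * ((x - y0) \<bullet> (x - xt)) \<le> real_of_ereal (g xt)"
  proof -
    have "(?G + L *\<^sub>R (x - xt) + b *\<^sub>R (x - y0)) \<bullet> (xt - x)
        = - (?G \<bullet> (x - xt) + L * (norm (x - xt))\<^sup>2 + b * ((x - y0) \<bullet> (x - xt)))"
      unfolding power2_norm_eq_inner by (simp add: inner_add inner_diff algebra_simps)
    then show ?thesis using prox_gradient_subgradient[OF xt] by simp
  qed
  moreover have "b / 2 * (norm (x - y0))\<^sup>2 + b / 2 * (norm (x - xt))\<^sup>2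
      = b / 2 * (norm (xt - y0))\<^sup>2 + b * ((x - y0) \<bullet> (x - xt))"
    unfolding power2_norm_eq_inner by (simp add: inner_diff inner_commute field_simps)
  moreover have "0 \<le> b / 2 * (norm (x - xt))\<^sup>2" using b by simp
  moreover have "L * (norm (x - xt))\<^sup>2 = L / 2 * (norm (x - xt))\<^sup>2 + L / 2 * (norm (x - xt))\<^sup>2" by simp
  ultimately show ?thesis
    using desc[OF xt x] unfolding aug_val_def r_def by linarith
qed

text \<open>
  The optimality condition of the step contains the gradient at \<open>xt\<close> instead of that at \<open>x\<close>. Along \<open>C\<close> they
  differ by at most \<open>L |x - xt|\<close>; the remaining components are taken up by another choice of the
  subgradient of \<open>g\<close> at \<open>x\<close>.
\<close>

lemma primal_residual:
  "edist_set 0 (subdiff_lagrangian_x f g p x (\<Lambda> b l (p x))) \<le> ennreal (2 * L * norm (x - xt) + b * norm (x - y0))"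
proof -
  obtain U where U: "open U" "C \<subseteq> U" "U \<subseteq> edom f" "continuous_on U (\<lambda>y. real_of_ereal (f y))"
    by (rule f_domain) (rule that)
  let ?G = "smooth_grad b l" and ?\<phi> = "\<lambda>y. real_of_ereal (f y) + sm b l (p y)"
  let ?w = "L *\<^sub>R (x - xt) + b *\<^sub>R (x - y0)"
  have inc: "(?G xt - ?G x) \<bullet> (y - x) \<le> L * norm (xt - x) * norm (y - x)" if y: "y \<in> C" for y
  proof (rule gradient_increment_le[OF _ U(1,2) _ _ _ desc L x y xt])
    show "convex C" by (rule closed_convex_onD(3)[OF r])
    show "GDERIV ?\<phi> a :> ?G a" if "a \<in> C" for a by (rule smooth_part_gderiv(1)[OF b that])
    show "?\<phi> a + ?G a \<bullet> (z - a) \<le> ?\<phi> z" if "a \<in> C" "z \<in> U" for a z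
      using that U C_sub_f
      by (intro convex_on_gradient_ineq[OF smooth_part_convex[OF b]] smooth_part_gderiv(1)[OF b]) auto
    show "continuous_on U ?\<phi>"
      by (intro continuous_intros U(4) continuous_on_subset[OF smooth_val_comp_cont[OF b]]) auto
  qed
  have "real_of_ereal (g x) \<le> real_of_ereal (g y) + (?G x + ?w) \<bullet> (y - x) + (L * norm (xt - x)) * norm (y - x)"
    if y: "y \<in> C" for y
    using prox_gradient_subgradient[OF y] inc[OF y]
    by (simp add: inner_add_left inner_diff_left)
  from exists_subgradient_near[OF g_convex_on x _ this] L
  obtain v where v: "\<And>y. y \<in> C \<Longrightarrow> real_of_ereal (g x) + v \<bullet> (y - x) \<le> real_of_ereal (g y)"
    "norm (v + (?G x + ?w)) \<le> L * norm (xt - x)" by auto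
  have "v \<in> subdiff g x"
    using x v(1) by (intro in_subdiffI[OF g_not_minf]) (auto simp: C_def)
  then have "egrad f x + v + adjoint (frechet_derivative p (at x)) (\<Lambda> b l (p x)) \<in> subdiff_lagrangian_x f g p x (\<Lambda> b l (p x))"
    unfolding subdiff_lagrangian_x_def by blast
  moreover have "egrad f x + v + adjoint (frechet_derivative p (at x)) (\<Lambda> b l (p x)) = v + ?G x"
    by (simp add: smooth_grad_def)
  ultimately have "v + ?G x \<in> subdiff_lagrangian_x f g p x (\<Lambda> b l (p x))" by simp
  then have "edist_set 0 (subdiff_lagrangian_x f g p x (\<Lambda> b l (p x))) \<le> ennreal (norm (v + ?G x))"
    by (rule edist_set_zero_le)
  also have "norm (v + ?G x) \<le> 2 * L * norm (x - xt) + b * norm (x - y0)"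
  proof -
    have "v + ?G x = (v + (?G x + ?w)) - ?w" by simp
    then have "norm (v + ?G x) \<le> norm (v + (?G x + ?w)) + norm ?w"
      using norm_triangle_ineq4[of "v + (?G x + ?w)" ?w] by simp
    moreover have "norm ?w \<le> L * norm (x - xt) + b * norm (x - y0)"
      using norm_triangle_ineq[of "L *\<^sub>R (x - xt)" "b *\<^sub>R (x - y0)"] L b by simp
    ultimately show ?thesis using v(2) by (simp add: norm_minus_commute)
  qed
  finally show ?thesis by (simp add: ennreal_leI)
qed

end

end

section \<open>One outer iteration\<close>

context ipalm_kkt
begin

lemma beta_pos: "0 < \<beta> s"
  using beta0_pos rho_bounds by (simp add: \<beta>_def)

lemma beta_Suc: "\<beta> s < 2 * \<beta> (Suc s)" "\<beta> (Suc s) \<le> \<beta> s"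
proof -
  have "\<beta> (Suc s) = \<rho> * \<beta> s" by (simp add: \<beta>_def)
  moreover have "1 / 2 * \<beta> s < \<rho> * \<beta> s" "\<rho> * \<beta> s \<le> 1 * \<beta> s"
    using rho_bounds beta_pos[of s] by (auto intro: mult_strict_right_mono mult_right_mono)
  ultimately show "\<beta> s < 2 * \<beta> (Suc s)" "\<beta> (Suc s) \<le> \<beta> s" by linarith+
qed

lemma eps_pos: "0 < eps s"
  using eps0_pos eta_bounds by (simp add: eps_def)

lemma x_in: "\<omega> \<in> space M \<Longrightarrow> x s \<omega> \<in> C"
proof -
  assume \<omega>: "\<omega> \<in> space M"
  obtain y where y: "y \<in> C" using closed_convex_onD(1)[OF r] by blast
  have "g (x s \<omega>) \<noteq> \<infinity>"
    using x_step[OF \<omega>, of s] y by (auto simp: is_arg_min_def not_less C_def edom_def dest!: spec[of _ y])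
  then show "x s \<omega> \<in> C" by (simp add: C_def edom_def less_top[symmetric] top_ereal_def)
qed

lemma xprev_in: "\<omega> \<in> space M \<Longrightarrow> xprev s \<omega> \<in> C"
  using x_in xinit_dom by (cases s) (auto simp: xprev_def C_def)

lemma x_step_real:
  assumes \<omega>: "\<omega> \<in> space M" and xt: "xt s \<omega> \<in> C" and y: "y \<in> C"
  defines "G \<equiv> smooth_grad (\<beta> s) (l s \<omega>) (xt s \<omega>)"
  shows "real_of_ereal (g (x s \<omega>)) + (G \<bullet> (x s \<omega> - xt s \<omega>) + L s / 2 * (norm (x s \<omega> - xt s \<omega>))\<^sup>2
           + \<beta> s / 2 * (norm (x s \<omega> - xprev s \<omega>))\<^sup>2)
    \<le> real_of_ereal (g y) + (G \<bullet> (y - xt s \<omega>) + L s / 2 * (norm (y - xt s \<omega>))\<^sup>2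
           + \<beta> s / 2 * (norm (y - xprev s \<omega>))\<^sup>2)"
proof -
  have G: "egrad (\<phi> s \<omega>) (xt s \<omega>) = G"
    unfolding G_def \<phi>_def by (rule smooth_part_gderiv(2)[OF beta_pos xt])
  define q where "q z = G \<bullet> (z - xt s \<omega>) + L s / 2 * (norm (z - xt s \<omega>))\<^sup>2
           + \<beta> s / 2 * (norm (z - xprev s \<omega>))\<^sup>2" for z
  have "is_arg_min (\<lambda>z. ereal (q z) + g z) (\<lambda>_. True) (x s \<omega>)"
    using x_step[OF \<omega>, of s] unfolding G q_def .
  then have "ereal (q (x s \<omega>)) + g (x s \<omega>) \<le> ereal (q y) + g y"
    by (auto simp: is_arg_min_def not_less)
  then have "ereal (q (x s \<omega>)) + ereal (real_of_ereal (g (x s \<omega>))) \<le> ereal (q y) + ereal (real_of_ereal (g y))"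
    using g_eq[OF y] g_eq[OF x_in[OF \<omega>, of s]] by simp
  then show ?thesis by (simp add: q_def add.commute)
qed

lemma descent_real:
  assumes \<omega>: "\<omega> \<in> space M" and y: "y \<in> C" and z: "z \<in> C"
  shows "real_of_ereal (f z) + sm (\<beta> s) (l s \<omega>) (p z) \<le> real_of_ereal (f y) + sm (\<beta> s) (l s \<omega>) (p y)
    + smooth_grad (\<beta> s) (l s \<omega>) y \<bullet> (z - y) + L s / 2 * (norm (z - y))\<^sup>2"
  using L_descent[OF \<omega>, of y z s] y z unfolding \<phi>_def C_def[symmetric]
  by (simp add: smooth_part_eq[OF beta_pos] smooth_part_gderiv(2)[OF beta_pos] norm_minus_commute)

lemma l_Suc: "\<omega> \<in> space M \<Longrightarrow> l (Suc s) \<omega> = \<Lambda> (\<beta> s) (l s \<omega>) (p (x s \<omega>))"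
  using l_step smooth_argmax_eq[OF beta_pos] by simp

lemma xprev_Suc [simp]: "xprev (Suc s) \<omega> = x s \<omega>"
  by (simp add: xprev_def)

text \<open>
  Outputs of the solver may lie outside the domain of \<open>g\<close>, where the gap is infinite.
\<close>

definition gap :: "nat \<Rightarrow> 'w \<Rightarrow> real^'n \<Rightarrow> ennreal" where
  "gap s \<omega> y = e2ennreal (H s \<omega> y - Hmin s \<omega>)"

definition Hstar :: "nat \<Rightarrow> 'w \<Rightarrow> real" where
  "Hstar s \<omega> = aug_val (\<beta> s) (xprev s \<omega>) (l s \<omega>) (exact_x (\<beta> s) (xprev s \<omega>) (l s \<omega>))"

lemma H_eq:
  "y \<in> C \<Longrightarrow> H s \<omega> y = ereal (aug_val (\<beta> s) (xprev s \<omega>) (l s \<omega>) y)"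
  "y \<notin> C \<Longrightarrow> H s \<omega> y = \<infinity>"
  by (simp_all add: H_def prox_aug_lagrangian_eq[OF beta_pos])

lemma Hmin_eq: "Hmin s \<omega> = ereal (Hstar s \<omega>)"
  unfolding Hmin_def H_def Hstar_def by (rule prox_aug_lagrangian_INF[OF beta_pos])

lemma gap_eq:
  "y \<in> C \<Longrightarrow> gap s \<omega> y = ennreal (aug_val (\<beta> s) (xprev s \<omega>) (l s \<omega>) y - Hstar s \<omega>)"
  "y \<notin> C \<Longrightarrow> gap s \<omega> y = top"
  by (simp_all add: gap_def H_eq Hmin_eq)

lemma Hstar_le: "y \<in> C \<Longrightarrow> Hstar s \<omega> \<le> aug_val (\<beta> s) (xprev s \<omega>) (l s \<omega>) y"
  unfolding Hstar_def by (rule aug_val_exact_x_le[OF beta_pos])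

lemma Ms_nonneg: "0 \<le> Ms s \<omega>"
proof -
  have "0 < 2 * \<beta> (Suc s) - \<beta> s" "0 \<le> \<beta> s - \<beta> (Suc s)" using beta_Suc[of s] by auto
  then show ?thesis unfolding Ms_def using beta_pos[of s] by (intro add_nonneg_nonneg) auto
qed

lemma gap_Suc_le:
  assumes \<omega>: "\<omega> \<in> space M"
  shows "gap (Suc s) \<omega> (x s \<omega>) \<le> 2 * gap s \<omega> (x s \<omega>) + ennreal (Ms s \<omega>)"
proof -
  let ?y = "xprev s \<omega>" and ?l = "l s \<omega>" and ?l' = "l (Suc s) \<omega>" and ?x = "x s \<omega>"
  let ?b = "\<beta> s" and ?b' = "\<beta> (Suc s)"
  have xC: "?x \<in> C" by (rule x_in[OF \<omega>])
  have "aug_val ?b' ?x ?l' ?x - aug_val ?b' ?x ?l' (exact_x ?b' ?x ?l')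
    \<le> 2 * (aug_val ?b ?y ?l ?x - aug_val ?b ?y ?l (exact_x ?b ?y ?l)) + Ms s \<omega>"
    unfolding Ms_def smooth_argmax_eq[OF beta_pos]
    using shifted_gap[OF beta_Suc[of s] xC exact_x_in[OF beta_pos, of "Suc s" ?x ?l'] l_Suc[OF \<omega>, of s]
        prox_shift_bound[OF beta_pos beta_pos], where y = ?y]
    by simp
  then have "aug_val ?b' ?x ?l' ?x - Hstar (Suc s) \<omega> \<le> 2 * (aug_val ?b ?y ?l ?x - Hstar s \<omega>) + Ms s \<omega>"
    by (simp add: Hstar_def)
  moreover define \<Delta> where "\<Delta> = aug_val ?b ?y ?l ?x - Hstar s \<omega>"
  ultimately have "gap (Suc s) \<omega> ?x \<le> ennreal (2 * \<Delta> + Ms s \<omega>)"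
    by (simp add: gap_eq(1)[OF xC] ennreal_leI)
  also have "0 \<le> \<Delta>" using Hstar_le[OF xC, of s \<omega>] by (simp add: \<Delta>_def)
  then have "ennreal (2 * \<Delta> + Ms s \<omega>) = 2 * ennreal \<Delta> + ennreal (Ms s \<omega>)"
    using Ms_nonneg[of s \<omega>] by (simp add: ennreal_plus ennreal_mult)
  also have "ennreal \<Delta> = gap s \<omega> ?x" by (simp add: gap_eq(1)[OF xC] \<Delta>_def)
  finally show ?thesis .
qed

lemma gap_decrease:
  assumes \<omega>: "\<omega> \<in> space M" and xt: "xt s \<omega> \<in> C"
  shows "gap s \<omega> (x s \<omega>) + ennreal (L s / 2 * (norm (x s \<omega> - xt s \<omega>))\<^sup>2) \<le> gap s \<omega> (xt s \<omega>)"
proof -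
  have L0: "0 \<le> L s" using L_pos[of s] by simp
  have "aug_val (\<beta> s) (xprev s \<omega>) (l s \<omega>) (x s \<omega>) + L s / 2 * (norm (x s \<omega> - xt s \<omega>))\<^sup>2
      \<le> aug_val (\<beta> s) (xprev s \<omega>) (l s \<omega>) (xt s \<omega>)"
    by (rule prox_gradient_decrease[OF beta_pos L0 xt x_in[OF \<omega>] descent_real[OF \<omega>] x_step_real[OF \<omega> xt]])
  then show ?thesis
    using Hstar_le[OF x_in[OF \<omega>, of s], of s \<omega>] L0
    by (simp add: gap_eq(1)[OF xt] gap_eq(1)[OF x_in[OF \<omega>]] ennreal_leI flip: ennreal_plus)
qed

lemma gap_x_le:
  assumes \<omega>: "\<omega> \<in> space M"
  shows "gap s \<omega> (x s \<omega>) \<le> gap s \<omega> (xt s \<omega>)"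
proof (cases "xt s \<omega> \<in> C")
  case True
  from gap_decrease[OF \<omega> this] show ?thesis by (rule order_trans[rotated]) simp
qed (simp add: gap_eq)

section \<open>Measurability of the iterates and of the gap\<close>

lemma sets_past:
  "sets (past s) = sigma_sets (space M)
     (\<Union>t\<in>{..<s}. {x t -` B \<inter> space M | B. B \<in> sets borel} \<union> {l t -` B \<inter> space M | B. B \<in> sets borel})"
  unfolding past_def by (rule sets_measure_of) auto

lemma space_past [simp]: "space (past s) = space M"
  unfolding past_def by (rule space_measure_of) auto

lemma subalgebra_past: "subalgebra M (past s)"
proof -
  have "sets (past s) \<subseteq> sets M"
    unfolding sets_past using x_measurable l_measurable
    by (intro sets.sigma_sets_subset) (auto intro: measurable_sets)
  then show ?thesis by (simp add: subalgebra_def)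
qed

lemma x_past_of_less: "t < s \<Longrightarrow> x t \<in> borel_measurable (past s)"
  by (rule measurableI) (auto simp: sets_past intro!: sigma_sets.Basic)

lemma l_past_of_less: "t < s \<Longrightarrow> l t \<in> borel_measurable (past s)"
  by (rule measurableI) (auto simp: sets_past intro!: sigma_sets.Basic)

lemma xprev_past: "xprev s \<in> borel_measurable (past s)"
proof (cases s)
  case 0
  then have "xprev s = (\<lambda>_. xinit)" by (simp add: xprev_def fun_eq_iff)
  then show ?thesis by simp
next
  case (Suc t)
  then have "xprev s = x t" by (simp add: xprev_def fun_eq_iff)
  then show ?thesis using x_past_of_less[of t s] Suc by simp
qed

lemma p_borel [measurable]: "p \<in> borel_measurable borel"
  by (rule borel_measurable_continuous_onI[OF p_continuous])

lemma smooth_arg_borel: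
  assumes b: "0 < b" and uv: "u \<in> borel_measurable N" "v \<in> borel_measurable N"
  shows "(\<lambda>\<omega>. \<Lambda> b (u \<omega>) (v \<omega>)) \<in> borel_measurable N"
proof -
  have "(\<lambda>(l, u). \<Lambda> b l u) \<in> borel_measurable borel"
    by (rule borel_measurable_continuous_onI[OF continuous_on_smooth_arg[OF k b]])
  from measurable_compose[OF borel_measurable_Pair[OF uv] this] show ?thesis by simp
qed

lemma smooth_val_borel:
  assumes b: "0 < b" and uv: "u \<in> borel_measurable N" "v \<in> borel_measurable N"
  shows "(\<lambda>\<omega>. sm b (u \<omega>) (v \<omega>)) \<in> borel_measurable N"
proof -
  have "(\<lambda>(l, u). sm b l u) \<in> borel_measurable borel"
    by (rule borel_measurable_continuous_onI[OF continuous_on_smooth_val[OF k b]])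
  from measurable_compose[OF borel_measurable_Pair[OF uv] this] show ?thesis by simp
qed

lemma l_past: "l s \<in> borel_measurable (past s)"
proof (cases s)
  case 0
  have "(\<lambda>_. l0) \<in> borel_measurable (past s)" by simp
  then show ?thesis by (rule measurable_cong[THEN iffD1, rotated]) (simp add: 0 l_init)
next
  case (Suc t)
  have [measurable]: "x t \<in> borel_measurable (past s)" "l t \<in> borel_measurable (past s)"
    using x_past_of_less l_past_of_less Suc by auto
  have "(\<lambda>\<omega>. \<Lambda> (\<beta> t) (l t \<omega>) (p (x t \<omega>))) \<in> borel_measurable (past s)"
    by (intro smooth_arg_borel beta_pos) measurable
  then show ?thesis by (rule measurable_cong[THEN iffD1, rotated]) (simp add: Suc l_Suc)
qed

lemma Ms_past: "Ms s \<in> borel_measurable (past (Suc s))"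
proof -
  have [measurable]: "x s \<in> borel_measurable (past (Suc s))" "l s \<in> borel_measurable (past (Suc s))"
    "l (Suc s) \<in> borel_measurable (past (Suc s))"
    using x_past_of_less l_past_of_less l_past by auto
  have [measurable]: "xprev s \<in> borel_measurable (past (Suc s))"
  proof (cases s)
    case 0
    then have "xprev s = (\<lambda>_. xinit)" by (simp add: xprev_def fun_eq_iff)
    then show ?thesis by simp
  next
    case (Suc t)
    then have "xprev s = x t" by (simp add: xprev_def fun_eq_iff)
    then show ?thesis using x_past_of_less[of t "Suc s"] Suc by simp
  qed
  have [measurable]: "(\<lambda>\<omega>. \<Lambda> (\<beta> (Suc s)) (l (Suc s) \<omega>) (p (x s \<omega>))) \<in> borel_measurable (past (Suc s))"
    by (intro smooth_arg_borel beta_pos) measurable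
  have [measurable]: "fst \<in> borel_measurable (borel :: ('b::{second_countable_topology} \<times> 'c::{second_countable_topology}) measure)"
    "snd \<in> borel_measurable (borel :: ('b::{second_countable_topology} \<times> 'c::{second_countable_topology}) measure)"
    by (intro borel_measurable_continuous_onI continuous_intros)+
  show ?thesis
    unfolding Ms_def[abs_def] smooth_argmax_eq[OF beta_pos] by measurable
qed

text \<open>
  The number of inner iterations depends on the new multiplier, which is a function of the last iterates and
  so is known before the solver is called.
\<close>

lemma m_past: "m s \<in> measurable (past s) (count_space UNIV)"
proof (cases s)
  case 0
  have "(\<lambda>_. m0) \<in> measurable (past s) (count_space UNIV)" by simp
  then show ?thesis by (rule measurable_cong[THEN iffD1, rotated]) (simp add: 0 m_init)
next
  case (Suc t)
  note Ms_past[of t, measurable]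
  have "(\<lambda>\<omega>. LEAST k. 0 < k \<and> 2 * eps t + Ms t \<omega> \<le> 2 powi \<lfloor>real k / K (Suc t)\<rfloor> * eps (Suc t) / 2)
      \<in> measurable (past (Suc t)) (count_space UNIV)"
    by measurable
  then show ?thesis unfolding Suc by (rule measurable_cong[THEN iffD1, rotated]) (simp add: m_step)
qed

text \<open>
  The sublevel sets are sections of the closed epigraph.
\<close>

lemma fg_borel [measurable]: "(\<lambda>y. f y + g y) \<in> borel_measurable borel"
proof (rule borel_measurableI_le)
  fix t :: ereal
  have epi: "closed {y. y \<in> C \<and> r y \<le> a}" for a
  proof -
    have "closed ((\<lambda>y. (y, a)) -` {(x, t). x \<in> C \<and> r x \<le> t})"
      by (intro closed_vimage closed_convex_onD(4)[OF r] continuous_intros)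
    then show ?thesis by (simp add: vimage_def)
  qed
  show "{y \<in> space borel. f y + g y \<le> t} \<in> sets borel"
  proof (cases t)
    case (real a)
    have "f y + g y \<le> ereal a \<longleftrightarrow> y \<in> C \<and> r y \<le> a" for y
      using fg_eq[of y] fg_eq_inf[of y] by (cases "y \<in> C") auto
    then have "{y \<in> space borel. f y + g y \<le> t} = {y. y \<in> C \<and> r y \<le> a}" by (simp add: real)
    then show ?thesis using epi[of a] by simp
  next
    case MInf
    have "{y \<in> space borel. f y + g y \<le> t} = {}"
      using f_not_minf g_not_minf by (auto simp: MInf)
    then show ?thesis by simp
  qed simp
qed

lemma H_borel:
  assumes [measurable]: "Y \<in> borel_measurable M"
  shows "(\<lambda>\<omega>. H s \<omega> (Y \<omega>)) \<in> borel_measurable M"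
proof -
  have [measurable]: "xprev s \<in> borel_measurable M" "l s \<in> borel_measurable M"
    using measurable_from_subalg[OF subalgebra_past] xprev_past l_measurable by auto
  have [measurable]: "(\<lambda>\<omega>. sm (\<beta> s) (l s \<omega>) (p (Y \<omega>))) \<in> borel_measurable M"
    by (intro smooth_val_borel beta_pos) measurable
  have "H s \<omega> (Y \<omega>) = (\<lambda>y. f y + g y) (Y \<omega>) + ereal (sm (\<beta> s) (l s \<omega>) (p (Y \<omega>)))
      + ereal (\<beta> s / 2 * (norm (Y \<omega> - xprev s \<omega>))\<^sup>2)" for \<omega>
    by (simp add: H_def prox_aug_lagrangian_def smoothed_eq[OF beta_pos])
  moreover have "(\<lambda>\<omega>. (\<lambda>y. f y + g y) (Y \<omega>) + ereal (sm (\<beta> s) (l s \<omega>) (p (Y \<omega>)))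
      + ereal (\<beta> s / 2 * (norm (Y \<omega> - xprev s \<omega>))\<^sup>2)) \<in> borel_measurable M"
    by (intro borel_measurable_ereal_add measurable_compose[OF _ fg_borel]) measurable
  ultimately show ?thesis by simp
qed

text \<open>
  An infimum of continuous functions of the centre \<open>(y, l)\<close> is upper semicontinuous.
\<close>

lemma Hstar_borel: "Hstar s \<in> borel_measurable M"
proof -
  define V where "V = (\<lambda>(y, l). aug_val (\<beta> s) y l (exact_x (\<beta> s) y l))"
  have xl: "xprev s \<in> borel_measurable M" "l s \<in> borel_measurable M"
    using measurable_from_subalg[OF subalgebra_past] xprev_past l_measurable by auto
  have "V \<in> borel_measurable borel"
  proof (rule borel_measurableI_less)
    fix c
    have "V w < c \<longleftrightarrow> (\<exists>y\<in>C. aug_val (\<beta> s) (fst w) (snd w) y < c)" for w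
      using aug_val_exact_x_le[OF beta_pos, of _ s "fst w" "snd w"] exact_x_in[OF beta_pos, of s "fst w" "snd w"]
      unfolding V_def case_prod_beta by (meson le_less_trans)
    then have "{w \<in> space borel. V w < c} = (\<Union>y\<in>C. {w. aug_val (\<beta> s) (fst w) (snd w) y < c})"
      by auto
    moreover have "open {w. aug_val (\<beta> s) (fst w) (snd w) y < c}" for y
    proof (rule open_Collect_less)
      have "continuous_on UNIV (\<lambda>w :: (real^'n) \<times> (real^'d1) \<times> (real^'d2). (snd w, p y))" by (intro continuous_intros)
      from continuous_on_compose2[OF continuous_on_smooth_val[OF k beta_pos[of s], of UNIV] this]
      have "continuous_on UNIV (\<lambda>w :: (real^'n) \<times> (real^'d1) \<times> (real^'d2). sm (\<beta> s) (snd w) (p y))" by simp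
      then show "continuous_on UNIV (\<lambda>w. aug_val (\<beta> s) (fst w) (snd w) y)"
        unfolding aug_val_def by (intro continuous_intros)
    qed simp
    ultimately show "{w \<in> space borel. V w < c} \<in> sets borel" by (simp add: open_UN)
  qed
  from measurable_compose[OF borel_measurable_Pair[OF xl] this]
  show ?thesis by (simp add: V_def Hstar_def[abs_def])
qed

lemma gap_borel:
  assumes "Y \<in> borel_measurable M"
  shows "(\<lambda>\<omega>. gap s \<omega> (Y \<omega>)) \<in> borel_measurable M"
proof -
  note [measurable] = H_borel[OF assms] Hstar_borel
  show ?thesis unfolding gap_def Hmin_eq by measurable
qed

lemma xt_borel: "xt s \<in> borel_measurable M"
proof -
  have "(\<lambda>\<omega>. \<A> s \<omega> (xprev s \<omega>) (m s \<omega>) (H s \<omega>)) \<in> borel_measurable M"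
    using xprev_in by (intro solver_measurable xprev_past m_past) (auto simp: C_def)
  then show ?thesis by (rule measurable_cong[THEN iffD1, rotated]) (simp add: xt_step)
qed

section \<open>Convergence in mean\<close>

text \<open>
  The least integer in the definition of \<open>m\<close> exists because the powers of \<open>2\<close> are unbounded.
\<close>

lemma m_Suc_contracts:
  assumes \<omega>: "\<omega> \<in> space M"
  shows "2 powi (- \<lfloor>real (m (Suc s) \<omega>) / K (Suc s)\<rfloor>) * (2 * eps s + Ms s \<omega>) \<le> eps (Suc s) / 2"
proof -
  define P where "P i \<longleftrightarrow> 0 < i \<and> 2 * eps s + Ms s \<omega> \<le> 2 powi \<lfloor>real i / K (Suc s)\<rfloor> * eps (Suc s) / 2" for i :: nat
  have K1: "1 \<le> K (Suc s)" by (rule K_ge_1)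
  obtain n :: nat where n: "(2 * eps s + Ms s \<omega>) / (eps (Suc s) / 2) < 2 ^ n"
    using real_arch_pow[of 2] by fastforce
  define i where "i = nat \<lceil>K (Suc s) * real (Suc n)\<rceil>"
  have ri: "K (Suc s) * real (Suc n) \<le> real i"
    unfolding i_def by (rule real_nat_ceiling_ge)
  have "0 < K (Suc s) * real (Suc n)" using K1 by (intro mult_pos_pos) auto
  then have i0: "0 < i" using ri by (metis le_less_trans not_le of_nat_0_less_iff less_le_trans)
  have "real (Suc n) \<le> real i / K (Suc s)" using ri K1 by (simp add: field_simps)
  then have "int n \<le> \<lfloor>real i / K (Suc s)\<rfloor>" by linarith
  then have "(2::real) powi int n \<le> 2 powi \<lfloor>real i / K (Suc s)\<rfloor>"
    by (intro power_int_increasing) auto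
  then have "(2 * eps s + Ms s \<omega>) / (eps (Suc s) / 2) \<le> 2 powi \<lfloor>real i / K (Suc s)\<rfloor>" using n by simp
  then have "P i" using i0 eps_pos[of "Suc s"] unfolding P_def by (simp add: field_simps)
  then have "P (LEAST i. P i)" by (rule LeastI)
  moreover have "m (Suc s) \<omega> = (LEAST i. P i)" using m_step[OF \<omega>, of s] by (simp add: P_def)
  ultimately have "2 * eps s + Ms s \<omega> \<le> 2 powi \<lfloor>real (m (Suc s) \<omega>) / K (Suc s)\<rfloor> * (eps (Suc s) / 2)"
    by (simp add: P_def)
  then have "2 powi (- \<lfloor>real (m (Suc s) \<omega>) / K (Suc s)\<rfloor>) * (2 * eps s + Ms s \<omega>)
      \<le> 2 powi (- \<lfloor>real (m (Suc s) \<omega>) / K (Suc s)\<rfloor>) * (2 powi \<lfloor>real (m (Suc s) \<omega>) / K (Suc s)\<rfloor> * (eps (Suc s) / 2))"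
    by (intro mult_left_mono) auto
  also have "\<dots> = eps (Suc s) / 2" by (simp add: power_int_minus)
  finally show ?thesis .
qed

text \<open>
  Let \<open>\<Delta>\<close> be the gap at \<open>x\<close> in iteration \<open>s\<close> and \<open>k\<close> the negative power of \<open>2\<close> chosen by \<open>m\<close>. From
  \<open>k (2 eps s + M_s) \<le> eps (s+1) / 2\<close> and \<open>\<Delta>, M_s \<ge> 0\<close> one gets
  \<open>k (2 \<Delta> + M_s) \<le> eps (s+1) / 2 \<cdot> (\<Delta> / eps s + 1)\<close>, in which the random \<open>M_s\<close> no longer occurs. Since
  \<open>\<Delta>\<close> has mean at most \<open>eps s\<close>, the right-hand side has mean at most \<open>eps (s+1)\<close>.
\<close>

lemma mean_gap: "(\<integral>\<^sup>+ \<omega>. gap s \<omega> (xt s \<omega>) \<partial>M) \<le> ennreal (eps s)"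
proof (induction s)
  case 0
  have "AE \<omega> in M. gap 0 \<omega> (xt 0 \<omega>) \<le> ennreal (eps 0)"
    using eps0_bound
  proof eventually_elim
    case (elim \<omega>)
    then have "e2ennreal (H 0 \<omega> (xt 0 \<omega>) - Hmin 0 \<omega>) \<le> e2ennreal (ereal \<epsilon>0)" by (rule e2ennreal_mono)
    then show ?case by (simp add: gap_def eps_def)
  qed
  then have "(\<integral>\<^sup>+ \<omega>. gap 0 \<omega> (xt 0 \<omega>) \<partial>M) \<le> (\<integral>\<^sup>+ \<omega>. ennreal (eps 0) \<partial>M)" by (rule nn_integral_mono_AE)
  then show ?case by (simp add: emeasure_space_1)
next
  case (Suc s)
  interpret F: finite_measure_subalgebra M "past (Suc s)"
    by unfold_locales (rule subalgebra_past)
  let ?k = "\<lambda>\<omega>. (2::real) powi (- \<lfloor>real (m (Suc s) \<omega>) / K (Suc s)\<rfloor>)"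
  let ?G = "\<lambda>\<omega>. gap (Suc s) \<omega> (xt (Suc s) \<omega>)"
  let ?G' = "\<lambda>\<omega>. e2ennreal (H (Suc s) \<omega> (\<A> (Suc s) \<omega> (xprev (Suc s) \<omega>) (m (Suc s) \<omega>) (H (Suc s) \<omega>)) - Hmin (Suc s) \<omega>)"
  have GG': "?G' \<omega> = ?G \<omega>" if "\<omega> \<in> space M" for \<omega> using that by (simp add: gap_def xt_step)
  have G [measurable]: "?G \<in> borel_measurable M" by (rule gap_borel[OF xt_borel])
  then have G' [measurable]: "?G' \<in> borel_measurable M"
    by (subst measurable_cong[of M ?G' ?G borel, OF GG'])
  have [measurable]: "(\<lambda>\<omega>. gap s \<omega> (xt s \<omega>)) \<in> borel_measurable M" by (rule gap_borel[OF xt_borel])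
  have "(\<integral>\<^sup>+ \<omega>. ?G \<omega> \<partial>M) = (\<integral>\<^sup>+ \<omega>. 1 * ?G' \<omega> \<partial>M)"
    by (intro nn_integral_cong) (use GG' in simp)
  also have "\<dots> = (\<integral>\<^sup>+ \<omega>. 1 * nn_cond_exp M (past (Suc s)) ?G' \<omega> \<partial>M)"
    by (rule F.nn_cond_exp_intg[OF _ G', symmetric]) simp
  also have "\<dots> \<le> (\<integral>\<^sup>+ \<omega>. ennreal (?k \<omega>) * gap (Suc s) \<omega> (x s \<omega>) \<partial>M)"
  proof (rule nn_integral_mono_AE)
    have "AE \<omega> in M. nn_cond_exp M (past (Suc s)) ?G' \<omega>
        \<le> ennreal (?k \<omega>) * e2ennreal (H (Suc s) \<omega> (xprev (Suc s) \<omega>) - Hmin (Suc s) \<omega>)"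
      using xprev_in[of _ "Suc s"] by (intro solver_rate xprev_past m_past) (simp_all only: C_def)
    then show "AE \<omega> in M. 1 * nn_cond_exp M (past (Suc s)) ?G' \<omega> \<le> ennreal (?k \<omega>) * gap (Suc s) \<omega> (x s \<omega>)"
      by (simp add: gap_def)
  qed
  also have "\<dots> \<le> (\<integral>\<^sup>+ \<omega>. ennreal (eps (Suc s) / (2 * eps s)) * gap s \<omega> (xt s \<omega>) + ennreal (eps (Suc s) / 2) \<partial>M)"
  proof (rule nn_integral_mono)
    fix \<omega> assume \<omega>: "\<omega> \<in> space M"
    have k0: "0 < ?k \<omega>" by simp
    note c = m_Suc_contracts[OF \<omega>, of s]
    have e: "0 < eps s" by (rule eps_pos)
    have "?k \<omega> * (2 * eps s) \<le> ?k \<omega> * (2 * eps s + Ms s \<omega>)"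
      using Ms_nonneg[of s \<omega>] k0 by (intro mult_left_mono) auto
    with c have "?k \<omega> * (2 * eps s) \<le> eps (Suc s) / 2" by linarith
    then have c1: "?k \<omega> * 2 \<le> eps (Suc s) / (2 * eps s)" using e by (simp add: field_simps)
    have "?k \<omega> * Ms s \<omega> \<le> ?k \<omega> * (2 * eps s + Ms s \<omega>)"
      using e k0 by (intro mult_left_mono) auto
    with c have c2: "?k \<omega> * Ms s \<omega> \<le> eps (Suc s) / 2" by linarith
    have "ennreal (?k \<omega>) * gap (Suc s) \<omega> (x s \<omega>) \<le> ennreal (?k \<omega>) * (2 * gap s \<omega> (x s \<omega>) + ennreal (Ms s \<omega>))"
      by (intro mult_left_mono gap_Suc_le[OF \<omega>]) auto
    also have "\<dots> \<le> ennreal (?k \<omega>) * (ennreal 2 * gap s \<omega> (xt s \<omega>) + ennreal (Ms s \<omega>))"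
      using mult_left_mono[OF gap_x_le[OF \<omega>, of s], of 2] by (intro mult_left_mono add_right_mono) auto
    also have "\<dots> = ennreal (?k \<omega> * 2) * gap s \<omega> (xt s \<omega>) + ennreal (?k \<omega> * Ms s \<omega>)"
      using k0 Ms_nonneg[of s \<omega>] by (simp add: distrib_left ennreal_mult mult.assoc)
    also have "\<dots> \<le> ennreal (eps (Suc s) / (2 * eps s)) * gap s \<omega> (xt s \<omega>) + ennreal (eps (Suc s) / 2)"
      by (intro add_mono mult_right_mono ennreal_leI c1 c2) auto
    finally show "ennreal (?k \<omega>) * gap (Suc s) \<omega> (x s \<omega>)
      \<le> ennreal (eps (Suc s) / (2 * eps s)) * gap s \<omega> (xt s \<omega>) + ennreal (eps (Suc s) / 2)" .
  qed
  also have "\<dots> = ennreal (eps (Suc s) / (2 * eps s)) * (\<integral>\<^sup>+ \<omega>. gap s \<omega> (xt s \<omega>) \<partial>M) + ennreal (eps (Suc s) / 2)"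
    by (simp add: nn_integral_add nn_integral_cmult emeasure_space_1)
  also have "\<dots> \<le> ennreal (eps (Suc s) / (2 * eps s)) * ennreal (eps s) + ennreal (eps (Suc s) / 2)"
    by (intro add_mono mult_left_mono Suc.IH) auto
  also have "\<dots> = ennreal (eps (Suc s))"
    using eps_pos[of s] eps_pos[of "Suc s"] by (simp flip: ennreal_mult' ennreal_plus)
  finally show ?case .
qed

lemma xt_in: "AE \<omega> in M. xt s \<omega> \<in> C"
proof -
  have "(\<integral>\<^sup>+ \<omega>. gap s \<omega> (xt s \<omega>) \<partial>M) \<noteq> \<infinity>"
    using mean_gap[of s] by (auto simp: top_unique)
  from nn_integral_PInf_AE[OF gap_borel[OF xt_borel] this] show ?thesis
  proof eventually_elim
    case (elim \<omega>)
    then show ?case using gap_eq(2)[of "xt s \<omega>" s \<omega>] by (cases "xt s \<omega> \<in> C") auto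
  qed
qed

text \<open>
  The bound of \<open>inexact_step\<close> for the distance of the new iterates from the exact proximal step.
\<close>

definition step_error :: "nat \<Rightarrow> 'w \<Rightarrow> real" where
  "step_error s \<omega> = sqrt (2 * enn2real (gap s \<omega> (x s \<omega>)) / \<beta> s)"

lemma x_borel [measurable]: "x s \<in> borel_measurable M" by (rule x_measurable)
lemma l_borel [measurable]: "l s \<in> borel_measurable M" by (rule l_measurable)
lemma xprev_borel [measurable]: "xprev s \<in> borel_measurable M"
  using measurable_from_subalg[OF subalgebra_past xprev_past] .

lemma step_error_borel [measurable]: "step_error s \<in> borel_measurable M"
proof -
  have [measurable]: "(\<lambda>\<omega>. gap s \<omega> (x s \<omega>)) \<in> borel_measurable M" by (rule gap_borel[OF x_measurable])
  show ?thesis unfolding step_error_def[abs_def] by measurable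
qed

lemma mean_square_step_error:
  "(\<integral>\<^sup>+ \<omega>. ennreal ((step_error s \<omega>)\<^sup>2) \<partial>M) \<le> ennreal ((2 * sqrt (\<epsilon>0 / \<beta>0) * sqrt (\<eta> / \<rho>) ^ s)\<^sup>2)"
proof -
  have b: "0 < \<beta> s" by (rule beta_pos)
  have [measurable]: "(\<lambda>\<omega>. gap s \<omega> (xt s \<omega>)) \<in> borel_measurable M" by (rule gap_borel[OF xt_borel])
  have "(\<integral>\<^sup>+ \<omega>. ennreal ((step_error s \<omega>)\<^sup>2) \<partial>M) \<le> (\<integral>\<^sup>+ \<omega>. ennreal (2 / \<beta> s) * gap s \<omega> (xt s \<omega>) \<partial>M)"
  proof (rule nn_integral_mono)
    fix \<omega> assume \<omega>: "\<omega> \<in> space M"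
    have "(step_error s \<omega>)\<^sup>2 = 2 / \<beta> s * enn2real (gap s \<omega> (x s \<omega>))"
      using b by (simp add: step_error_def)
    then have "ennreal ((step_error s \<omega>)\<^sup>2) = ennreal (2 / \<beta> s) * ennreal (enn2real (gap s \<omega> (x s \<omega>)))"
      using b by (simp only:) (intro ennreal_mult; simp)
    also have "ennreal (enn2real (gap s \<omega> (x s \<omega>))) = gap s \<omega> (x s \<omega>)"
      using gap_eq(1)[OF x_in[OF \<omega>]] by simp
    also have "ennreal (2 / \<beta> s) * gap s \<omega> (x s \<omega>) \<le> ennreal (2 / \<beta> s) * gap s \<omega> (xt s \<omega>)"
      by (intro mult_left_mono gap_x_le \<omega>) auto
    finally show "ennreal ((step_error s \<omega>)\<^sup>2) \<le> ennreal (2 / \<beta> s) * gap s \<omega> (xt s \<omega>)" .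
  qed
  also have "\<dots> = ennreal (2 / \<beta> s) * (\<integral>\<^sup>+ \<omega>. gap s \<omega> (xt s \<omega>) \<partial>M)" by (simp add: nn_integral_cmult)
  also have "\<dots> \<le> ennreal (2 / \<beta> s) * ennreal (eps s)" by (intro mult_left_mono mean_gap) auto
  also have "\<dots> = ennreal (2 / \<beta> s * eps s)" 
    using b eps_pos[of s] by (intro ennreal_mult[symmetric]) auto
  also have "2 / \<beta> s * eps s \<le> (2 * sqrt (\<epsilon>0 / \<beta>0) * sqrt (\<eta> / \<rho>) ^ s)\<^sup>2"
  proof -
    have "(sqrt (\<eta> / \<rho>) ^ s)\<^sup>2 = (\<eta> / \<rho>) ^ s"
      using eta_bounds rho_bounds by (simp add: power2_eq_square flip: power_mult_distrib)
    then have "(2 * sqrt (\<epsilon>0 / \<beta>0) * sqrt (\<eta> / \<rho>) ^ s)\<^sup>2 = 4 * (\<epsilon>0 / \<beta>0) * (\<eta> / \<rho>) ^ s"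
      using eps0_pos beta0_pos by (simp add: power_mult_distrib)
    also have "\<dots> = 4 * (eps s / \<beta> s)" by (simp add: eps_def \<beta>_def power_divide)
    finally show ?thesis using b eps_pos[of s] by (simp add: field_simps)
  qed
  finally show ?thesis by (simp add: ennreal_leI)
qed

context
  fixes xs :: "real^'n" and ls :: "(real^'d1) \<times> (real^'d2)"
  assumes xs: "xs \<in> C" and ls: "ls \<in> E"
    and saddle_x: "\<And>x. x \<in> C \<Longrightarrow> r xs + ls \<bullet> p xs \<le> r x + ls \<bullet> p x"
    and saddle_l: "\<And>v. v \<in> E \<Longrightarrow> v \<bullet> p xs - k v \<le> ls \<bullet> p xs - k ls"
begin

definition dist_opt :: "nat \<Rightarrow> 'w \<Rightarrow> real" where
  "dist_opt s \<omega> = norm ((xprev s \<omega>, l s \<omega>) - (xs, ls))"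

lemma dist_opt_borel [measurable]: "dist_opt s \<in> borel_measurable M"
  unfolding dist_opt_def[abs_def]
  by (rule measurable_compose[OF borel_measurable_Pair[OF xprev_borel l_borel]])
     (intro borel_measurable_continuous_onI continuous_intros)

text \<open>
  A bound for the root mean square of the distances of all iterates to the saddle point. The increments
  \<open>2 sqrt (eps s / \<beta> s)\<close> sum up to the second term.
\<close>

definition radius :: real where
  "radius = norm ((xinit, l0) - (xs, ls)) + 2 * sqrt (\<epsilon>0 / \<beta>0) / (1 - sqrt (\<eta> / \<rho>))"

lemma step_bounds:
  assumes \<omega>: "\<omega> \<in> space M"
  shows "dist_opt (Suc s) \<omega> \<le> dist_opt s \<omega> + step_error s \<omega>"
    and "norm ((x s \<omega>, l (Suc s) \<omega>) - (xprev s \<omega>, l s \<omega>)) \<le> dist_opt s \<omega> + step_error s \<omega>"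
proof -
  have "sqrt (2 * (aug_val (\<beta> s) (xprev s \<omega>) (l s \<omega>) (x s \<omega>)
      - aug_val (\<beta> s) (xprev s \<omega>) (l s \<omega>) (exact_x (\<beta> s) (xprev s \<omega>) (l s \<omega>))) / \<beta> s) = step_error s \<omega>"
    using Hstar_le[OF x_in[OF \<omega>, of s], of s \<omega>]
    by (simp add: step_error_def gap_eq(1)[OF x_in[OF \<omega>]] Hstar_def)
  note * = inexact_step[OF beta_pos[of s] x_in[OF \<omega>, of s] xs ls saddle_x saddle_l, where y = "xprev s \<omega>" and l = "l s \<omega>", unfolded this]
  show "dist_opt (Suc s) \<omega> \<le> dist_opt s \<omega> + step_error s \<omega>"
    using *(1) by (simp add: dist_opt_def l_Suc[OF \<omega>] del: diff_Pair)
  show "norm ((x s \<omega>, l (Suc s) \<omega>) - (xprev s \<omega>, l s \<omega>)) \<le> dist_opt s \<omega> + step_error s \<omega>"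
    using *(2) by (simp add: dist_opt_def l_Suc[OF \<omega>] del: diff_Pair)
qed

lemma ratio_bounds: "0 < sqrt (\<eta> / \<rho>)" "sqrt (\<eta> / \<rho>) < 1" "\<eta> / \<rho> \<le> \<rho>\<^sup>2"
proof -
  show "0 < sqrt (\<eta> / \<rho>)" using eta_bounds rho_bounds by simp
  show 1: "\<eta> / \<rho> \<le> \<rho>\<^sup>2" using eta_bounds rho_bounds by (simp add: field_simps power2_eq_square power3_eq_cube)
  have "\<rho>\<^sup>2 < 1" using rho_bounds by (simp add: power_less_one_iff)
  with 1 show "sqrt (\<eta> / \<rho>) < 1" by simp
qed

lemma mean_square_dist:
  shows "(\<integral>\<^sup>+ \<omega>. ennreal ((dist_opt s \<omega> + step_error s \<omega>)\<^sup>2) \<partial>M) \<le> ennreal (radius\<^sup>2)"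
proof -
  let ?q = "sqrt (\<eta> / \<rho>)" and ?c = "2 * sqrt (\<epsilon>0 / \<beta>0)"
  define A where "A s = norm ((xinit, l0) - (xs, ls)) + ?c * (\<Sum>t<s. ?q ^ t)" for s
  have c0: "0 \<le> ?c" using eps0_pos beta0_pos by simp
  have A0: "0 \<le> A s" for s
    unfolding A_def using c0 ratio_bounds by (intro add_nonneg_nonneg mult_nonneg_nonneg sum_nonneg) auto
  have AS: "A s + ?c * ?q ^ s = A (Suc s)" for s by (simp add: A_def algebra_simps)
  have add: "(\<integral>\<^sup>+ \<omega>. ennreal ((dist_opt s \<omega> + step_error s \<omega>)\<^sup>2) \<partial>M) \<le> ennreal ((A (Suc s))\<^sup>2)"
    if "(\<integral>\<^sup>+ \<omega>. ennreal ((dist_opt s \<omega>)\<^sup>2) \<partial>M) \<le> ennreal ((A s)\<^sup>2)" for s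
    unfolding AS[symmetric] using that c0 ratio_bounds
    by (intro nn_integral_square_add_le mean_square_step_error A0) auto
  have "(\<integral>\<^sup>+ \<omega>. ennreal ((dist_opt s \<omega>)\<^sup>2) \<partial>M) \<le> ennreal ((A s)\<^sup>2)" for s
  proof (induction s)
    case 0
    have "(\<integral>\<^sup>+ \<omega>. ennreal ((dist_opt 0 \<omega>)\<^sup>2) \<partial>M) = (\<integral>\<^sup>+ \<omega>. ennreal ((A 0)\<^sup>2) \<partial>M)"
      by (intro nn_integral_cong) (simp add: dist_opt_def A_def l_init xprev_def)
    then show ?case by (simp add: emeasure_space_1)
  next
    case (Suc s)
    have "(\<integral>\<^sup>+ \<omega>. ennreal ((dist_opt (Suc s) \<omega>)\<^sup>2) \<partial>M) \<le> (\<integral>\<^sup>+ \<omega>. ennreal ((dist_opt s \<omega> + step_error s \<omega>)\<^sup>2) \<partial>M)"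
      using step_bounds(1)
      by (intro nn_integral_mono ennreal_leI power_mono) (auto simp: dist_opt_def)
    also note add[OF Suc]
    finally show ?case .
  qed
  from add[OF this] have "(\<integral>\<^sup>+ \<omega>. ennreal ((dist_opt s \<omega> + step_error s \<omega>)\<^sup>2) \<partial>M) \<le> ennreal ((A (Suc s))\<^sup>2)" .
  also have "(A (Suc s))\<^sup>2 \<le> radius\<^sup>2"
  proof (rule power_mono[OF _ A0])
    have "(\<Sum>t<Suc s. ?q ^ t) \<le> 1 / (1 - ?q)"
    proof -
      have ne: "?q \<noteq> 1" using ratio_bounds(2) by linarith
      have "(\<Sum>t<Suc s. ?q ^ t) = (1 - ?q ^ Suc s) / (1 - ?q)"
        using ne by (simp only: sum_gp_strict if_False)
      also have "\<dots> \<le> 1 / (1 - ?q)"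
        using ratio_bounds by (intro divide_right_mono) auto
      finally show ?thesis .
    qed
    from mult_left_mono[OF this c0] show "A (Suc s) \<le> radius" by (simp add: A_def radius_def)
  qed
  finally show ?thesis by (simp add: ennreal_leI)
qed

lemma radius_pos: "0 < radius"
  unfolding radius_def using ratio_bounds eps0_pos beta0_pos by (intro add_nonneg_pos divide_pos_pos) auto

lemma mean_dual_residual:
  "(\<integral>\<^sup>+ \<omega>. edist_set 0 (subdiff_lagrangian_dual h p (x s \<omega>) (l (Suc s) \<omega>)) \<partial>M) \<le> ennreal (\<beta> s * radius)"
proof -
  let ?f = "\<lambda>\<omega>. \<beta> s * (dist_opt s \<omega> + step_error s \<omega>)"
  have b: "0 < \<beta> s" by (rule beta_pos)
  have "(\<integral>\<^sup>+ \<omega>. edist_set 0 (subdiff_lagrangian_dual h p (x s \<omega>) (l (Suc s) \<omega>)) \<partial>M) \<le> (\<integral>\<^sup>+ \<omega>. ennreal (?f \<omega>) \<partial>M)"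
  proof (rule nn_integral_mono)
    fix \<omega> assume \<omega>: "\<omega> \<in> space M"
    have "edist_set 0 (subdiff_lagrangian_dual h p (x s \<omega>) (l (Suc s) \<omega>)) \<le> ennreal (\<beta> s * norm (l (Suc s) \<omega> - l s \<omega>))"
      unfolding l_Suc[OF \<omega>] by (rule dual_residual[OF b])
    also have "norm (l (Suc s) \<omega> - l s \<omega>) \<le> norm ((x s \<omega>, l (Suc s) \<omega>) - (xprev s \<omega>, l s \<omega>))"
      using norm_snd_le[of "l (Suc s) \<omega> - l s \<omega>" "x s \<omega> - xprev s \<omega>"] by simp
    also have "\<dots> \<le> dist_opt s \<omega> + step_error s \<omega>" by (rule step_bounds(2)[OF \<omega>])
    finally show "edist_set 0 (subdiff_lagrangian_dual h p (x s \<omega>) (l (Suc s) \<omega>)) \<le> ennreal (?f \<omega>)"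
      using b by (simp add: ennreal_leI mult_left_mono)
  qed
  also have "\<dots> \<le> ennreal (\<beta> s * radius)"
  proof (rule nn_integral_le_sqrt)
    show "?f \<in> borel_measurable M" by measurable
    show "0 < \<beta> s * radius" using b radius_pos by simp
    have "(\<integral>\<^sup>+ \<omega>. ennreal ((?f \<omega>)\<^sup>2) \<partial>M) = ennreal ((\<beta> s)\<^sup>2) * (\<integral>\<^sup>+ \<omega>. ennreal ((dist_opt s \<omega> + step_error s \<omega>)\<^sup>2) \<partial>M)"
      by (simp add: power_mult_distrib ennreal_mult nn_integral_cmult)
    also have "\<dots> \<le> ennreal ((\<beta> s)\<^sup>2) * ennreal (radius\<^sup>2)" by (intro mult_left_mono mean_square_dist) auto
    finally show "(\<integral>\<^sup>+ \<omega>. ennreal ((?f \<omega>)\<^sup>2) \<partial>M) \<le> ennreal ((\<beta> s * radius)\<^sup>2)"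
      by (simp add: power_mult_distrib ennreal_mult)
  qed
  finally show ?thesis .
qed

text \<open>
  In the bound \<open>2 L |x - xt| + \<beta> s |x - y|\<close> the square of the first term is at most \<open>8 L\<close> times the gap
  at \<open>xt\<close>, by the descent of the proximal gradient step.
\<close>

lemma mean_primal_residual:
  "(\<integral>\<^sup>+ \<omega>. edist_set 0 (subdiff_lagrangian_x f g p (x s \<omega>) (l (Suc s) \<omega>)) \<partial>M)
    \<le> ennreal (sqrt (16 * L s * eps s + 2 * (\<beta> s * radius)\<^sup>2))"
proof -
  let ?d = "\<lambda>\<omega>. norm (x s \<omega> - xt s \<omega>)"
  let ?f = "\<lambda>\<omega>. 2 * L s * ?d \<omega> + \<beta> s * (dist_opt s \<omega> + step_error s \<omega>)"
  have b: "0 < \<beta> s" by (rule beta_pos)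
  have L0: "0 < L s" by (rule L_pos)
  note [measurable] = xt_borel[of s] gap_borel[OF xt_borel, of s s]
  have "(\<integral>\<^sup>+ \<omega>. edist_set 0 (subdiff_lagrangian_x f g p (x s \<omega>) (l (Suc s) \<omega>)) \<partial>M) \<le> (\<integral>\<^sup>+ \<omega>. ennreal (?f \<omega>) \<partial>M)"
  proof (rule nn_integral_mono_AE)
    show "AE \<omega> in M. edist_set 0 (subdiff_lagrangian_x f g p (x s \<omega>) (l (Suc s) \<omega>)) \<le> ennreal (?f \<omega>)"
      using xt_in[of s] AE_space
    proof eventually_elim
      fix \<omega> assume xt: "xt s \<omega> \<in> C" and \<omega>: "\<omega> \<in> space M"
      have "edist_set 0 (subdiff_lagrangian_x f g p (x s \<omega>) (l (Suc s) \<omega>))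
          \<le> ennreal (2 * L s * ?d \<omega> + \<beta> s * norm (x s \<omega> - xprev s \<omega>))"
        unfolding l_Suc[OF \<omega>]
        by (rule primal_residual[OF b less_imp_le[OF L0] xt x_in[OF \<omega>] descent_real[OF \<omega>] x_step_real[OF \<omega> xt]])
      also have "norm (x s \<omega> - xprev s \<omega>) \<le> norm ((x s \<omega>, l (Suc s) \<omega>) - (xprev s \<omega>, l s \<omega>))"
        using norm_fst_le[of "x s \<omega> - xprev s \<omega>" "l (Suc s) \<omega> - l s \<omega>"] by simp
      also have "\<dots> \<le> dist_opt s \<omega> + step_error s \<omega>" by (rule step_bounds(2)[OF \<omega>])
      finally show "edist_set 0 (subdiff_lagrangian_x f g p (x s \<omega>) (l (Suc s) \<omega>)) \<le> ennreal (?f \<omega>)"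
        using b by (simp add: ennreal_leI mult_left_mono)
    qed
  qed
  also have "\<dots> \<le> ennreal (sqrt (16 * L s * eps s + 2 * (\<beta> s * radius)\<^sup>2))"
  proof (rule nn_integral_le_sqrt)
    show "?f \<in> borel_measurable M" by measurable
    have pos: "0 < 16 * L s * eps s + 2 * (\<beta> s * radius)\<^sup>2"
      using L0 eps_pos[of s] by (intro add_pos_nonneg) auto
    then show "0 < sqrt (16 * L s * eps s + 2 * (\<beta> s * radius)\<^sup>2)" by simp
    have "(\<integral>\<^sup>+ \<omega>. ennreal ((?f \<omega>)\<^sup>2) \<partial>M)
        \<le> (\<integral>\<^sup>+ \<omega>. ennreal (16 * L s) * gap s \<omega> (xt s \<omega>)
              + ennreal (2 * (\<beta> s)\<^sup>2) * ennreal ((dist_opt s \<omega> + step_error s \<omega>)\<^sup>2) \<partial>M)"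
    proof (rule nn_integral_mono_AE)
      show "AE \<omega> in M. ennreal ((?f \<omega>)\<^sup>2) \<le> ennreal (16 * L s) * gap s \<omega> (xt s \<omega>)
              + ennreal (2 * (\<beta> s)\<^sup>2) * ennreal ((dist_opt s \<omega> + step_error s \<omega>)\<^sup>2)"
        using xt_in[of s] AE_space
      proof eventually_elim
        fix \<omega> assume xt: "xt s \<omega> \<in> C" and \<omega>: "\<omega> \<in> space M"
        let ?D = "dist_opt s \<omega> + step_error s \<omega>"
        have sq: "(a + c)\<^sup>2 \<le> 2 * a\<^sup>2 + 2 * c\<^sup>2" for a c :: real
          using zero_le_power2[of "a - c"] by (simp add: power2_sum power2_diff)
        have "(?f \<omega>)\<^sup>2 \<le> 2 * (2 * L s * ?d \<omega>)\<^sup>2 + 2 * (\<beta> s * ?D)\<^sup>2" by (rule sq)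
        also have "\<dots> = 16 * L s * (L s / 2 * (?d \<omega>)\<^sup>2) + 2 * (\<beta> s)\<^sup>2 * ?D\<^sup>2"
          by (simp add: power_mult_distrib) (simp add: power2_eq_square)
        finally have "ennreal ((?f \<omega>)\<^sup>2) \<le> ennreal (16 * L s * (L s / 2 * (?d \<omega>)\<^sup>2) + 2 * (\<beta> s)\<^sup>2 * ?D\<^sup>2)"
          by (rule ennreal_leI)
        also have "\<dots> = ennreal (16 * L s) * ennreal (L s / 2 * (?d \<omega>)\<^sup>2) + ennreal (2 * (\<beta> s)\<^sup>2) * ennreal (?D\<^sup>2)"
        proof -
          have "ennreal (16 * L s * (L s / 2 * (?d \<omega>)\<^sup>2) + 2 * (\<beta> s)\<^sup>2 * ?D\<^sup>2)
              = ennreal (16 * L s * (L s / 2 * (?d \<omega>)\<^sup>2)) + ennreal (2 * (\<beta> s)\<^sup>2 * ?D\<^sup>2)"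
            using L0 by (intro ennreal_plus mult_nonneg_nonneg) auto
          also have "ennreal (16 * L s * (L s / 2 * (?d \<omega>)\<^sup>2)) = ennreal (16 * L s) * ennreal (L s / 2 * (?d \<omega>)\<^sup>2)"
            using L0 by (intro ennreal_mult mult_nonneg_nonneg) auto
          also have "ennreal (2 * (\<beta> s)\<^sup>2 * ?D\<^sup>2) = ennreal (2 * (\<beta> s)\<^sup>2) * ennreal (?D\<^sup>2)"
            by (intro ennreal_mult) auto
          finally show ?thesis .
        qed
        also have "ennreal (L s / 2 * (?d \<omega>)\<^sup>2) \<le> gap s \<omega> (xt s \<omega>)"
          using gap_decrease[OF \<omega> xt] by (rule order_trans[rotated]) simp
        finally show "ennreal ((?f \<omega>)\<^sup>2) \<le> ennreal (16 * L s) * gap s \<omega> (xt s \<omega>)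
              + ennreal (2 * (\<beta> s)\<^sup>2) * ennreal (?D\<^sup>2)"
          by (simp add: mult_left_mono add_mono)
      qed
    qed
    also have "\<dots> = ennreal (16 * L s) * (\<integral>\<^sup>+ \<omega>. gap s \<omega> (xt s \<omega>) \<partial>M)
        + ennreal (2 * (\<beta> s)\<^sup>2) * (\<integral>\<^sup>+ \<omega>. ennreal ((dist_opt s \<omega> + step_error s \<omega>)\<^sup>2) \<partial>M)"
      by (simp add: nn_integral_add nn_integral_cmult)
    also have "\<dots> \<le> ennreal (16 * L s) * ennreal (eps s) + ennreal (2 * (\<beta> s)\<^sup>2) * ennreal (radius\<^sup>2)"
      by (intro add_mono mult_left_mono mean_gap mean_square_dist) auto
    also have "\<dots> = ennreal (16 * L s * eps s + 2 * (\<beta> s * radius)\<^sup>2)"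
      using L0 eps_pos[of s]
      by (simp add: power_mult_distrib mult.assoc flip: ennreal_mult ennreal_plus)
    finally show "(\<integral>\<^sup>+ \<omega>. ennreal ((?f \<omega>)\<^sup>2) \<partial>M) \<le> ennreal ((sqrt (16 * L s * eps s + 2 * (\<beta> s * radius)\<^sup>2))\<^sup>2)"
      using pos by simp
  qed
  finally show ?thesis .
qed

end

end

theorem corollary9:
  fixes f g :: "real^'n \<Rightarrow> ereal"
    and h1 :: "real^'d1 \<Rightarrow> real"
    and \<K> :: "(real^'d2) set"
    and p1 :: "real^'n \<Rightarrow> real^'d1"
    and p2 :: "real^'n \<Rightarrow> real^'d2"
    and M :: "'w measure"
    and \<A> :: "nat \<Rightarrow> 'w \<Rightarrow> real^'n \<Rightarrow> nat \<Rightarrow> (real^'n \<Rightarrow> ereal) \<Rightarrow> real^'n"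
    and \<beta>0 \<rho> \<eta> \<epsilon>0 Lh1 \<gamma> \<epsilon> c0 c4 :: real
    and m0 :: nat
    and L K :: "nat \<Rightarrow> real"
    and xinit xstar :: "real^'n"
    and l0 lstar :: "(real^'d1) \<times> (real^'d2)"
    and xt x :: "nat \<Rightarrow> 'w \<Rightarrow> real^'n"
    and l :: "nat \<Rightarrow> 'w \<Rightarrow> (real^'d1) \<times> (real^'d2)"
    and m :: "nat \<Rightarrow> 'w \<Rightarrow> nat"
    and s :: nat
  assumes run: "ipalm_kkt f g h1 \<K> p1 p2 Lh1 M \<A> \<beta>0 \<rho> \<eta> \<epsilon>0 m0 L K xinit l0 xt x l m"
    and xstar: "is_arg_min (\<lambda>y. f y + g y + split_h h1 \<K> (p1 y, p2 y)) (\<lambda>_. True) xstar"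
    and lstar: "is_arg_max (dual_fun f g (split_h h1 \<K>) (\<lambda>y. (p1 y, p2 y))) (\<lambda>_. True) lstar"
    and gamma: "0 < \<gamma>" "\<And>t. L t \<le> \<gamma> * inverse (\<beta>0 * \<rho> ^ t)"
    and c0: "c0 = 2 * (norm ((xinit, l0) - (xstar, lstar))
                       + 2 * sqrt (\<epsilon>0 / \<beta>0) / (1 - sqrt (\<eta> / \<rho>)))\<^sup>2
                  + 2 * (norm lstar)\<^sup>2 + 2 * (norm xstar)\<^sup>2"
    and c4: "c4 = max (sqrt (16 * \<gamma> * \<epsilon>0 / \<beta>0 + 8 * c0 * \<beta>0\<^sup>2)) (\<beta>0 * sqrt c0)"
    and eps: "0 < \<epsilon>"
    and s: "real s \<ge> ln (c4 / \<epsilon>) / ln (1 / \<rho>)"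
  shows "(\<integral>\<^sup>+ \<omega>. edist_set 0
            (subdiff_lagrangian_x f g (\<lambda>y. (p1 y, p2 y)) (x s \<omega>) (l (Suc s) \<omega>)) \<partial>M) \<le> ennreal \<epsilon>
       \<and> (\<integral>\<^sup>+ \<omega>. edist_set 0
            (subdiff_lagrangian_dual (split_h h1 \<K>) (\<lambda>y. (p1 y, p2 y)) (x s \<omega>) (l (Suc s) \<omega>)) \<partial>M) \<le> ennreal \<epsilon>"
proof -
  interpret ipalm_kkt f g h1 \<K> p1 p2 Lh1 M \<A> \<beta>0 \<rho> \<eta> \<epsilon>0 m0 L K xinit l0 xt x l m by (rule run)
  note sad = optimal_saddle[OF xstar lstar]
  define R where "R = norm ((xinit, l0) - (xstar, lstar)) + 2 * sqrt (\<epsilon>0 / \<beta>0) / (1 - sqrt (\<eta> / \<rho>))"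
  have R: "radius xstar lstar = R" unfolding R_def by (rule radius_def[OF sad])
  have R0: "0 < R" using radius_pos[OF sad] R by simp
  have c0R: "2 * R\<^sup>2 \<le> c0" unfolding c0 R_def by simp
  then have R2: "R\<^sup>2 \<le> c0" using zero_le_power2[of R] by linarith
  then have c0R': "R\<^sup>2 \<le> c0" "R \<le> sqrt c0" by (auto intro: real_le_rsqrt)
  have c0_pos: "0 < c0" using R2 zero_less_power[OF R0, of 2] by linarith
  have \<rho>: "0 < \<rho>" "\<rho> < 1" using rho_bounds by auto
  have A: "0 < 16 * \<gamma> * \<epsilon>0 / \<beta>0 + 8 * c0 * \<beta>0\<^sup>2"
    using gamma(1) eps0_pos beta0_pos c0_pos by (intro add_pos_nonneg) auto
  have c4: "0 < c4" "\<beta>0 * sqrt c0 \<le> c4" "sqrt (16 * \<gamma> * \<epsilon>0 / \<beta>0 + 8 * c0 * \<beta>0\<^sup>2) \<le> c4"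
    using A unfolding c4 by (auto simp: less_max_iff_disj)
  \<comment> \<open>This is what the lower bound on \<open>s\<close> says.\<close>
  have small: "\<rho> ^ s * c4 \<le> \<epsilon>"
  proof -
    have "0 < ln (1 / \<rho>)" using \<rho> by simp
    then have "ln (c4 / \<epsilon>) \<le> real s * ln (1 / \<rho>)" using s by (simp add: pos_divide_le_eq)
    also have "\<dots> = ln ((1 / \<rho>) ^ s)" using \<rho> by (simp add: ln_realpow)
    finally have "c4 / \<epsilon> \<le> (1 / \<rho>) ^ s" using c4(1) eps \<rho> by simp
    then show ?thesis using \<rho> eps by (simp add: power_divide field_simps)
  qed
  have b: "\<beta> s = \<beta>0 * \<rho> ^ s" by (rule \<beta>_def)
  have bR: "\<beta> s * R \<le> \<rho> ^ s * (\<beta>0 * sqrt c0)"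
    using c0R'(2) beta0_pos \<rho> by (simp add: b mult_left_mono)
  have "\<beta> s * R \<le> \<epsilon>"
  proof -
    have "\<rho> ^ s * (\<beta>0 * sqrt c0) \<le> \<rho> ^ s * c4" using c4(2) \<rho> by (intro mult_left_mono) auto
    with bR small show ?thesis by linarith
  qed
  then have dual: "(\<integral>\<^sup>+ \<omega>. edist_set 0 (subdiff_lagrangian_dual h p (x s \<omega>) (l (Suc s) \<omega>)) \<partial>M) \<le> ennreal \<epsilon>"
    using mean_dual_residual[OF sad, of s] unfolding R by (meson ennreal_leI order_trans)
  \<comment> \<open>Here \<open>\<eta> \<le> \<rho>^3\<close> enters, as \<open>\<eta> / \<rho> \<le> \<rho>^2\<close>.\<close>
  have "L s * eps s \<le> \<gamma> * \<epsilon>0 / \<beta>0 * (\<rho> ^ s)\<^sup>2"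
  proof -
    have "L s * eps s \<le> \<gamma> * inverse (\<beta>0 * \<rho> ^ s) * eps s"
      using gamma(2)[of s] eps_pos[of s] by (intro mult_right_mono) auto
    also have "\<dots> = \<gamma> * \<epsilon>0 / \<beta>0 * (\<eta> / \<rho>) ^ s"
      by (simp add: eps_def power_divide field_simps)
    also have "\<dots> \<le> \<gamma> * \<epsilon>0 / \<beta>0 * (\<rho>\<^sup>2) ^ s"
      using ratio_bounds(3)[OF sad] eta_bounds \<rho> gamma(1) eps0_pos beta0_pos
      by (intro mult_left_mono power_mono) auto
    finally show ?thesis by (simp add: power_mult[symmetric] mult.commute)
  qed
  moreover have "(\<beta> s * R)\<^sup>2 \<le> c0 * \<beta>0\<^sup>2 * (\<rho> ^ s)\<^sup>2"
    using mult_right_mono[OF c0R'(1), of "(\<beta> s)\<^sup>2"] by (simp add: b power_mult_distrib mult_ac)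
  moreover have "0 \<le> c0 * \<beta>0\<^sup>2 * (\<rho> ^ s)\<^sup>2" using c0_pos by simp
  moreover have "(\<rho> ^ s)\<^sup>2 * (16 * \<gamma> * \<epsilon>0 / \<beta>0 + 8 * c0 * \<beta>0\<^sup>2)
      = 16 * (\<gamma> * \<epsilon>0 / \<beta>0 * (\<rho> ^ s)\<^sup>2) + 8 * (c0 * \<beta>0\<^sup>2 * (\<rho> ^ s)\<^sup>2)"
    by (simp add: algebra_simps)
  moreover have "16 * L s * eps s = 16 * (L s * eps s)" by simp
  ultimately have "16 * L s * eps s + 2 * (\<beta> s * R)\<^sup>2
      \<le> (\<rho> ^ s)\<^sup>2 * (16 * \<gamma> * \<epsilon>0 / \<beta>0 + 8 * c0 * \<beta>0\<^sup>2)"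
    by linarith
  then have "sqrt (16 * L s * eps s + 2 * (\<beta> s * R)\<^sup>2)
      \<le> sqrt ((\<rho> ^ s)\<^sup>2 * (16 * \<gamma> * \<epsilon>0 / \<beta>0 + 8 * c0 * \<beta>0\<^sup>2))" by simp
  also have "\<dots> = \<rho> ^ s * sqrt (16 * \<gamma> * \<epsilon>0 / \<beta>0 + 8 * c0 * \<beta>0\<^sup>2)"
    using \<rho> by (simp add: real_sqrt_mult)
  also have "\<dots> \<le> \<rho> ^ s * c4" using c4(3) \<rho> by (intro mult_left_mono) auto
  also note small
  finally have primal: "(\<integral>\<^sup>+ \<omega>. edist_set 0 (subdiff_lagrangian_x f g p (x s \<omega>) (l (Suc s) \<omega>)) \<partial>M) \<le> ennreal \<epsilon>"
    using mean_primal_residual[OF sad, of s] unfolding R by (meson ennreal_leI order_trans)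
  from primal dual show ?thesis by blast
qed

end
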